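(* Suppose that for some constant $\lambda\ge 0$ the matrix $\Phi_\lambda(s)$ admits a spectral factorization $\Phi_\lambda(s)=\Upsilon_\lambda(s)\Upsilon_\lambda(s)^H$ with $\Upsilon_\lambda$ as described in the context, and let $m_{11}=m$. Let $\bar\gamma>0$ belong to the feasible set of the convex problem $\inf\bar\gamma^2$ over $\bar\gamma^2$ and Hermitian $X_1,Y_1\in\mathbf{C}^{m\times m}$ subject to the constraints $$\bar\gamma^2>\lambda^2,\qquad X_1>0,\quad Y_1>0,\qquad A_\lambda X_1+X_1A_\lambda^\dagger+B_\lambda B_\lambda^\dagger<0,$$ $$\begin{bmatrix}N_c^\dagger&0\\ 0&I_n\end{bmatrix}\begin{bmatrix}A_\lambda^\dagger Y_1+Y_1A_\lambda&Y_1B_\lambda&C_{2,\lambda}^\dagger\\ B_\lambda^\dagger Y_1&-I_p&D_{2,\lambda}^\dagger\\ C_{2,\lambda}&D_{2,\lambda}&-\bar\gamma^2I_n\end{bmatrix}\begin{bmatrix}N_c&0\\ 0&I_n\end{bmatrix}<0,\qquad\begin{bmatrix}X_1&I\\ I&Y_1\end{bmatrix}\ge0$$ (i.e. these constraints hold for this $\bar\gamma$ with some $X_1,Y_1$). If there exists $\theta>0$ such that, with $\gamma=(\bar\gamma^2-\lambda^2)^{1/2}$, $$\theta\left(\Phi(i\omega)-\gamma^2\begin{bmatrix}0&0\\ 0&I_n\end{bmatrix}\right)-\begin{bmatrix}I_{n_y}&0\\ 0&-I_n\end{bmatrix}>0\quad\forall\omega\in\bar{\mathbf{R}},$$ then the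 set $\mathcal{H}_{11,\gamma}^-$ corresponding to this $\gamma$ is not empty and $\gamma\ge\gamma_\circ''=\gamma_\circ$. One transfer function which belongs to this set is given by $$H_{11}(s)=C_{11}(sI-A_{11})^{-1}B_{11}+J_{11},$$ where $A_{11},B_{11},C_{11},J_{11}$ (of dimensions $m_{11}\times m_{11}$, $m_{11}\times n_y$, $n\times m_{11}$, $n\times n_y$) are matrices which render the inequality $$\Sigma_{\hat X}+\Pi^\dagger K^\dagger\Lambda_{\hat X}+\Lambda_{\hat X}^\dagger K\Pi<0$$ true with the chosen $\bar\gamma$ and some $\hat X=\hat X^\dagger>0$. That is, $\gamma=(\bar\gamma^2-\lambda^2)^{1/2}$ and this $H_{11}(s)$ lie in the feasible set of the optimization problem $\gamma_\circ''=\inf\{\gamma>0:\mathcal{H}_{11,\gamma}^-\neq\emptyset\}$.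
   Context: Notation. $^\dagger$ is the complex conjugate transpose of a matrix, $^T$ the transpose, $X(s)^H\triangleq X(-s^* )^\dagger$ for a rational matrix function $X$, $I_k$ the $k\times k$ identity matrix. Inequalities between Hermitian matrices are in the positive (semi)definite order. $\bar{\mathbf{R}}=\mathbf{R}\cup\{\pm\infty\}$ (values at $\pm\infty$ are limits). Channel. $n,n_w,n_y,n_d$ are dimensions with $n_y+n_d=n+n_w$. The channel is given by complex matrices $A,B,C,D$, with $A$ Hurwitz, satisfying $A+A^\dagger+BB^\dagger=0$, $B=-C^\dagger D$, $D^\dagger D=DD^\dagger=I_{n+n_w}$, and $(A,B,C,D)$ is a minimal realization of the $(n_y+n_d)\times(n+n_w)$ transfer function $G(s)=D+C(sI-A)^{-1}B$. $G$ is partitioned as $G=\begin{bmatrix}G_{11}&G_{12}\\ G_{21}&G_{22}\end{bmatrix}$ with $G_{11}$ of size $n_y\times n$ and $G_{12}$ of size $n_y\times n_w$. $\Sigma_u$ ($n\times n$) and $\Sigma_w$ ($n_w\times n_w$) are Hermitian positive definite matrices. Define $$\Psi(s)=G_{11}(s)\Sigma_u^TG_{11}(s)^H+G_{12}(s)\Sigma_w^TG_{12}(s)^H,$$ $$\Phi(s)=\begin{bmatrix}\Psi(s)&-G_{11}(s)(I_n+\Sigma_u^T)\\ -(I_n+\Sigma_u^T)G_{11}(s)^H&\Sigma_u^T+2I_n\end{bmatrix},\qquad \Phi_\lambda(s)=\Phi(s)+\begin{bmatrix}0&0\\ 0&\lambda^2I_n\end{bmatrix}.$$ Filters. $\mathcal{H}_p$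 is the set of admissible equalizers: stable rational $n_f\times n_f$ transfer functions $H(s)$ in the Hardy space $H_\infty$, $n_f=n_y+n_z\ge n$ (the number $n_z$ is not fixed in advance), analytic in $\mathrm{Re}\,s>-\tau$ for some $\tau>0$, and paraunitary: $H(s)^HH(s)=H(s)H(s)^H=I$; $H_{11}$ denotes the top-left $n\times n_y$ block of $H$. For any $n\times n_y$ transfer function $H_{11}$, $$P_e(s)=\begin{bmatrix}H_{11}(s)&I_n\end{bmatrix}\Phi(s)\begin{bmatrix}H_{11}(s)^H\\ I_n\end{bmatrix}.$$ $\gamma_\circ$ is the infimum of all $\gamma>0$ for which there exists $H\in\mathcal{H}_p$ with $P_e(i\omega)<\gamma^2I_n$ for all $\omega\in\mathbf{R}$. For $\gamma>0$, $\mathcal{H}_{11,\gamma}^-$ is the set of proper rational $n\times n_y$ transfer functions $H_{11}$ such that: all poles of $H_{11}$ lie in the open left half-plane and $H_{11}$ is analytic in $\mathrm{Re}\,s>-\tau$ for some $\tau>0$; $P_e(i\omega)<\gamma^2I_n$ for all $\omega\in\mathbf{R}$; and $H_{11}(i\omega)H_{11}(i\omega)^\dagger<I_n$ for all $\omega\in\bar{\mathbf{R}}$. $\gamma_\circ''=\inf\{\gamma>0:\mathcal{H}_{11,\gamma}^-\ne\emptyset\}$. Spectral factor. $\Upsilon_\lambda(s)$ is an $(n_y+n)\times p$ rational matrix with all its poles in $\mathrm{Re}\,s<-\tau$ and analytic in $\mathrm{Re}\,s>-\tau$ for some $\tau>0$. $m$ is its McMillan degree and $$\Upsilon_\lambda(s)=\begin{bmatrix}C_{1,\lambda}\\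 C_{2,\lambda}\end{bmatrix}(sI_m-A_\lambda)^{-1}B_\lambda+\begin{bmatrix}D_{1,\lambda}\\ D_{2,\lambda}\end{bmatrix}$$ is a minimal realization, with $A_\lambda$ ($m\times m$, Hurwitz), $B_\lambda$ ($m\times p$), $C_{1,\lambda}$ ($n_y\times m$), $C_{2,\lambda}$ ($n\times m$), $D_{1,\lambda}$ ($n_y\times p$), $D_{2,\lambda}$ ($n\times p$). $N_c$ is a full rank matrix with $\mathrm{Im}\,N_c=\mathrm{Ker}\begin{bmatrix}C_{1,\lambda}&D_{1,\lambda}\end{bmatrix}$. $m_{11}$ is the filter state dimension. Matrices in the design inequality ($\hat X$ is $(m+m_{11})\times(m+m_{11})$): $$K=\begin{bmatrix}A_{11}^\dagger&C_{11}^\dagger\\ B_{11}^\dagger&J_{11}^\dagger\end{bmatrix},\ \bar A=\begin{bmatrix}A_\lambda^\dagger&0\\ 0&0_{m_{11}\times m_{11}}\end{bmatrix},\ \bar B=\begin{bmatrix}C_{2,\lambda}^\dagger\\ 0_{m_{11}\times n}\end{bmatrix},\ \underline{B}=\begin{bmatrix}0_{m\times m_{11}}&C_{1,\lambda}^\dagger\\ I_{m_{11}}&0_{m_{11}\times n_y}\end{bmatrix},$$ $$\underline{C}=\begin{bmatrix}0_{m_{11}\times m}&I_{m_{11}}\\ 0_{n\times m}&0_{n\times m_{11}}\end{bmatrix},\ \underline{D}_{12}=\begin{bmatrix}0_{p\times m_{11}}&D_{1,\lambda}^\dagger\end{bmatrix},\ \bar C=\begin{bmatrix}B_\lambda^\dagger&0_{p\times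 m_{11}}\end{bmatrix},\ \bar D=D_{2,\lambda}^\dagger,\ \underline{D}_{21}=\begin{bmatrix}0_{m_{11}\times n}\\ I_n\end{bmatrix},$$ $$\Sigma_{\hat X}=\begin{bmatrix}\bar A^\dagger\hat X+\hat X\bar A&\hat X\bar B&\bar C^\dagger\\ \bar B^\dagger\hat X&-\bar\gamma^2I_n&\bar D^\dagger\\ \bar C&\bar D&-I_p\end{bmatrix},\quad\Lambda_{\hat X}=\begin{bmatrix}\underline{B}^\dagger\hat X&0_{(m_{11}+n_y)\times n}&\underline{D}_{12}^\dagger\end{bmatrix},\quad\Pi=\begin{bmatrix}\underline{C}&\underline{D}_{21}&0_{(m_{11}+n)\times p}\end{bmatrix}.$$ *)

theory Defs
  imports
    "HOL-Complex_Analysis.Complex_Analysis"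
    "HOL-Library.Extended_Real"
    "Jordan_Normal_Form.Schur_Decomposition"
    "Jordan_Normal_Form.Gauss_Jordan_Elimination"
    "Jordan_Normal_Form.Matrix_Kernel"
    "Jordan_Normal_Form.DL_Rank"
begin

text \<open>
  Matrices are those of Jordan_Normal_Form, with dimensions given by natural numbers. A rational
  matrix function is a map from complex numbers to complex matrices; its values at the finitely
  many points where the underlying quotients of polynomials are undefined carry no information.
  Hence identities between rational matrix functions are required at all but finitely many points.
\<close>

unbundle no vec_syntax
unbundle no inner_syntax
hide_type (open) Finite_Cartesian_Product.vec
hide_const (open) Finite_Cartesian_Product.vec Finite_Cartesian_Product.mat
  Finite_Cartesian_Product.row Finite_Cartesian_Product.column Determinants.det
  Finite_Cartesian_Product.transpose

notation mat_adjoint (\<open>(_\<^sup>\<dagger>)\<close> [1000] 1000)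

definition append_cols :: "complex mat \<Rightarrow> complex mat \<Rightarrow> complex mat" (infixr \<open>@\<^sub>c\<close> 64) where
  "A @\<^sub>c B = four_block_mat A B (0\<^sub>m 0 (dim_col A)) (0\<^sub>m 0 (dim_col B))"

definition hermitian :: "complex mat \<Rightarrow> bool" where
  "hermitian A \<longleftrightarrow> A\<^sup>\<dagger> = A"

text \<open>The order on matrices provided by Jordan_Normal_Form is entrywise; the relations below are
  the positive (semi)definite order.\<close>

definition pos_def :: "complex mat \<Rightarrow> bool" where
  "pos_def A \<longleftrightarrow> hermitian A \<and>
     (\<forall>v \<in> carrier_vec (dim_row A). v \<noteq> 0\<^sub>v (dim_row A) \<longrightarrow> Re ((A *\<^sub>v v) \<bullet>c v) > 0)"

definition pos_semidef :: "complex mat \<Rightarrow> bool" where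
  "pos_semidef A \<longleftrightarrow> hermitian A \<and> (\<forall>v \<in> carrier_vec (dim_row A). Re ((A *\<^sub>v v) \<bullet>c v) \<ge> 0)"

definition mat_less :: "complex mat \<Rightarrow> complex mat \<Rightarrow> bool" (infix \<open>\<prec>\<close> 50) where
  "A \<prec> B \<longleftrightarrow> pos_def (B - A)"

definition neg_def :: "complex mat \<Rightarrow> bool" where
  "neg_def A \<longleftrightarrow> pos_def (- A)"

definition hurwitz :: "complex mat \<Rightarrow> bool" where
  "hurwitz A \<longleftrightarrow> (\<forall>e. eigenvalue A e \<longrightarrow> Re e < 0)"

definition full_rank :: "complex mat \<Rightarrow> bool" where
  "full_rank N \<longleftrightarrow> vec_space.rank (dim_row N) N = min (dim_row N) (dim_col N)"

definition mat_image :: "complex mat \<Rightarrow> complex vec set" where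
  "mat_image N = (\<lambda>v. N *\<^sub>v v) ` carrier_vec (dim_col N)"

text \<open>Singular matrices get the junk value zero, so that \<open>state_space\<close> below equals \<open>D\<close> at the
  eigenvalues of \<open>A\<close>.\<close>

definition mat_inv :: "complex mat \<Rightarrow> complex mat" where
  "mat_inv A = (case mat_inverse A of Some B \<Rightarrow> B | None \<Rightarrow> 0\<^sub>m (dim_row A) (dim_col A))"

type_synonym tfun = "complex \<Rightarrow> complex mat"

definition rational_mat :: "nat \<Rightarrow> nat \<Rightarrow> tfun \<Rightarrow> bool" where
  "rational_mat r c X \<longleftrightarrow> (\<forall>s. X s \<in> carrier_mat r c) \<and>
     (\<forall>i<r. \<forall>j<c. \<exists>p q. q \<noteq> 0 \<and>
        (\<forall>s. poly q s \<noteq> 0 \<longrightarrow> X s $$ (i, j) = poly p s / poly q s))"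

definition proper_rational_mat :: "nat \<Rightarrow> nat \<Rightarrow> tfun \<Rightarrow> bool" where
  "proper_rational_mat r c X \<longleftrightarrow> (\<forall>s. X s \<in> carrier_mat r c) \<and>
     (\<forall>i<r. \<forall>j<c. \<exists>p q. q \<noteq> 0 \<and> degree p \<le> degree q \<and>
        (\<forall>s. poly q s \<noteq> 0 \<longrightarrow> X s $$ (i, j) = poly p s / poly q s))"

definition pole :: "tfun \<Rightarrow> complex \<Rightarrow> bool" where
  "pole X s \<longleftrightarrow> (\<exists>i<dim_row (X s). \<exists>j<dim_col (X s). is_pole (\<lambda>z. X z $$ (i, j)) s)"

definition analytic_mat :: "tfun \<Rightarrow> complex set \<Rightarrow> bool" where
  "analytic_mat X S \<longleftrightarrow>
     (\<forall>i<dim_row (X 0). \<forall>j<dim_col (X 0). (\<lambda>z. X z $$ (i, j)) analytic_on S)"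

definition hardy_inf :: "tfun \<Rightarrow> bool" where
  "hardy_inf X \<longleftrightarrow> analytic_mat X {s. Re s > 0} \<and>
     (\<exists>M. \<forall>s. Re s > 0 \<longrightarrow>
        (\<forall>i<dim_row (X s). \<forall>j<dim_col (X s). cmod (X s $$ (i, j)) \<le> M))"

definition para_conj :: "tfun \<Rightarrow> tfun" (\<open>(_\<^sup>H)\<close> [1000] 1000) where
  "X\<^sup>H = (\<lambda>s. (X (- cnj s))\<^sup>\<dagger>)"

definition tf_eq :: "tfun \<Rightarrow> tfun \<Rightarrow> bool" (infix \<open>\<doteq>\<close> 50) where
  "X \<doteq> Y \<longleftrightarrow> (\<forall>\<^sub>F s in cofinite. X s = Y s)"

text \<open>The value at \<open>i\<omega>\<close> for extended real \<open>\<omega>\<close>; at the infinite points it is the entrywise limit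
  along the imaginary axis.\<close>

definition freq_value :: "tfun \<Rightarrow> ereal \<Rightarrow> complex mat" where
  "freq_value X \<omega> = (case \<omega> of
       ereal r \<Rightarrow> X (\<i> * of_real r)
     | PInfty \<Rightarrow> mat (dim_row (X 0)) (dim_col (X 0))
                  (\<lambda>(i, j). Lim at_top (\<lambda>r. X (\<i> * of_real r) $$ (i, j)))
     | MInfty \<Rightarrow> mat (dim_row (X 0)) (dim_col (X 0))
                  (\<lambda>(i, j). Lim at_bot (\<lambda>r. X (\<i> * of_real r) $$ (i, j))))"

definition state_space ::
  "complex mat \<Rightarrow> complex mat \<Rightarrow> complex mat \<Rightarrow> complex mat \<Rightarrow> tfun" where
  "state_space A B C D = (\<lambda>s. D + C * mat_inv (s \<cdot>\<^sub>m 1\<^sub>m (dim_row A) - A) * B)"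

definition is_realization ::
  "nat \<Rightarrow> nat \<Rightarrow> nat \<Rightarrow> complex mat \<Rightarrow> complex mat \<Rightarrow> complex mat \<Rightarrow> complex mat \<Rightarrow> tfun \<Rightarrow> bool" where
  "is_realization r c m A B C D X \<longleftrightarrow>
     A \<in> carrier_mat m m \<and> B \<in> carrier_mat m c \<and> C \<in> carrier_mat r m \<and> D \<in> carrier_mat r c \<and>
     X \<doteq> state_space A B C D"

definition mcmillan_degree :: "nat \<Rightarrow> nat \<Rightarrow> tfun \<Rightarrow> nat" where
  "mcmillan_degree r c X = (LEAST m. \<exists>A B C D. is_realization r c m A B C D X)"

definition minimal_realization ::
  "nat \<Rightarrow> nat \<Rightarrow> nat \<Rightarrow> complex mat \<Rightarrow> complex mat \<Rightarrow> complex mat \<Rightarrow> complex mat \<Rightarrow> tfun \<Rightarrow> bool" where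
  "minimal_realization r c m A B C D X \<longleftrightarrow>
     is_realization r c m A B C D X \<and> m = mcmillan_degree r c X"

text \<open>\<open>k\<close> is the state dimension of the channel.\<close>

definition quantum_channel ::
  "nat \<Rightarrow> nat \<Rightarrow> nat \<Rightarrow> nat \<Rightarrow> nat \<Rightarrow> complex mat \<Rightarrow> complex mat \<Rightarrow> complex mat \<Rightarrow> complex mat \<Rightarrow> bool"
where
  "quantum_channel n nw ny nd k A B C D \<longleftrightarrow>
     ny + nd = n + nw \<and> hurwitz A \<and>
     minimal_realization (ny + nd) (n + nw) k A B C D (state_space A B C D) \<and>
     A + A\<^sup>\<dagger> + B * B\<^sup>\<dagger> = 0\<^sub>m k k \<and> B = - (C\<^sup>\<dagger> * D) \<and>
     D\<^sup>\<dagger> * D = 1\<^sub>m (n + nw) \<and> D * D\<^sup>\<dagger> = 1\<^sub>m (n + nw)"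

definition G11 :: "nat \<Rightarrow> nat \<Rightarrow> tfun \<Rightarrow> tfun" where
  "G11 n ny G = (\<lambda>s. mat ny n (\<lambda>(i, j). G s $$ (i, j)))"

definition G12 :: "nat \<Rightarrow> nat \<Rightarrow> nat \<Rightarrow> tfun \<Rightarrow> tfun" where
  "G12 n nw ny G = (\<lambda>s. mat ny nw (\<lambda>(i, j). G s $$ (i, n + j)))"

definition Psi :: "nat \<Rightarrow> nat \<Rightarrow> nat \<Rightarrow> tfun \<Rightarrow> complex mat \<Rightarrow> complex mat \<Rightarrow> tfun" where
  "Psi n nw ny G Su Sw = (\<lambda>s.
     G11 n ny G s * transpose_mat Su * (G11 n ny G)\<^sup>H s +
     G12 n nw ny G s * transpose_mat Sw * (G12 n nw ny G)\<^sup>H s)"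

definition Phi :: "nat \<Rightarrow> nat \<Rightarrow> nat \<Rightarrow> tfun \<Rightarrow> complex mat \<Rightarrow> complex mat \<Rightarrow> tfun" where
  "Phi n nw ny G Su Sw = (\<lambda>s. four_block_mat
     (Psi n nw ny G Su Sw s)
     (- (G11 n ny G s * (1\<^sub>m n + transpose_mat Su)))
     (- ((1\<^sub>m n + transpose_mat Su) * (G11 n ny G)\<^sup>H s))
     (transpose_mat Su + 2 \<cdot>\<^sub>m 1\<^sub>m n))"

definition E22 :: "nat \<Rightarrow> nat \<Rightarrow> complex mat" where
  "E22 n ny = four_block_mat (0\<^sub>m ny ny) (0\<^sub>m ny n) (0\<^sub>m n ny) (1\<^sub>m n)"

definition Phi_lambda ::
  "nat \<Rightarrow> nat \<Rightarrow> nat \<Rightarrow> tfun \<Rightarrow> complex mat \<Rightarrow> complex mat \<Rightarrow> real \<Rightarrow> tfun" where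
  "Phi_lambda n nw ny G Su Sw l =
     (\<lambda>s. Phi n nw ny G Su Sw s + complex_of_real (l\<^sup>2) \<cdot>\<^sub>m E22 n ny)"

definition P_e ::
  "nat \<Rightarrow> nat \<Rightarrow> nat \<Rightarrow> tfun \<Rightarrow> complex mat \<Rightarrow> complex mat \<Rightarrow> tfun \<Rightarrow> tfun" where
  "P_e n nw ny G Su Sw H11 =
     (\<lambda>s. (H11 s @\<^sub>c 1\<^sub>m n) * Phi n nw ny G Su Sw s * (H11\<^sup>H s @\<^sub>r 1\<^sub>m n))"

definition admissible_equalizers :: "nat \<Rightarrow> nat \<Rightarrow> tfun set" where
  "admissible_equalizers n ny = {H. \<exists>nz nf. nf = ny + nz \<and> nf \<ge> n \<and>
     rational_mat nf nf H \<and> (\<forall>s. pole H s \<longrightarrow> Re s < 0) \<and> hardy_inf H \<and>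
     (\<exists>\<tau>>0. analytic_mat H {s. Re s > - \<tau>}) \<and>
     (\<lambda>s. H\<^sup>H s * H s) \<doteq> (\<lambda>s. 1\<^sub>m nf) \<and> (\<lambda>s. H s * H\<^sup>H s) \<doteq> (\<lambda>s. 1\<^sub>m nf)}"

definition top_left :: "nat \<Rightarrow> nat \<Rightarrow> tfun \<Rightarrow> tfun" where
  "top_left n ny H = (\<lambda>s. mat n ny (\<lambda>(i, j). H s $$ (i, j)))"

text \<open>The infima are taken in the extended reals: an infeasible problem has the value \<open>\<infinity>\<close>.\<close>

definition gamma_opt ::
  "nat \<Rightarrow> nat \<Rightarrow> nat \<Rightarrow> tfun \<Rightarrow> complex mat \<Rightarrow> complex mat \<Rightarrow> ereal" where
  "gamma_opt n nw ny G Su Sw = Inf (ereal ` {\<gamma>. \<gamma> > 0 \<and>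
     (\<exists>H \<in> admissible_equalizers n ny. \<forall>\<omega>::real.
        P_e n nw ny G Su Sw (top_left n ny H) (\<i> * of_real \<omega>)
          \<prec> complex_of_real (\<gamma>\<^sup>2) \<cdot>\<^sub>m 1\<^sub>m n)})"

definition H11_minus ::
  "nat \<Rightarrow> nat \<Rightarrow> nat \<Rightarrow> tfun \<Rightarrow> complex mat \<Rightarrow> complex mat \<Rightarrow> real \<Rightarrow> tfun set" where
  "H11_minus n nw ny G Su Sw \<gamma> = {H11. proper_rational_mat n ny H11 \<and>
     (\<forall>s. pole H11 s \<longrightarrow> Re s < 0) \<and> (\<exists>\<tau>>0. analytic_mat H11 {s. Re s > - \<tau>}) \<and>
     (\<forall>\<omega>::real. P_e n nw ny G Su Sw H11 (\<i> * of_real \<omega>)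
        \<prec> complex_of_real (\<gamma>\<^sup>2) \<cdot>\<^sub>m 1\<^sub>m n) \<and>
     (\<forall>\<omega>::ereal. freq_value H11 \<omega> * (freq_value H11 \<omega>)\<^sup>\<dagger> \<prec> 1\<^sub>m n)}"

definition gamma_opt'' ::
  "nat \<Rightarrow> nat \<Rightarrow> nat \<Rightarrow> tfun \<Rightarrow> complex mat \<Rightarrow> complex mat \<Rightarrow> ereal" where
  "gamma_opt'' n nw ny G Su Sw =
     Inf (ereal ` {\<gamma>. \<gamma> > 0 \<and> H11_minus n nw ny G Su Sw \<gamma> \<noteq> {}})"

text \<open>The constraints of the convex problem; \<open>g\<close> is the optimization variable whose square is
  minimized, and \<open>N\<close> spans the kernel of \<open>C1 @\<^sub>c D1\<close>.\<close>

definition lmi_feasible ::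
  "nat \<Rightarrow> nat \<Rightarrow> nat \<Rightarrow> real \<Rightarrow> complex mat \<Rightarrow> complex mat \<Rightarrow> complex mat \<Rightarrow> complex mat \<Rightarrow>
   complex mat \<Rightarrow> real \<Rightarrow> complex mat \<Rightarrow> complex mat \<Rightarrow> bool" where
  "lmi_feasible m n p l A B C2 D2 N g X1 Y1 \<longleftrightarrow>
     X1 \<in> carrier_mat m m \<and> Y1 \<in> carrier_mat m m \<and> hermitian X1 \<and> hermitian Y1 \<and>
     g\<^sup>2 > l\<^sup>2 \<and> pos_def X1 \<and> pos_def Y1 \<and>
     neg_def (A * X1 + X1 * A\<^sup>\<dagger> + B * B\<^sup>\<dagger>) \<and>
     neg_def (
       four_block_mat N\<^sup>\<dagger> (0\<^sub>m (dim_col N) n) (0\<^sub>m n (m + p)) (1\<^sub>m n) *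
       ((A\<^sup>\<dagger> * Y1 + Y1 * A @\<^sub>c Y1 * B        @\<^sub>c C2\<^sup>\<dagger>) @\<^sub>r
        (B\<^sup>\<dagger> * Y1          @\<^sub>c - 1\<^sub>m p         @\<^sub>c D2\<^sup>\<dagger>) @\<^sub>r
        (C2               @\<^sub>c D2            @\<^sub>c - (complex_of_real (g\<^sup>2) \<cdot>\<^sub>m 1\<^sub>m n))) *
       four_block_mat N (0\<^sub>m (m + p) n) (0\<^sub>m n (dim_col N)) (1\<^sub>m n)) \<and>
     pos_semidef (four_block_mat X1 (1\<^sub>m m) (1\<^sub>m m) Y1)"

definition K_mat :: "complex mat \<Rightarrow> complex mat \<Rightarrow> complex mat \<Rightarrow> complex mat \<Rightarrow> complex mat" where
  "K_mat A11 B11 C11 J11 = four_block_mat A11\<^sup>\<dagger> C11\<^sup>\<dagger> B11\<^sup>\<dagger> J11\<^sup>\<dagger>"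

definition A_bar :: "nat \<Rightarrow> nat \<Rightarrow> complex mat \<Rightarrow> complex mat" where
  "A_bar m m11 A = four_block_mat A\<^sup>\<dagger> (0\<^sub>m m m11) (0\<^sub>m m11 m) (0\<^sub>m m11 m11)"

definition B_bar :: "nat \<Rightarrow> nat \<Rightarrow> complex mat \<Rightarrow> complex mat" where
  "B_bar m11 n C2 = C2\<^sup>\<dagger> @\<^sub>r 0\<^sub>m m11 n"

definition B_under :: "nat \<Rightarrow> nat \<Rightarrow> nat \<Rightarrow> complex mat \<Rightarrow> complex mat" where
  "B_under m m11 ny C1 = four_block_mat (0\<^sub>m m m11) C1\<^sup>\<dagger> (1\<^sub>m m11) (0\<^sub>m m11 ny)"

definition C_under :: "nat \<Rightarrow> nat \<Rightarrow> nat \<Rightarrow> complex mat" where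
  "C_under m m11 n = four_block_mat (0\<^sub>m m11 m) (1\<^sub>m m11) (0\<^sub>m n m) (0\<^sub>m n m11)"

definition D12_under :: "nat \<Rightarrow> nat \<Rightarrow> complex mat \<Rightarrow> complex mat" where
  "D12_under m11 p D1 = 0\<^sub>m p m11 @\<^sub>c D1\<^sup>\<dagger>"

definition C_bar :: "nat \<Rightarrow> nat \<Rightarrow> complex mat \<Rightarrow> complex mat" where
  "C_bar m11 p B = B\<^sup>\<dagger> @\<^sub>c 0\<^sub>m p m11"

definition D_bar :: "complex mat \<Rightarrow> complex mat" where
  "D_bar D2 = D2\<^sup>\<dagger>"

definition D21_under :: "nat \<Rightarrow> nat \<Rightarrow> complex mat" where
  "D21_under m11 n = 0\<^sub>m m11 n @\<^sub>r 1\<^sub>m n"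

definition Sigma_X ::
  "nat \<Rightarrow> nat \<Rightarrow> nat \<Rightarrow> nat \<Rightarrow> complex mat \<Rightarrow> complex mat \<Rightarrow> complex mat \<Rightarrow> complex mat \<Rightarrow>
   real \<Rightarrow> complex mat \<Rightarrow> complex mat" where
  "Sigma_X m m11 n p A B C2 D2 g X = (
     let Ab = A_bar m m11 A; Bb = B_bar m11 n C2; Cb = C_bar m11 p B; Db = D_bar D2 in
     (Ab\<^sup>\<dagger> * X + X * Ab @\<^sub>c X * Bb                          @\<^sub>c Cb\<^sup>\<dagger>) @\<^sub>r
     (Bb\<^sup>\<dagger> * X          @\<^sub>c - (complex_of_real (g\<^sup>2) \<cdot>\<^sub>m 1\<^sub>m n) @\<^sub>c Db\<^sup>\<dagger>) @\<^sub>r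
     (Cb               @\<^sub>c Db                              @\<^sub>c - 1\<^sub>m p))"

definition Lambda_X ::
  "nat \<Rightarrow> nat \<Rightarrow> nat \<Rightarrow> nat \<Rightarrow> nat \<Rightarrow> complex mat \<Rightarrow> complex mat \<Rightarrow> complex mat \<Rightarrow> complex mat" where
  "Lambda_X m m11 n ny p C1 D1 X =
     (B_under m m11 ny C1)\<^sup>\<dagger> * X @\<^sub>c 0\<^sub>m (m11 + ny) n @\<^sub>c (D12_under m11 p D1)\<^sup>\<dagger>"

definition Pi_mat :: "nat \<Rightarrow> nat \<Rightarrow> nat \<Rightarrow> nat \<Rightarrow> complex mat" where
  "Pi_mat m m11 n p = C_under m m11 n @\<^sub>c D21_under m11 n @\<^sub>c 0\<^sub>m (m11 + n) p"

text \<open>This is the bounded real inequality with bound \<open>g\<close> for the realization of the adjoint of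
  \<open>(H11 @\<^sub>c 1\<^sub>m n) * \<Upsilon>\<close> whose state matrix is
  \<open>A_bar + B_under * K * C_under\<close>.\<close>

definition design_inequality ::
  "nat \<Rightarrow> nat \<Rightarrow> nat \<Rightarrow> nat \<Rightarrow> nat \<Rightarrow> complex mat \<Rightarrow> complex mat \<Rightarrow> complex mat \<Rightarrow> complex mat \<Rightarrow>
   complex mat \<Rightarrow> complex mat \<Rightarrow> real \<Rightarrow>
   complex mat \<Rightarrow> complex mat \<Rightarrow> complex mat \<Rightarrow> complex mat \<Rightarrow> bool" where
  "design_inequality m m11 n ny p A B C1 C2 D1 D2 g A11 B11 C11 J11 \<longleftrightarrow>
     A11 \<in> carrier_mat m11 m11 \<and> B11 \<in> carrier_mat m11 ny \<and>
     C11 \<in> carrier_mat n m11 \<and> J11 \<in> carrier_mat n ny \<and>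
     (\<exists>X \<in> carrier_mat (m + m11) (m + m11). hermitian X \<and> pos_def X \<and>
       (let K = K_mat A11 B11 C11 J11; P = Pi_mat m m11 n p; L = Lambda_X m m11 n ny p C1 D1 X in
        neg_def (Sigma_X m m11 n p A B C2 D2 g X + P\<^sup>\<dagger> * K\<^sup>\<dagger> * L + L\<^sup>\<dagger> * K * P)))"

end

theory Submission imports Defs begin

text \<open>
  On the imaginary axis \<open>H11\<^sup>H\<close> is the adjoint of \<open>H11\<close>, so a filter enters the error spectrum only
  through the vectors \<open>H11\<^sup>\<dagger> u\<close>: the form of \<open>P_e\<close> at \<open>u\<close> is the form of \<open>Phi\<close> at \<open>(H11\<^sup>\<dagger> u, u)\<close>.

  To see that design matrices give feasible filters, consider the linear system with input \<open>u\<close> in which the adjoint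
  of the filter produces \<open>y = H11\<^sup>\<dagger> u\<close> and feeds the adjoint of the spectral factor, whose output is
  \<open>z = \<Upsilon>\<^sup>\<dagger> (y, u)\<close>. The design inequality says that its matrix variable is a storage function of this
  system for the supply rate \<open>gbar\<^sup>2 |u|\<^sup>2 - |z|\<^sup>2\<close> (\<open>design_dissipation\<close>). For \<open>u = 0\<close> this forces the
  filter to be stable (\<open>design_hurwitz\<close>). At \<open>s = i\<omega>\<close> the storage term drops out and
  \<open>|z|\<^sup>2 < gbar\<^sup>2 |u|\<^sup>2\<close> remains (\<open>design_gain\<close>); since \<open>\<Upsilon> \<Upsilon>\<^sup>\<dagger> = Phi + l\<^sup>2 E22\<close>, this is the bound
  \<open>P_e < g\<^sup>2\<close>. The hypothesis on \<open>\<theta>\<close>, evaluated at \<open>(H11\<^sup>\<dagger> u, u)\<close>, turns that bound into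
  \<open>|H11\<^sup>\<dagger> u| < |u|\<close> (\<open>theta_contraction\<close>).

  Design matrices exist because the filter matrices enter the design inequality affinely, through one
  matrix \<open>K\<close>, and can be eliminated by the projection lemma: a suitable \<open>K\<close> exists as soon as the
  inequality without \<open>K\<close> holds on the kernels of the two factors around \<open>K\<close>. For the storage matrix
  with rows \<open>(S, Q)\<close> and \<open>(Q, Q)\<close>, where \<open>S\<close> is \<open>X1\<close> plus a small multiple of the identity and
  \<open>Q = S - Y1\<^sup>-\<^sup>1\<close>, the two kernel conditions are the Lyapunov inequality and the inequality projected
  by \<open>Nc\<close> (\<open>completion_matrix\<close>, \<open>design_exists\<close>).

  It remains to compare the two infima. As the form of \<open>P_e\<close> is convex in \<open>H11\<close>, replacing \<open>H11\<close> by \<open>t H11\<close> with \<open>t < 1\<close> close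
  to 1 raises \<open>P_e\<close> arbitrarily little (\<open>error_form_scale\<close>). A corner of a unitary matrix is a
  contraction, so scaled corners of equalizers satisfy the strict constraints. Conversely a stable
  \<open>F = t H11\<close> with \<open>|F| \<le> t\<close> is a corner of a stable paraunitary matrix. In the disc variable write
  \<open>F = N / d\<close>. On the circle \<open>|d|\<^sup>2 - N\<^sup>\<dagger> N\<close> is uniformly positive, hence it is \<open>G\<^sup>\<dagger> G\<close> for a polynomial
  matrix \<open>G\<close> (\<open>fejer_sos\<close>), and the column \<open>V = (N, G) / d\<close> is isometric. A Halmos dilation of \<open>V\<close>,
  made stable by a scalar inner factor, is square and paraunitary (\<open>paraunitary_completion\<close>).
\<close>

text \<open>The dollar sign denotes vector entries throughout.\<close>

no_notation fps_nth (infixl \<open>$\<close> 75)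

abbreviation (input) sqnorm :: "complex vec \<Rightarrow> real" where
  "sqnorm v \<equiv> Re (v \<bullet>c v)"

abbreviation (input) im_axis :: "real \<Rightarrow> complex" where
  "im_axis x \<equiv> \<i> * complex_of_real x"

section \<open>Inner products and adjoints\<close>

lemma cscalar_prod_sum: "dim_vec v = dim_vec w \<Longrightarrow> v \<bullet>c w = (\<Sum>i<dim_vec w. v $ i * cnj (w $ i))"
  unfolding scalar_prod_def by (auto simp: atLeast0LessThan intro!: sum.cong)

lemma dim_adjoint [simp]: "dim_row A\<^sup>\<dagger> = dim_col A" "dim_col A\<^sup>\<dagger> = dim_row A"
  unfolding mat_adjoint_def by auto

lemma adjoint_carrier [simp]: "A \<in> carrier_mat r c \<Longrightarrow> A\<^sup>\<dagger> \<in> carrier_mat c r"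
  by (auto intro!: carrier_matI)

lemma index_adjoint [simp]: "i < dim_col A \<Longrightarrow> j < dim_row A \<Longrightarrow> A\<^sup>\<dagger> $$ (i, j) = cnj (A $$ (j, i))"
  unfolding mat_adjoint_def by (simp add: mat_of_rows_def)

lemma adjoint_adjoint [simp]: "(A::complex mat)\<^sup>\<dagger>\<^sup>\<dagger> = A"
  by (rule eq_matI) auto

lemma mult_vec_sum:
  "dim_col M = dim_vec v \<Longrightarrow> i < dim_row M \<Longrightarrow> (M *\<^sub>v v) $ i = (\<Sum>j<dim_vec v. M $$ (i, j) * v $ j)"
  by (auto simp: scalar_prod_def atLeast0LessThan intro!: sum.cong)

lemma mult_mat_sum:
  "dim_col M = dim_row N \<Longrightarrow> i < dim_row M \<Longrightarrow> j < dim_col N \<Longrightarrow>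
    (M * N) $$ (i, j) = (\<Sum>k<dim_row N. M $$ (i, k) * N $$ (k, j))"
  by (auto simp: scalar_prod_def atLeast0LessThan intro!: sum.cong)

lemma adjoint_mult:
  fixes A B :: "complex mat"
  assumes "dim_col A = dim_row B"
  shows "(A * B)\<^sup>\<dagger> = B\<^sup>\<dagger> * A\<^sup>\<dagger>"
proof (rule eq_matI)
  fix i j assume ij: "i < dim_row (B\<^sup>\<dagger> * A\<^sup>\<dagger>)" "j < dim_col (B\<^sup>\<dagger> * A\<^sup>\<dagger>)"
  have "(A * B)\<^sup>\<dagger> $$ (i, j) = cnj ((A * B) $$ (j, i))" using ij by (simp del: index_mult_mat(1))
  also have "\<dots> = (\<Sum>k<dim_row B. cnj (A $$ (j, k)) * cnj (B $$ (k, i)))"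
    using ij assms by (subst mult_mat_sum) auto
  also have "\<dots> = (\<Sum>k<dim_row B. B\<^sup>\<dagger> $$ (i, k) * A\<^sup>\<dagger> $$ (k, j))"
    using ij assms by (intro sum.cong) auto
  also have "\<dots> = (B\<^sup>\<dagger> * A\<^sup>\<dagger>) $$ (i, j)" using ij assms by (subst mult_mat_sum) auto
  finally show "(A * B)\<^sup>\<dagger> $$ (i, j) = (B\<^sup>\<dagger> * A\<^sup>\<dagger>) $$ (i, j)" .
qed auto

lemma adjoint_add:
  "dim_row A = dim_row B \<Longrightarrow> dim_col A = dim_col B \<Longrightarrow> (A + B)\<^sup>\<dagger> = A\<^sup>\<dagger> + (B::complex mat)\<^sup>\<dagger>"
  by (rule eq_matI) auto

lemma adjoint_minus:
  "dim_row A = dim_row B \<Longrightarrow> dim_col A = dim_col B \<Longrightarrow> (A - B)\<^sup>\<dagger> = A\<^sup>\<dagger> - (B::complex mat)\<^sup>\<dagger>"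
  by (rule eq_matI) auto

lemma adjoint_uminus: "(- A)\<^sup>\<dagger> = - (A::complex mat)\<^sup>\<dagger>"
  by (rule eq_matI) auto

lemma adjoint_smult: "(c \<cdot>\<^sub>m A)\<^sup>\<dagger> = cnj c \<cdot>\<^sub>m (A::complex mat)\<^sup>\<dagger>"
  by (rule eq_matI) auto

lemma adjoint_one [simp]: "(1\<^sub>m n :: complex mat)\<^sup>\<dagger> = 1\<^sub>m n"
  by (rule eq_matI) auto

lemma adjoint_zero [simp]: "(0\<^sub>m r c :: complex mat)\<^sup>\<dagger> = 0\<^sub>m c r"
  by (rule eq_matI) auto

lemma adjoint_four_block:
  assumes "A \<in> carrier_mat r1 c1" "B \<in> carrier_mat r1 c2" "C \<in> carrier_mat r2 c1" "D \<in> carrier_mat r2 c2"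
  shows "(four_block_mat A B C D)\<^sup>\<dagger> = four_block_mat A\<^sup>\<dagger> C\<^sup>\<dagger> B\<^sup>\<dagger> (D::complex mat)\<^sup>\<dagger>"
  using assms by (intro eq_matI) auto

lemma cscalar_adjoint:
  fixes A :: "complex mat"
  assumes "dim_col A = dim_vec v" "dim_row A = dim_vec w"
  shows "(A *\<^sub>v v) \<bullet>c w = v \<bullet>c (A\<^sup>\<dagger> *\<^sub>v w)"
proof -
  have "(A *\<^sub>v v) \<bullet>c w = (\<Sum>i<dim_vec w. (A *\<^sub>v v) $ i * cnj (w $ i))"
    using assms by (intro cscalar_prod_sum) simp
  also have "\<dots> = (\<Sum>i<dim_vec w. \<Sum>j<dim_vec v. A $$ (i,j) * v $ j * cnj (w $ i))"
    using assms by (intro sum.cong refl) (simp add: mult_vec_sum sum_distrib_right del: index_mult_mat_vec)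
  also have "\<dots> = (\<Sum>j<dim_vec v. \<Sum>i<dim_vec w. A $$ (i,j) * v $ j * cnj (w $ i))"
    by (rule sum.swap)
  also have "\<dots> = (\<Sum>j<dim_vec v. v $ j * cnj (\<Sum>i<dim_vec w. A\<^sup>\<dagger> $$ (j,i) * w $ i))"
    using assms by (intro sum.cong refl) (simp add: sum_distrib_left mult_ac)
  also have "\<dots> = (\<Sum>j<dim_vec (A\<^sup>\<dagger> *\<^sub>v w). v $ j * cnj ((A\<^sup>\<dagger> *\<^sub>v w) $ j))"
    using assms by (intro sum.cong) (simp_all add: mult_vec_sum del: index_mult_mat_vec)
  also have "\<dots> = v \<bullet>c (A\<^sup>\<dagger> *\<^sub>v w)"
    using assms by (intro cscalar_prod_sum[symmetric]) simp
  finally show ?thesis .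
qed

lemma cscalar_cnj: "dim_vec (v::complex vec) = dim_vec w \<Longrightarrow> cnj (v \<bullet>c w) = w \<bullet>c v"
  by (simp add: cscalar_prod_sum mult.commute)

lemma Re_cscalar_commute: "dim_vec (v::complex vec) = dim_vec w \<Longrightarrow> Re (v \<bullet>c w) = Re (w \<bullet>c v)"
  using cnj.sel(1)[of "v \<bullet>c w"] by (simp only: cscalar_cnj)

lemma cscalar_add_left: "dim_vec (u::complex vec) = dim_vec w \<Longrightarrow> dim_vec v = dim_vec w \<Longrightarrow> (u + v) \<bullet>c w = u \<bullet>c w + v \<bullet>c w"
  by (simp add: cscalar_prod_sum sum.distrib algebra_simps)

lemma cscalar_add_right: "dim_vec (u::complex vec) = dim_vec w \<Longrightarrow> dim_vec v = dim_vec w \<Longrightarrow> w \<bullet>c (u + v) = w \<bullet>c u + w \<bullet>c v"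
  by (simp add: cscalar_prod_sum sum.distrib algebra_simps)

lemma cscalar_minus_left: "dim_vec (u::complex vec) = dim_vec w \<Longrightarrow> dim_vec v = dim_vec w \<Longrightarrow> (u - v) \<bullet>c w = u \<bullet>c w - v \<bullet>c w"
  by (simp add: cscalar_prod_sum sum_subtractf algebra_simps)

lemma cscalar_minus_right: "dim_vec (u::complex vec) = dim_vec w \<Longrightarrow> dim_vec v = dim_vec w \<Longrightarrow> w \<bullet>c (u - v) = w \<bullet>c u - w \<bullet>c v"
  by (simp add: cscalar_prod_sum sum_subtractf algebra_simps)

lemma cscalar_smult_left: "dim_vec (v::complex vec) = dim_vec w \<Longrightarrow> (c \<cdot>\<^sub>v v) \<bullet>c w = c * (v \<bullet>c w)"
  by (simp add: cscalar_prod_sum sum_distrib_left mult_ac)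

lemma cscalar_smult_right: "dim_vec (v::complex vec) = dim_vec w \<Longrightarrow> v \<bullet>c (c \<cdot>\<^sub>v w) = cnj c * (v \<bullet>c w)"
  by (simp add: cscalar_prod_sum sum_distrib_left mult_ac)

lemma cscalar_uminus_left: "dim_vec (v::complex vec) = dim_vec w \<Longrightarrow> (- v) \<bullet>c w = - (v \<bullet>c w)"
  by (simp add: cscalar_prod_sum sum_negf)

lemma cscalar_append:
  fixes a b c d :: "complex vec"
  assumes "dim_vec a = dim_vec c" "dim_vec b = dim_vec d"
  shows "(a @\<^sub>v b) \<bullet>c (c @\<^sub>v d) = a \<bullet>c c + b \<bullet>c d"
proof -
  have "conjugate (c @\<^sub>v d) = conjugate c @\<^sub>v conjugate d"
    by (rule eq_vecI) auto
  then show ?thesis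
    using assms by (simp add: scalar_prod_append[OF carrier_vecI carrier_vecI carrier_vecI carrier_vecI])
qed

lemmas cscalar_simps = cscalar_add_left cscalar_add_right cscalar_minus_left cscalar_minus_right
  cscalar_smult_left cscalar_smult_right cscalar_uminus_left cscalar_append

lemma cscalar_self: "v \<bullet>c v = complex_of_real (\<Sum>i<dim_vec v. (cmod (v $ i))\<^sup>2)"
  by (simp add: cscalar_prod_sum complex_norm_square[symmetric])

lemma cscalar_self_nonneg: "sqnorm v \<ge> 0"
  unfolding cscalar_self by (simp add: sum_nonneg)

lemma cscalar_self_pos: "(v::complex vec) \<noteq> 0\<^sub>v (dim_vec v) \<Longrightarrow> sqnorm v > 0"
proof -
  assume "v \<noteq> 0\<^sub>v (dim_vec v)"
  then obtain i where "i < dim_vec v" "v $ i \<noteq> 0" by (metis eq_vecI index_zero_vec)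
  then show ?thesis unfolding cscalar_self by (auto intro!: sum_pos2[of _ i])
qed

lemma cscalar_zero_left [simp]: "(0\<^sub>v (dim_vec w)) \<bullet>c (w::complex vec) = 0"
  by (simp add: cscalar_prod_sum)

lemma cscalar_zero_right [simp]: "(w::complex vec) \<bullet>c 0\<^sub>v (dim_vec w) = 0"
  by (simp add: cscalar_prod_sum)

lemma mult_vec_carrier_dim [simp]: "dim_row A = n \<Longrightarrow> A *\<^sub>v v \<in> carrier_vec n"
  by (auto intro: carrier_vecI)

lemma assoc_mult_vec:
  fixes A B :: "complex mat"
  shows "dim_col A = dim_row B \<Longrightarrow> dim_col B = dim_vec v \<Longrightarrow> (A * B) *\<^sub>v v = A *\<^sub>v (B *\<^sub>v v)"
  by (rule assoc_mult_mat_vec[of A "dim_row A" "dim_col A" B "dim_col B"]) auto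

lemma mult_vec_add:
  fixes A :: "complex mat"
  shows "dim_col A = dim_vec u \<Longrightarrow> dim_vec u = dim_vec v \<Longrightarrow> A *\<^sub>v (u + v) = A *\<^sub>v u + A *\<^sub>v v"
  by (rule mult_add_distrib_mat_vec[of A "dim_row A" "dim_col A"]) (auto intro!: carrier_vecI)

lemma mult_vec_minus:
  fixes A :: "complex mat"
  shows "dim_col A = dim_vec u \<Longrightarrow> dim_vec u = dim_vec v \<Longrightarrow> A *\<^sub>v (u - v) = A *\<^sub>v u - A *\<^sub>v v"
  by (rule mult_minus_distrib_mat_vec[of A "dim_row A" "dim_col A"]) (auto intro!: carrier_vecI)

lemma mult_vec_smult:
  fixes A :: "complex mat"
  shows "dim_col A = dim_vec v \<Longrightarrow> A *\<^sub>v (c \<cdot>\<^sub>v v) = c \<cdot>\<^sub>v (A *\<^sub>v v)"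
  by (rule mult_mat_vec[of A "dim_row A" "dim_col A"]) auto

lemma add_mult_vec:
  fixes A B :: "complex mat"
  shows "dim_col A = dim_vec v \<Longrightarrow> dim_col B = dim_vec v \<Longrightarrow> dim_row A = dim_row B \<Longrightarrow>
    (A + B) *\<^sub>v v = A *\<^sub>v v + B *\<^sub>v v"
  by (rule add_mult_distrib_mat_vec[of A "dim_row A" "dim_col A"]) auto

lemma minus_mult_vec:
  fixes A B :: "complex mat"
  shows "dim_col A = dim_vec v \<Longrightarrow> dim_col B = dim_vec v \<Longrightarrow> dim_row A = dim_row B \<Longrightarrow>
    (A - B) *\<^sub>v v = A *\<^sub>v v - B *\<^sub>v v"
  by (rule minus_mult_distrib_mat_vec[of A "dim_row A" "dim_col A"]) auto

lemma smult_mult_vec: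
  fixes A :: "complex mat"
  shows "dim_col A = dim_vec v \<Longrightarrow> (c \<cdot>\<^sub>m A) *\<^sub>v v = c \<cdot>\<^sub>v (A *\<^sub>v v)"
  by (rule eq_vecI) auto

lemma hermitian_square: "hermitian A \<Longrightarrow> dim_row A = dim_col A"
  unfolding hermitian_def by (metis dim_adjoint(1))

lemma hermitian_cscalar:
  assumes "hermitian M" "dim_col M = dim_vec v" "dim_vec w = dim_vec v"
  shows "(M *\<^sub>v v) \<bullet>c w = v \<bullet>c (M *\<^sub>v w)"
  using assms hermitian_square[of M] cscalar_adjoint[of M v w] by (simp add: hermitian_def)

section \<open>Compactness of the unit sphere\<close>

text \<open>Vectors whose dimension is a term carry no topology. The unit sphere is embedded into a space of
  functions instead, where it is compact by Tychonoff's theorem.\<close>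

lemma compact_sphere: "compact {x::nat \<Rightarrow> complex. (\<forall>i\<ge>n. x i = 0) \<and> (\<Sum>i<n. (cmod (x i))\<^sup>2) = 1}"
proof -
  let ?B = "PiE UNIV (\<lambda>i. if i < n then cball (0::complex) 1 else {0})"
  let ?S = "{x::nat \<Rightarrow> complex. (\<Sum>i<n. (cmod (x i))\<^sup>2) = 1}"
  have "compactin (product_topology (\<lambda>_. euclidean) UNIV) ?B"
    by (subst compactin_PiE) auto
  then have "compact ?B" by (simp add: euclidean_product_topology compactin_euclidean_iff)
  moreover have "closed ?S"
    by (intro closed_Collect_eq continuous_intros continuous_on_product_coordinates)
  ultimately have "compact (?B \<inter> ?S)" by (rule compact_Int_closed)
  moreover have "{x::nat \<Rightarrow> complex. (\<forall>i\<ge>n. x i = 0) \<and> (\<Sum>i<n. (cmod (x i))\<^sup>2) = 1} = ?B \<inter> ?S"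
  proof (intro equalityI subsetI)
    fix x assume x: "x \<in> {x::nat \<Rightarrow> complex. (\<forall>i\<ge>n. x i = 0) \<and> (\<Sum>i<n. (cmod (x i))\<^sup>2) = 1}"
    { fix i assume i: "i < n"
      have "(cmod (x i))\<^sup>2 \<le> (\<Sum>i<n. (cmod (x i))\<^sup>2)"
        using i by (intro member_le_sum) auto
      then have "(cmod (x i))\<^sup>2 \<le> 1\<^sup>2" using x by simp
      then have "cmod (x i) \<le> 1" by (rule power2_le_imp_le) simp }
    then show "x \<in> ?B \<inter> ?S" using x by auto
  next
    fix x assume x: "x \<in> ?B \<inter> ?S"
    then have "x i = 0" if "i \<ge> n" for i
      using that PiE_mem[of x UNIV "\<lambda>i. if i < n then cball 0 1 else {0}" i] by auto
    then show "x \<in> {x::nat \<Rightarrow> complex. (\<forall>i\<ge>n. x i = 0) \<and> (\<Sum>i<n. (cmod (x i))\<^sup>2) = 1}"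
      using x by auto
  qed
  ultimately show ?thesis by simp
qed

definition qform :: "complex mat \<Rightarrow> complex vec \<Rightarrow> real" where
  "qform M v = Re ((M *\<^sub>v v) \<bullet>c v)"

lemma pos_def_iff: "M \<in> carrier_mat n n \<Longrightarrow>
  pos_def M \<longleftrightarrow> hermitian M \<and> (\<forall>v \<in> carrier_vec n. v \<noteq> 0\<^sub>v n \<longrightarrow> qform M v > 0)"
  unfolding pos_def_def qform_def by auto

lemma qform_smult_vec:
  "M \<in> carrier_mat n n \<Longrightarrow> v \<in> carrier_vec n \<Longrightarrow> qform M (complex_of_real c \<cdot>\<^sub>v v) = c\<^sup>2 * qform M v"
  unfolding qform_def by (simp add: mult_vec_smult cscalar_simps power2_eq_square)

lemma qform_add_mat: "M \<in> carrier_mat n n \<Longrightarrow> N \<in> carrier_mat n n \<Longrightarrow> v \<in> carrier_vec n \<Longrightarrow>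
   qform (M + N) v = qform M v + qform N v"
  unfolding qform_def by (simp add: add_mult_vec cscalar_simps)

lemma qform_minus_mat: "M \<in> carrier_mat n n \<Longrightarrow> N \<in> carrier_mat n n \<Longrightarrow> v \<in> carrier_vec n \<Longrightarrow>
   qform (M - N) v = qform M v - qform N v"
  unfolding qform_def by (simp add: minus_mult_vec cscalar_simps)

lemma qform_uminus_mat: "M \<in> carrier_mat n n \<Longrightarrow> v \<in> carrier_vec n \<Longrightarrow> qform (- M) v = - qform M v"
  unfolding qform_def by (simp add: cscalar_simps)

lemma qform_smult_mat: "M \<in> carrier_mat n n \<Longrightarrow> v \<in> carrier_vec n \<Longrightarrow>
   qform (complex_of_real c \<cdot>\<^sub>m M) v = c * qform M v"
  unfolding qform_def by (simp add: smult_mult_vec cscalar_simps)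

lemma qform_one: "v \<in> carrier_vec n \<Longrightarrow> qform (1\<^sub>m n) v = sqnorm v"
  unfolding qform_def by simp

lemma qform_gram: "A \<in> carrier_mat r n \<Longrightarrow> v \<in> carrier_vec n \<Longrightarrow>
   qform (A\<^sup>\<dagger> * A) v = sqnorm (A *\<^sub>v v)"
  unfolding qform_def by (auto simp: cscalar_adjoint assoc_mult_vec)

lemma qform_sum:
  "M \<in> carrier_mat n n \<Longrightarrow> qform M (vec n x) = Re (\<Sum>i<n. (\<Sum>j<n. M $$ (i,j) * x j) * cnj (x i))"
  unfolding qform_def by (subst cscalar_prod_sum) (auto simp: mult_vec_sum simp del: index_mult_mat_vec intro!: arg_cong[where f=Re] sum.cong)

lemma continuous_on_qform: "M \<in> carrier_mat n n \<Longrightarrow> continuous_on A (\<lambda>x. qform M (vec n x))"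
  by (auto simp: qform_sum simp del: Re_sum intro!: continuous_intros continuous_on_subset[OF continuous_on_product_coordinates])

text \<open>On the compact set where \<open>f \<ge> 0\<close> the function \<open>g\<close> is positive, so \<open>f / g\<close> has a maximum there and
  any larger \<open>\<rho>\<close> works; elsewhere \<open>f < 0 \<le> \<rho> * g\<close>.\<close>

lemma compact_penalty:
  fixes f g :: "'a::topological_space \<Rightarrow> real"
  assumes S: "compact S" and f: "continuous_on UNIV f" and g: "continuous_on UNIV g"
    and g_nonneg: "\<And>x. x \<in> S \<Longrightarrow> g x \<ge> 0"
    and neg: "\<And>x. x \<in> S \<Longrightarrow> g x = 0 \<Longrightarrow> f x < 0"
  shows "\<exists>\<rho>>0. \<forall>x\<in>S. f x < \<rho> * g x"
proof -
  let ?T = "S \<inter> {x. f x \<ge> 0}"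
  have T: "compact ?T"
    by (intro compact_Int_closed S closed_Collect_le f continuous_on_const)
  have gpos: "g x > 0" if "x \<in> ?T" for x
    using neg[of x] g_nonneg[of x] that by fastforce
  show ?thesis
  proof (cases "?T = {}")
    case True
    have "f x < 1 * g x" if "x \<in> S" for x
    proof -
      have "f x < 0" using True that by fastforce
      then show ?thesis using g_nonneg[OF that] by simp
    qed
    then show ?thesis by (intro exI[of _ 1]) auto
  next
    case False
    have c: "continuous_on ?T (\<lambda>x. f x / g x)"
      using gpos by (intro continuous_on_divide continuous_on_subset[OF f] continuous_on_subset[OF g]) force+
    obtain x0 where x0: "x0 \<in> ?T" "\<And>y. y \<in> ?T \<Longrightarrow> f y / g y \<le> f x0 / g x0"
      using continuous_attains_sup[OF T False c] by blast
    let ?r = "f x0 / g x0 + 1"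
    have "f x0 / g x0 \<ge> 0" using x0(1) gpos[OF x0(1)] by simp
    then have r0: "?r > 0" by simp
    have "f x < ?r * g x" if x: "x \<in> S" for x
    proof (cases "f x \<ge> 0")
      case True
      then have xT: "x \<in> ?T" using x by auto
      have "f x / g x < ?r" using x0(2)[OF xT] by linarith
      then show ?thesis using gpos[OF xT] by (simp add: pos_divide_less_eq)
    next
      case False
      have "?r * g x \<ge> 0" using r0 g_nonneg[OF x] by (intro mult_nonneg_nonneg) auto
      then show ?thesis using False by linarith
    qed
    then show ?thesis using r0 by blast
  qed
qed

text \<open>Both forms are homogeneous of degree two, so it suffices to treat the unit sphere.\<close>

lemma finsler:
  assumes M: "M \<in> carrier_mat n n" and N: "N \<in> carrier_mat n n"
    and N_nonneg: "\<And>v. v \<in> carrier_vec n \<Longrightarrow> qform N v \<ge> 0"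
    and neg: "\<And>v. v \<in> carrier_vec n \<Longrightarrow> v \<noteq> 0\<^sub>v n \<Longrightarrow> qform N v = 0 \<Longrightarrow> qform M v < 0"
  shows "\<exists>\<rho>>0. \<forall>v \<in> carrier_vec n. v \<noteq> 0\<^sub>v n \<longrightarrow> qform M v < \<rho> * qform N v"
proof -
  let ?S = "{x::nat \<Rightarrow> complex. (\<forall>i\<ge>n. x i = 0) \<and> (\<Sum>i<n. (cmod (x i))\<^sup>2) = 1}"
  let ?f = "\<lambda>x. qform M (vec n x)" and ?g = "\<lambda>x. qform N (vec n x)"
  have nz: "vec n x \<noteq> 0\<^sub>v n" if "x \<in> ?S" for x
  proof
    assume "vec n x = 0\<^sub>v n"
    then have "x i = 0" if "i < n" for i using that by (metis index_vec index_zero_vec(1))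
    then show False using \<open>x \<in> ?S\<close> by simp
  qed
  have "\<exists>\<rho>>0. \<forall>x\<in>?S. ?f x < \<rho> * ?g x"
  proof (rule compact_penalty[OF compact_sphere continuous_on_qform[OF M] continuous_on_qform[OF N]])
    show "?g x \<ge> 0" for x by (rule N_nonneg) simp
    show "?f x < 0" if "x \<in> ?S" "?g x = 0" for x
      using neg[OF vec_carrier nz[OF that(1)] that(2)] .
  qed
  then obtain \<rho> where \<rho>: "\<rho> > 0" "\<And>x. x \<in> ?S \<Longrightarrow> ?f x < \<rho> * ?g x" by blast
  have "qform M v < \<rho> * qform N v" if v: "v \<in> carrier_vec n" "v \<noteq> 0\<^sub>v n" for v
  proof -
    let ?c = "sqnorm v"
    have c: "?c > 0" using cscalar_self_pos[of v] v by auto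
    define x where "x = (\<lambda>i. if i < n then v $ i / complex_of_real (sqrt ?c) else 0)"
    have ceq: "?c = (\<Sum>i<n. (cmod (v $ i))\<^sup>2)" using v by (simp add: cscalar_self)
    have "(\<Sum>i<n. (cmod (x i))\<^sup>2) = (\<Sum>i<n. (cmod (v $ i))\<^sup>2) / ?c"
      using c by (auto simp: x_def norm_divide power_divide sum_divide_distrib intro!: sum.cong)
    then have "x \<in> ?S" using ceq c by (auto simp: x_def)
    moreover have "v = complex_of_real (sqrt ?c) \<cdot>\<^sub>v vec n x"
      using v c by (intro eq_vecI) (auto simp: x_def)
    then have "qform M v = ?c * ?f x" "qform N v = ?c * ?g x"
      using qform_smult_vec[OF M, of "vec n x" "sqrt ?c"] qform_smult_vec[OF N, of "vec n x" "sqrt ?c"] c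
      by auto
    ultimately show ?thesis using \<rho>(2)[of x] c by simp
  qed
  then show ?thesis using \<rho>(1) by blast
qed

lemma form_bound:
  assumes M: "M \<in> carrier_mat n n"
  shows "\<exists>c>0. \<forall>v \<in> carrier_vec n. qform M v \<le> c * sqnorm v"
proof -
  have "qform (1\<^sub>m n) v = 0 \<Longrightarrow> v \<noteq> 0\<^sub>v n \<Longrightarrow> qform M v < 0" if "v \<in> carrier_vec n" for v
    using cscalar_self_pos[of v] that by (auto simp: qform_one)
  then obtain \<rho> where "\<rho> > 0" "\<And>v. v \<in> carrier_vec n \<Longrightarrow> v \<noteq> 0\<^sub>v n \<Longrightarrow> qform M v < \<rho> * sqnorm v"
    using finsler[OF M one_carrier_mat] by (auto simp: qform_one cscalar_self_nonneg)
  moreover have "qform M (0\<^sub>v n) = 0" using M by (simp add: qform_def)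
  ultimately show ?thesis
    by (intro exI[of _ \<rho>]) (metis cscalar_self_nonneg less_imp_le mult_nonneg_nonneg)
qed

section \<open>Inverses\<close>

lemma trivial_kernel_invertible:
  fixes M :: "complex mat"
  assumes M: "M \<in> carrier_mat n n" and ker: "\<And>v. v \<in> carrier_vec n \<Longrightarrow> M *\<^sub>v v = 0\<^sub>v n \<Longrightarrow> v = 0\<^sub>v n"
  obtains N where "N \<in> carrier_mat n n" "M * N = 1\<^sub>m n" "N * M = 1\<^sub>m n"
proof -
  have "det M \<noteq> 0" using det_0_iff_vec_prod_zero[OF M] ker by auto
  then show ?thesis using det_non_zero_imp_unit[OF M] that
    unfolding Units_def ring_mat_def by auto
qed

lemma hermitian_inverse:
  assumes "M \<in> carrier_mat n n" "N \<in> carrier_mat n n" "hermitian M" "M * N = 1\<^sub>m n"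
  shows "hermitian N"
proof -
  have "(M * N)\<^sup>\<dagger> = N\<^sup>\<dagger> * M" using assms by (subst adjoint_mult) (auto simp: hermitian_def)
  then have "N\<^sup>\<dagger> * M = 1\<^sub>m n" using assms(4) by simp
  then have "N\<^sup>\<dagger> * (M * N) = N" using assms by (subst assoc_mult_mat[symmetric, of _ n n _ n _ n]) auto
  then show ?thesis using assms by (simp add: hermitian_def)
qed

lemma pos_def_inverse:
  assumes M: "M \<in> carrier_mat n n" and pd: "pos_def M"
  obtains N where "N \<in> carrier_mat n n" "M * N = 1\<^sub>m n" "N * M = 1\<^sub>m n" "pos_def N"
proof -
  have ker: "v = 0\<^sub>v n" if "v \<in> carrier_vec n" "M *\<^sub>v v = 0\<^sub>v n" for v
    using pd that M unfolding pos_def_iff[OF M] qform_def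
    by (metis cscalar_zero_left carrier_vecD less_irrefl zero_complex.sel(1))
  obtain N where N: "N \<in> carrier_mat n n" "M * N = 1\<^sub>m n" "N * M = 1\<^sub>m n"
    using trivial_kernel_invertible[OF M ker] by blast
  have h: "hermitian N" using hermitian_inverse[OF M N(1) _ N(2)] pd by (simp add: pos_def_def)
  have "qform N v > 0" if v: "v \<in> carrier_vec n" "v \<noteq> 0\<^sub>v n" for v
  proof -
    let ?w = "N *\<^sub>v v"
    have w: "?w \<in> carrier_vec n" using N v by auto
    have Mw: "M *\<^sub>v ?w = v" using assoc_mult_mat_vec[OF M N(1) v(1)] N v by simp
    moreover have "M *\<^sub>v 0\<^sub>v n = 0\<^sub>v n" using M by (intro eq_vecI) auto
    ultimately have "?w \<noteq> 0\<^sub>v n" using v by metis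
    then have "qform M ?w > 0" using pd w by (simp add: pos_def_iff[OF M])
    moreover have "qform M ?w = qform N v" using N v w M Mw
      by (simp add: qform_def Re_cscalar_commute)
    ultimately show ?thesis by simp
  qed
  then have "pos_def N" using h by (simp add: pos_def_iff[OF N(1)])
  then show ?thesis using N that by blast
qed

section \<open>The projection lemma\<close>

text \<open>By Finsler's lemma \<open>T = \<rho> L\<^sup>\<dagger> L - S\<close> is positive definite for some \<open>\<rho>\<close>. Every \<open>v\<close> splits
  \<open>T\<close>-orthogonally into \<open>v0\<close> in the kernel of \<open>P\<close> and \<open>v1 = Z (P v)\<close>. With \<open>K = - \<rho> L Z\<close> the pairing of
  \<open>K (P v)\<close> with \<open>L v\<close> cancels the mixed terms, and what remains is
  \<open>S(v0) - \<rho> |L v1|\<^sup>2 - T(v1)\<close>, where every term has the right sign.\<close>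

lemma projection_lemma:
  assumes S: "S \<in> carrier_mat q q" "hermitian S"
    and P: "P \<in> carrier_mat r q" and L: "L \<in> carrier_mat l q"
    and P_onto: "\<And>w. w \<in> carrier_vec r \<Longrightarrow> P\<^sup>\<dagger> *\<^sub>v w = 0\<^sub>v q \<Longrightarrow> w = 0\<^sub>v r"
    and kerP: "\<And>v. v \<in> carrier_vec q \<Longrightarrow> v \<noteq> 0\<^sub>v q \<Longrightarrow> P *\<^sub>v v = 0\<^sub>v r \<Longrightarrow> qform S v < 0"
    and kerL: "\<And>v. v \<in> carrier_vec q \<Longrightarrow> v \<noteq> 0\<^sub>v q \<Longrightarrow> L *\<^sub>v v = 0\<^sub>v l \<Longrightarrow> qform S v < 0"
  shows "\<exists>K \<in> carrier_mat l r. \<forall>v \<in> carrier_vec q. v \<noteq> 0\<^sub>v q \<longrightarrow>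
    qform S v + 2 * Re ((K *\<^sub>v (P *\<^sub>v v)) \<bullet>c (L *\<^sub>v v)) < 0"
proof -
  have LL: "L\<^sup>\<dagger> * L \<in> carrier_mat q q" using L by auto
  have "\<exists>\<rho>>0. \<forall>v \<in> carrier_vec q. v \<noteq> 0\<^sub>v q \<longrightarrow> qform S v < \<rho> * qform (L\<^sup>\<dagger> * L) v"
  proof (rule finsler[OF S(1) LL])
    fix v :: "complex vec" assume v: "v \<in> carrier_vec q"
    show "qform (L\<^sup>\<dagger> * L) v \<ge> 0" using L v by (simp add: qform_gram[of L l q] cscalar_self_nonneg)
    assume "v \<noteq> 0\<^sub>v q" "qform (L\<^sup>\<dagger> * L) v = 0"
    moreover from this have "L *\<^sub>v v = 0\<^sub>v l" using L v cscalar_self_pos[of "L *\<^sub>v v"]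
      by (auto simp: qform_gram[of L l q])
    ultimately show "qform S v < 0" using kerL v by blast
  qed
  then obtain \<rho> where \<rho>: "\<rho> > 0"
    "\<And>v. v \<in> carrier_vec q \<Longrightarrow> v \<noteq> 0\<^sub>v q \<Longrightarrow> qform S v < \<rho> * qform (L\<^sup>\<dagger> * L) v" by blast
  define T where "T = complex_of_real \<rho> \<cdot>\<^sub>m (L\<^sup>\<dagger> * L) - S"
  have T: "T \<in> carrier_mat q q" using S LL by (auto simp: T_def)
  have Tq: "qform T v = \<rho> * sqnorm (L *\<^sub>v v) - qform S v" if "v \<in> carrier_vec q" for v
    using that S L LL by (simp add: T_def qform_minus_mat[of _ q] qform_smult_mat[of _ q] qform_gram[of L l q])
  have "hermitian T" using S L unfolding hermitian_def T_def
    by (simp add: adjoint_minus adjoint_smult adjoint_mult)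
  then have Tpd: "pos_def T" using \<rho>(2) L by (auto simp: pos_def_iff[OF T] Tq qform_gram[of L l q])
  obtain F where F: "F \<in> carrier_mat q q" "T * F = 1\<^sub>m q" "F * T = 1\<^sub>m q" "pos_def F"
    using pos_def_inverse[OF T Tpd] by blast
  define W where "W = P * F * P\<^sup>\<dagger>"
  have W: "W \<in> carrier_mat r r" using P F by (auto simp: W_def)
  have Wv: "W *\<^sub>v w = P *\<^sub>v (F *\<^sub>v (P\<^sup>\<dagger> *\<^sub>v w))" if "w \<in> carrier_vec r" for w
    using that P F unfolding W_def by (simp add: assoc_mult_vec)
  have "w = 0\<^sub>v r" if w: "w \<in> carrier_vec r" "W *\<^sub>v w = 0\<^sub>v r" for w
  proof -
    have "qform F (P\<^sup>\<dagger> *\<^sub>v w) = Re ((W *\<^sub>v w) \<bullet>c w)"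
      unfolding qform_def Wv[OF w(1)]
      using w(1) P F(1) by (subst cscalar_adjoint[of P]) auto
    also have "\<dots> = 0" using w cscalar_zero_left[of w] by simp
    finally have "\<not> qform F (P\<^sup>\<dagger> *\<^sub>v w) > 0" by simp
    moreover have "P\<^sup>\<dagger> *\<^sub>v w \<in> carrier_vec q" using P w(1) by simp
    ultimately have "P\<^sup>\<dagger> *\<^sub>v w = 0\<^sub>v q" using iffD1[OF pos_def_iff[OF F(1)] F(4)] by blast
    then show ?thesis using P_onto w by blast
  qed
  then obtain Wi where Wi: "Wi \<in> carrier_mat r r" "W * Wi = 1\<^sub>m r"
    using trivial_kernel_invertible[OF W] by blast
  define Z where "Z = F * P\<^sup>\<dagger> * Wi"
  have Z: "Z \<in> carrier_mat q r" using F P Wi by (auto simp: Z_def)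
  define K where "K = complex_of_real (-\<rho>) \<cdot>\<^sub>m (L * Z)"
  have K: "K \<in> carrier_mat l r" using L Z by (auto simp: K_def)
  have "qform S v + 2 * Re ((K *\<^sub>v (P *\<^sub>v v)) \<bullet>c (L *\<^sub>v v)) < 0" if v: "v \<in> carrier_vec q" "v \<noteq> 0\<^sub>v q" for v
  proof -
    define w where "w = Wi *\<^sub>v (P *\<^sub>v v)"
    have w: "w \<in> carrier_vec r" using Wi P v by (auto simp: w_def)
    define v1 where "v1 = F *\<^sub>v (P\<^sup>\<dagger> *\<^sub>v w)"
    define v0 where "v0 = v - v1"
    have v1: "v1 \<in> carrier_vec q" using F P w by (auto simp: v1_def)
    have v0: "v0 \<in> carrier_vec q" using v v1 by (auto simp: v0_def)
    have veq: "v = v0 + v1" using v v1 by (intro eq_vecI) (auto simp: v0_def)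
    have v1Z: "v1 = Z *\<^sub>v (P *\<^sub>v v)" using F P Wi v unfolding v1_def Z_def w_def
      by (simp add: assoc_mult_vec)
    have "P *\<^sub>v v1 = W *\<^sub>v w" using Wv[OF w] by (simp add: v1_def)
    also have "\<dots> = P *\<^sub>v v" using W Wi P v assoc_mult_vec[of W Wi "P *\<^sub>v v"] unfolding w_def by simp
    finally have Pv1: "P *\<^sub>v v1 = P *\<^sub>v v" .
    have Pv0: "P *\<^sub>v v0 = 0\<^sub>v r" using P v v1 Pv1 unfolding v0_def
      by (simp add: mult_vec_minus)
    have Tv1: "T *\<^sub>v v1 = P\<^sup>\<dagger> *\<^sub>v w" using T F P w assoc_mult_vec[of T F "P\<^sup>\<dagger> *\<^sub>v w"] unfolding v1_def by simp
    have orth: "(T *\<^sub>v v1) \<bullet>c v0 = 0"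
    proof -
      have "(T *\<^sub>v v1) \<bullet>c v0 = w \<bullet>c (P *\<^sub>v v0)" using P v0 w by (simp add: Tv1 cscalar_adjoint)
      then show ?thesis using Pv0 w cscalar_zero_right[of w] by simp
    qed
    have Lv: "L *\<^sub>v v = L *\<^sub>v v0 + L *\<^sub>v v1" using L v0 v1 veq by (simp add: mult_vec_add)
    have KPv: "K *\<^sub>v (P *\<^sub>v v) = complex_of_real (-\<rho>) \<cdot>\<^sub>v (L *\<^sub>v v1)"
      using L Z P v unfolding K_def v1Z
      by (simp add: smult_mult_vec assoc_mult_vec)
    have "(T *\<^sub>v v0) \<bullet>c v1 = 0"
      using hermitian_cscalar[OF \<open>hermitian T\<close>, of v0 v1] orth T v0 v1 cscalar_cnj[of "T *\<^sub>v v1" v0]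
      by simp
    then have "qform T v = qform T v0 + qform T v1"
      using T v0 v1 orth unfolding qform_def veq by (simp add: mult_vec_add cscalar_simps)
    then have 1: "qform S v = \<rho> * sqnorm (L *\<^sub>v v) - \<rho> * sqnorm (L *\<^sub>v v0)
        + qform S v0 - qform T v1" using Tq[OF v(1)] Tq[OF v0] by simp
    have 2: "Re ((L *\<^sub>v v0) \<bullet>c (L *\<^sub>v v1)) = Re ((L *\<^sub>v v1) \<bullet>c (L *\<^sub>v v0))"
      using L by (simp add: Re_cscalar_commute)
    define a0 a1 a2 where "a0 = sqnorm (L *\<^sub>v v0)"
      and "a1 = Re ((L *\<^sub>v v1) \<bullet>c (L *\<^sub>v v0))" and "a2 = sqnorm (L *\<^sub>v v1)"
    have "sqnorm (L *\<^sub>v v) = a0 + 2 * a1 + a2"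
      using L 2 by (simp add: Lv cscalar_add_left cscalar_add_right a0_def a1_def a2_def)
    moreover have "Re ((K *\<^sub>v (P *\<^sub>v v)) \<bullet>c (L *\<^sub>v v)) = - \<rho> * (a1 + a2)"
      using L by (simp add: Lv KPv cscalar_add_right cscalar_smult_left a1_def a2_def distrib_left)
    ultimately have "qform S v + 2 * Re ((K *\<^sub>v (P *\<^sub>v v)) \<bullet>c (L *\<^sub>v v)) =
      \<rho> * (a0 + 2 * a1 + a2) - \<rho> * a0 + qform S v0 - qform T v1 + 2 * (- \<rho> * (a1 + a2))"
      using 1 by (simp add: a0_def)
    also have "\<dots> = qform S v0 - \<rho> * sqnorm (L *\<^sub>v v1) - qform T v1"
      unfolding a2_def[symmetric] by (simp add: distrib_left)
    also have "\<dots> < 0"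
    proof -
      have a: "\<rho> * sqnorm (L *\<^sub>v v1) \<ge> 0"
        by (rule mult_nonneg_nonneg[OF less_imp_le[OF \<rho>(1)] cscalar_self_nonneg])
      have b: "v1 \<noteq> 0\<^sub>v q \<Longrightarrow> qform T v1 > 0" using iffD1[OF pos_def_iff[OF T] Tpd] v1 by blast
      have c: "v0 \<noteq> 0\<^sub>v q \<Longrightarrow> qform S v0 < 0" by (rule kerP[OF v0 _ Pv0])
      have z: "qform S (0\<^sub>v q) = 0" "qform T (0\<^sub>v q) = 0" using S T by (auto simp: qform_def)
      have "v0 \<noteq> 0\<^sub>v q \<or> v1 \<noteq> 0\<^sub>v q" using veq v by auto
      then show ?thesis using a b c z by (cases "v0 = 0\<^sub>v q"; cases "v1 = 0\<^sub>v q") auto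
    qed
    finally show ?thesis .
  qed
  then show ?thesis using K by blast
qed

section \<open>Block matrices\<close>

lemma dim_append_cols [simp]:
  "dim_row (A @\<^sub>c B) = dim_row A" "dim_col (A @\<^sub>c B) = dim_col A + dim_col B"
  by (simp_all add: append_cols_def)

lemma dim_append_rows [simp]:
  "dim_row (A @\<^sub>r B) = dim_row A + dim_row B" "dim_col (A @\<^sub>r B) = dim_col A"
  by (simp_all add: append_rows_def)

lemma append_cols_mult_vec:
  assumes "dim_row A = dim_row B" "dim_col A = dim_vec x" "dim_col B = dim_vec y"
  shows "(A @\<^sub>c B) *\<^sub>v (x @\<^sub>v y) = A *\<^sub>v x + B *\<^sub>v y"
proof -
  have "(A @\<^sub>c B) *\<^sub>v (x @\<^sub>v y) =
      (A *\<^sub>v x + B *\<^sub>v y) @\<^sub>v (0\<^sub>m 0 (dim_col A) *\<^sub>v x + 0\<^sub>m 0 (dim_col B) *\<^sub>v y)"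
    unfolding append_cols_def using assms
    by (intro four_block_mat_mult_vec[OF carrier_matI carrier_matI carrier_matI carrier_matI carrier_vecI carrier_vecI]) auto
  then show ?thesis using assms by (auto intro!: eq_vecI)
qed

lemma append_rows_mult_vec:
  fixes A B :: "complex mat"
  assumes "dim_col A = dim_vec x" "dim_col B = dim_vec x"
  shows "(A @\<^sub>r B) *\<^sub>v x = (A *\<^sub>v x) @\<^sub>v (B *\<^sub>v x)"
  using assms by (intro mat_mult_append[where nc = "dim_vec x"]) (auto intro: carrier_vecI)

lemma four_block_mult_vec:
  fixes A B C D :: "complex mat"
  assumes "dim_row A = dim_row B" "dim_row C = dim_row D" "dim_col A = dim_vec x" "dim_col C = dim_vec x"
    "dim_col B = dim_vec y" "dim_col D = dim_vec y"
  shows "four_block_mat A B C D *\<^sub>v (x @\<^sub>v y) = (A *\<^sub>v x + B *\<^sub>v y) @\<^sub>v (C *\<^sub>v x + D *\<^sub>v y)"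
  using assms
  by (intro four_block_mat_mult_vec[OF carrier_matI carrier_matI carrier_matI carrier_matI carrier_vecI carrier_vecI]) auto

lemma append_vec_zero [simp]: "0\<^sub>v a @\<^sub>v 0\<^sub>v b = 0\<^sub>v (a + b)"
  by (rule eq_vecI) auto

lemma append_vec_eq_zero:
  "x \<in> carrier_vec a \<Longrightarrow> y \<in> carrier_vec b \<Longrightarrow> x @\<^sub>v y = 0\<^sub>v (a + b) \<longleftrightarrow> x = 0\<^sub>v a \<and> y = 0\<^sub>v b"
  by (metis append_vec_zero append_vec_eq zero_carrier_vec)

lemma vec_split:
  assumes "v \<in> carrier_vec (a + b)"
  obtains x y where "v = x @\<^sub>v y" "x \<in> carrier_vec a" "y \<in> carrier_vec b"
  using vec_first_last_append[OF assms] by (metis vec_first_carrier vec_last_carrier)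

lemma zero_mult_vec [simp]: "0\<^sub>m r (dim_vec v) *\<^sub>v (v::complex vec) = 0\<^sub>v r"
  by (rule eq_vecI) auto

lemma mult_vec_zero [simp]: "(A::complex mat) *\<^sub>v 0\<^sub>v (dim_col A) = 0\<^sub>v (dim_row A)"
  by (rule eq_vecI) auto

lemma hermitianI:
  assumes M: "M \<in> carrier_mat n n"
    and sym: "\<And>v w. v \<in> carrier_vec n \<Longrightarrow> w \<in> carrier_vec n \<Longrightarrow> (M *\<^sub>v v) \<bullet>c w = cnj ((M *\<^sub>v w) \<bullet>c v)"
  shows "hermitian M"
  unfolding hermitian_def
proof (rule eq_matI)
  fix i j assume "i < dim_row M" "j < dim_col M"
  then have ij: "i < n" "j < n" using M by auto
  have e: "M $$ (i, j) = (M *\<^sub>v unit_vec n j) \<bullet>c unit_vec n i" if "i < n" "j < n" for i j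
  proof -
    have "(M *\<^sub>v unit_vec n j) \<bullet>c unit_vec n i = (\<Sum>k<n. (M *\<^sub>v unit_vec n j) $ k * cnj (unit_vec n i $ k))"
      using M by (subst cscalar_prod_sum) auto
    also have "\<dots> = (\<Sum>k<n. if k = i then (M *\<^sub>v unit_vec n j) $ k else 0)"
      using that by (intro sum.cong) auto
    also have "\<dots> = (\<Sum>k<n. M $$ (i, k) * unit_vec n j $ k)"
      using that M by (simp add: mult_vec_sum del: index_mult_mat_vec)
    also have "\<dots> = (\<Sum>k<n. if k = j then M $$ (i, k) else 0)"
      using that by (intro sum.cong) auto
    finally show ?thesis using that by simp
  qed
  show "M\<^sup>\<dagger> $$ (i, j) = M $$ (i, j)"
    using e[OF ij] e[OF ij(2,1)] sym[of "unit_vec n j" "unit_vec n i"] M ij by simp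
qed (use M in auto)

lemma scalar_hermitian:
  "hermitian (complex_of_real c \<cdot>\<^sub>m 1\<^sub>m k)" "hermitian ((complex_of_real c)\<^sup>2 \<cdot>\<^sub>m 1\<^sub>m k)" "hermitian (1\<^sub>m k)"
  unfolding hermitian_def by (simp_all add: adjoint_smult)

section \<open>Bounded real forms\<close>

text \<open>The common shape of \<open>Sigma_X\<close> and of the matrix inequality projected by \<open>Nc\<close>. The blocks of size \<open>n\<close>
  and \<open>p\<close> come in opposite order there, hence the free diagonal blocks \<open>M2\<close> and \<open>M3\<close>.\<close>

definition bounded_real_block ::
  "complex mat \<Rightarrow> complex mat \<Rightarrow> complex mat \<Rightarrow> complex mat \<Rightarrow> complex mat \<Rightarrow> complex mat \<Rightarrow> complex mat \<Rightarrow> complex mat"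
where
  "bounded_real_block X A B C D M2 M3 =
     (A\<^sup>\<dagger> * X + X * A @\<^sub>c X * B @\<^sub>c C\<^sup>\<dagger>) @\<^sub>r (B\<^sup>\<dagger> * X @\<^sub>c - M2 @\<^sub>c D\<^sup>\<dagger>) @\<^sub>r (C @\<^sub>c D @\<^sub>c - M3)"

context
  fixes q r s :: nat and X A B C D M2 M3 :: "complex mat"
  assumes X: "X \<in> carrier_mat q q" "hermitian X" and A: "A \<in> carrier_mat q q"
    and B: "B \<in> carrier_mat q r" and C: "C \<in> carrier_mat s q" and D: "D \<in> carrier_mat s r"
    and M2: "M2 \<in> carrier_mat r r" "hermitian M2" and M3: "M3 \<in> carrier_mat s s" "hermitian M3"
begin

lemma bounded_real_block_carrier:
  "bounded_real_block X A B C D M2 M3 \<in> carrier_mat (q + (r + s)) (q + (r + s))"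
  unfolding bounded_real_block_def using X A B C D M2 M3 by (intro carrier_matI) auto

lemma bounded_real_block_sesqui:
  assumes "x \<in> carrier_vec q" "u \<in> carrier_vec r" "z \<in> carrier_vec s"
    "x' \<in> carrier_vec q" "u' \<in> carrier_vec r" "z' \<in> carrier_vec s"
  shows "(bounded_real_block X A B C D M2 M3 *\<^sub>v (x @\<^sub>v u @\<^sub>v z)) \<bullet>c (x' @\<^sub>v u' @\<^sub>v z') =
    (X *\<^sub>v x) \<bullet>c (A *\<^sub>v x' + B *\<^sub>v u') + (A *\<^sub>v x + B *\<^sub>v u) \<bullet>c (X *\<^sub>v x')
    + z \<bullet>c (C *\<^sub>v x' + D *\<^sub>v u') + (C *\<^sub>v x + D *\<^sub>v u) \<bullet>c z' - (M2 *\<^sub>v u) \<bullet>c u' - (M3 *\<^sub>v z) \<bullet>c z'"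
proof -
  note d = carrier_matD[OF X(1)] carrier_matD[OF A] carrier_matD[OF B] carrier_matD[OF C]
    carrier_matD[OF D] carrier_matD[OF M2(1)] carrier_matD[OF M3(1)] assms[THEN carrier_vecD]
  have "bounded_real_block X A B C D M2 M3 *\<^sub>v (x @\<^sub>v u @\<^sub>v z) =
    (A\<^sup>\<dagger> *\<^sub>v (X *\<^sub>v x) + X *\<^sub>v (A *\<^sub>v x) + (X *\<^sub>v (B *\<^sub>v u) + C\<^sup>\<dagger> *\<^sub>v z)) @\<^sub>v
    (B\<^sup>\<dagger> *\<^sub>v (X *\<^sub>v x) + (- (M2 *\<^sub>v u) + D\<^sup>\<dagger> *\<^sub>v z)) @\<^sub>v (C *\<^sub>v x + (D *\<^sub>v u + - (M3 *\<^sub>v z)))"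
    unfolding bounded_real_block_def
    by (simp add: append_rows_mult_vec append_cols_mult_vec add_mult_vec assoc_mult_vec d)
  moreover have "(A\<^sup>\<dagger> *\<^sub>v (X *\<^sub>v x)) \<bullet>c x' = (X *\<^sub>v x) \<bullet>c (A *\<^sub>v x')"
    "(C\<^sup>\<dagger> *\<^sub>v z) \<bullet>c x' = z \<bullet>c (C *\<^sub>v x')" "(B\<^sup>\<dagger> *\<^sub>v (X *\<^sub>v x)) \<bullet>c u' = (X *\<^sub>v x) \<bullet>c (B *\<^sub>v u')"
    "(D\<^sup>\<dagger> *\<^sub>v z) \<bullet>c u' = z \<bullet>c (D *\<^sub>v u')"
    by (subst cscalar_adjoint; simp add: d)+
  moreover have "(X *\<^sub>v (A *\<^sub>v x)) \<bullet>c x' = (A *\<^sub>v x) \<bullet>c (X *\<^sub>v x')"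
    "(X *\<^sub>v (B *\<^sub>v u)) \<bullet>c x' = (B *\<^sub>v u) \<bullet>c (X *\<^sub>v x')"
    by (rule hermitian_cscalar[OF X(2)]; simp add: d)+
  ultimately show ?thesis
    by (simp add: cscalar_append cscalar_add_left cscalar_add_right cscalar_uminus_left d)
qed

lemma bounded_real_block_hermitian: "hermitian (bounded_real_block X A B C D M2 M3)"
proof (rule hermitianI[OF bounded_real_block_carrier])
  fix v w :: "complex vec"
  assume "v \<in> carrier_vec (q + (r + s))" "w \<in> carrier_vec (q + (r + s))"
  then obtain x u z x' u' z' where vw: "v = x @\<^sub>v u @\<^sub>v z" "w = x' @\<^sub>v u' @\<^sub>v z'"
    and c: "x \<in> carrier_vec q" "u \<in> carrier_vec r" "z \<in> carrier_vec s"
      "x' \<in> carrier_vec q" "u' \<in> carrier_vec r" "z' \<in> carrier_vec s"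
    by (metis vec_split)
  note d = carrier_matD[OF X(1)] carrier_matD[OF A] carrier_matD[OF B] carrier_matD[OF C]
    carrier_matD[OF D] carrier_matD[OF M2(1)] carrier_matD[OF M3(1)] c[THEN carrier_vecD]
  have "cnj ((M2 *\<^sub>v u') \<bullet>c u) = (M2 *\<^sub>v u) \<bullet>c u'" "cnj ((M3 *\<^sub>v z') \<bullet>c z) = (M3 *\<^sub>v z) \<bullet>c z'"
    by (subst cscalar_cnj, simp add: d, rule hermitian_cscalar[symmetric]; simp add: M2 M3 d)+
  then show "(bounded_real_block X A B C D M2 M3 *\<^sub>v v) \<bullet>c w = cnj ((bounded_real_block X A B C D M2 M3 *\<^sub>v w) \<bullet>c v)"
    unfolding vw bounded_real_block_sesqui[OF c]
      bounded_real_block_sesqui[OF c(4-6) c(1-3)]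
    by (simp add: cscalar_cnj d)
qed

lemma bounded_real_block_qform:
  assumes c: "x \<in> carrier_vec q" "u \<in> carrier_vec r" "z \<in> carrier_vec s"
  shows "qform (bounded_real_block X A B C D M2 M3) (x @\<^sub>v u @\<^sub>v z) =
    2 * Re ((X *\<^sub>v x) \<bullet>c (A *\<^sub>v x + B *\<^sub>v u)) + 2 * Re (z \<bullet>c (C *\<^sub>v x + D *\<^sub>v u))
    - qform M2 u - qform M3 z"
proof -
  note d = carrier_matD[OF X(1)] carrier_matD[OF A] carrier_matD[OF B] carrier_matD[OF C]
    carrier_matD[OF D] carrier_matD[OF M2(1)] carrier_matD[OF M3(1)] c[THEN carrier_vecD]
  have "Re ((A *\<^sub>v x + B *\<^sub>v u) \<bullet>c (X *\<^sub>v x)) = Re ((X *\<^sub>v x) \<bullet>c (A *\<^sub>v x + B *\<^sub>v u))"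
    "Re ((C *\<^sub>v x + D *\<^sub>v u) \<bullet>c z) = Re (z \<bullet>c (C *\<^sub>v x + D *\<^sub>v u))"
    by (rule Re_cscalar_commute; simp add: d)+
  then show ?thesis
    unfolding qform_def bounded_real_block_sesqui[OF c c] by simp
qed

end

lemma qform_cross:
  assumes P: "P \<in> carrier_mat r q" and L: "L \<in> carrier_mat l q" and K: "K \<in> carrier_mat l r"
  shows "hermitian (P\<^sup>\<dagger> * K\<^sup>\<dagger> * L + L\<^sup>\<dagger> * K * P)"
    and "v \<in> carrier_vec q \<Longrightarrow>
      qform (P\<^sup>\<dagger> * K\<^sup>\<dagger> * L + L\<^sup>\<dagger> * K * P) v = 2 * Re ((K *\<^sub>v (P *\<^sub>v v)) \<bullet>c (L *\<^sub>v v))"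
proof -
  note d = carrier_matD[OF P] carrier_matD[OF L] carrier_matD[OF K]
  have "(P\<^sup>\<dagger> * K\<^sup>\<dagger> * L)\<^sup>\<dagger> = L\<^sup>\<dagger> * (K * P)" by (simp add: adjoint_mult d)
  also have "\<dots> = L\<^sup>\<dagger> * K * P"
    by (rule assoc_mult_mat[symmetric, OF adjoint_carrier[OF L] K P])
  finally have e: "(P\<^sup>\<dagger> * K\<^sup>\<dagger> * L)\<^sup>\<dagger> = L\<^sup>\<dagger> * K * P" .
  have c: "P\<^sup>\<dagger> * K\<^sup>\<dagger> * L \<in> carrier_mat q q" by (rule carrier_matI) (auto simp: d)
  have "(P\<^sup>\<dagger> * K\<^sup>\<dagger> * L + (P\<^sup>\<dagger> * K\<^sup>\<dagger> * L)\<^sup>\<dagger>)\<^sup>\<dagger> = (P\<^sup>\<dagger> * K\<^sup>\<dagger> * L)\<^sup>\<dagger> + P\<^sup>\<dagger> * K\<^sup>\<dagger> * L"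
    by (subst adjoint_add) (auto simp: d)
  also have "\<dots> = P\<^sup>\<dagger> * K\<^sup>\<dagger> * L + (P\<^sup>\<dagger> * K\<^sup>\<dagger> * L)\<^sup>\<dagger>"
    by (rule comm_add_mat[OF adjoint_carrier[OF c] c])
  finally show "hermitian (P\<^sup>\<dagger> * K\<^sup>\<dagger> * L + L\<^sup>\<dagger> * K * P)" unfolding hermitian_def e .
  assume v: "v \<in> carrier_vec q"
  have 1: "(P\<^sup>\<dagger> * K\<^sup>\<dagger> * L) *\<^sub>v v = P\<^sup>\<dagger> *\<^sub>v (K\<^sup>\<dagger> *\<^sub>v (L *\<^sub>v v))" "(L\<^sup>\<dagger> * K * P) *\<^sub>v v = L\<^sup>\<dagger> *\<^sub>v (K *\<^sub>v (P *\<^sub>v v))"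
    using v by (simp_all add: assoc_mult_vec d)
  have 2: "(L\<^sup>\<dagger> *\<^sub>v (K *\<^sub>v (P *\<^sub>v v))) \<bullet>c v = (K *\<^sub>v (P *\<^sub>v v)) \<bullet>c (L *\<^sub>v v)"
    using v by (subst cscalar_adjoint) (simp_all add: d)
  have "(P\<^sup>\<dagger> *\<^sub>v (K\<^sup>\<dagger> *\<^sub>v (L *\<^sub>v v))) \<bullet>c v = (K\<^sup>\<dagger> *\<^sub>v (L *\<^sub>v v)) \<bullet>c (P *\<^sub>v v)"
    using v by (subst cscalar_adjoint) (simp_all add: d)
  also have "\<dots> = (L *\<^sub>v v) \<bullet>c (K *\<^sub>v (P *\<^sub>v v))"
    using v by (subst cscalar_adjoint) (simp_all add: d)
  finally have 3: "Re ((P\<^sup>\<dagger> *\<^sub>v (K\<^sup>\<dagger> *\<^sub>v (L *\<^sub>v v))) \<bullet>c v) = Re ((K *\<^sub>v (P *\<^sub>v v)) \<bullet>c (L *\<^sub>v v))"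
    by (simp add: Re_cscalar_commute d)
  show "qform (P\<^sup>\<dagger> * K\<^sup>\<dagger> * L + L\<^sup>\<dagger> * K * P) v = 2 * Re ((K *\<^sub>v (P *\<^sub>v v)) \<bullet>c (L *\<^sub>v v))"
    using v 2 3 unfolding qform_def by (subst add_mult_vec) (auto simp: d 1 cscalar_add_left)
qed

section \<open>The design inequality\<close>

context
  fixes m m11 n ny p :: nat and A B C1 C2 D1 D2 :: "complex mat" and g :: real
  assumes A: "A \<in> carrier_mat m m" and B: "B \<in> carrier_mat m p"
    and C1: "C1 \<in> carrier_mat ny m" and C2: "C2 \<in> carrier_mat n m"
    and D1: "D1 \<in> carrier_mat ny p" and D2: "D2 \<in> carrier_mat n p"
begin

lemma Sigma_X_block:
  "Sigma_X m m11 n p A B C2 D2 g X =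
    bounded_real_block X (A_bar m m11 A) (B_bar m11 n C2) (C_bar m11 p B) (D_bar D2)
      (complex_of_real (g\<^sup>2) \<cdot>\<^sub>m 1\<^sub>m n) (1\<^sub>m p)"
  unfolding Sigma_X_def bounded_real_block_def Let_def ..

lemma bar_carriers:
  "A_bar m m11 A \<in> carrier_mat (m + m11) (m + m11)" "B_bar m11 n C2 \<in> carrier_mat (m + m11) n"
  "C_bar m11 p B \<in> carrier_mat p (m + m11)" "D_bar D2 \<in> carrier_mat p n"
  unfolding A_bar_def B_bar_def C_bar_def D_bar_def using A B C2 D2 by (auto intro!: carrier_matI)

lemma Pi_mat_carrier: "Pi_mat m m11 n p \<in> carrier_mat (m11 + n) ((m + m11) + (n + p))"
  unfolding Pi_mat_def C_under_def D21_under_def by (intro carrier_matI) auto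

lemma Lambda_X_carrier:
  "X \<in> carrier_mat (m + m11) (m + m11) \<Longrightarrow>
   Lambda_X m m11 n ny p C1 D1 X \<in> carrier_mat (m11 + ny) ((m + m11) + (n + p))"
  unfolding Lambda_X_def B_under_def D12_under_def using C1 D1 by (intro carrier_matI) auto

lemma Pi_mat_mult:
  assumes "x1 \<in> carrier_vec m" "x2 \<in> carrier_vec m11" "u \<in> carrier_vec n" "z \<in> carrier_vec p"
  shows "Pi_mat m m11 n p *\<^sub>v ((x1 @\<^sub>v x2) @\<^sub>v u @\<^sub>v z) = x2 @\<^sub>v u"
proof -
  note d = assms[THEN carrier_vecD]
  have z: "0\<^sub>m r m *\<^sub>v x1 = 0\<^sub>v r" "0\<^sub>m r m11 *\<^sub>v x2 = 0\<^sub>v r" "0\<^sub>m r n *\<^sub>v u = 0\<^sub>v r" "0\<^sub>m r p *\<^sub>v z = 0\<^sub>v r" for r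
    unfolding d[symmetric] by simp_all
  show ?thesis
    unfolding Pi_mat_def C_under_def D21_under_def
    using assms
    by (simp add: append_cols_mult_vec append_rows_mult_vec four_block_mult_vec d z append_vec_add[of _ m11 _ _ n])
qed

lemma Lambda_X_mult:
  assumes X: "X \<in> carrier_mat (m + m11) (m + m11)" and x: "x \<in> carrier_vec (m + m11)"
    and c: "u \<in> carrier_vec n" "z \<in> carrier_vec p"
    and xi: "X *\<^sub>v x = \<xi>1 @\<^sub>v \<xi>2" "\<xi>1 \<in> carrier_vec m" "\<xi>2 \<in> carrier_vec m11"
  shows "Lambda_X m m11 n ny p C1 D1 X *\<^sub>v (x @\<^sub>v u @\<^sub>v z) = \<xi>2 @\<^sub>v (C1 *\<^sub>v \<xi>1 + D1 *\<^sub>v z)"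
proof -
  note d = c[THEN carrier_vecD] carrier_vecD[OF x] carrier_vecD[OF xi(2)] carrier_vecD[OF xi(3)]
    carrier_matD[OF X] carrier_matD[OF C1] carrier_matD[OF D1]
  have z: "0\<^sub>m r m *\<^sub>v \<xi>1 = 0\<^sub>v r" "0\<^sub>m r m11 *\<^sub>v \<xi>2 = 0\<^sub>v r" "0\<^sub>m r n *\<^sub>v u = 0\<^sub>v r" "0\<^sub>m r p *\<^sub>v z = 0\<^sub>v r" for r
    unfolding d(1-5)[symmetric] by simp_all
  have "(B_under m m11 ny C1)\<^sup>\<dagger> = four_block_mat (0\<^sub>m m11 m) (1\<^sub>m m11) C1 (0\<^sub>m ny m11)"
    unfolding B_under_def using C1 by (subst adjoint_four_block[where ?r1.0 = m and ?r2.0 = m11 and ?c1.0 = m11 and ?c2.0 = ny]) auto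
  moreover have "(D12_under m11 p D1)\<^sup>\<dagger> *\<^sub>v z = 0\<^sub>v m11 @\<^sub>v (D1 *\<^sub>v z)"
  proof -
    have "(D12_under m11 p D1)\<^sup>\<dagger> = 0\<^sub>m m11 p @\<^sub>r D1"
      unfolding D12_under_def append_cols_def append_rows_def using D1
      by (subst adjoint_four_block[where ?r1.0 = p and ?r2.0 = 0 and ?c1.0 = m11 and ?c2.0 = ny]) auto
    then show ?thesis by (simp add: append_rows_mult_vec d z)
  qed
  moreover have "dim_row (D12_under m11 p D1) = p" "dim_col (D12_under m11 p D1) = m11 + ny"
    by (simp_all add: D12_under_def d)
  ultimately show ?thesis
    unfolding Lambda_X_def using xi
    by (simp add: append_cols_mult_vec assoc_mult_vec four_block_mult_vec d z
        append_vec_add[of _ m11 _ _ ny])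
qed

lemma Sigma_X_qform:
  assumes X: "X \<in> carrier_mat (m + m11) (m + m11)" "hermitian X"
    and c: "x1 \<in> carrier_vec m" "x2 \<in> carrier_vec m11" "u \<in> carrier_vec n" "z \<in> carrier_vec p"
  shows "qform (Sigma_X m m11 n p A B C2 D2 g X) ((x1 @\<^sub>v x2) @\<^sub>v u @\<^sub>v z) =
    2 * Re ((X *\<^sub>v (x1 @\<^sub>v x2)) \<bullet>c ((A\<^sup>\<dagger> *\<^sub>v x1 + C2\<^sup>\<dagger> *\<^sub>v u) @\<^sub>v 0\<^sub>v m11))
    + 2 * Re (z \<bullet>c (B\<^sup>\<dagger> *\<^sub>v x1 + D2\<^sup>\<dagger> *\<^sub>v u)) - g\<^sup>2 * sqnorm u - sqnorm z"
proof -
  note d = c[THEN carrier_vecD] carrier_matD[OF A] carrier_matD[OF B] carrier_matD[OF C2] carrier_matD[OF D2]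
  have z: "0\<^sub>m r m *\<^sub>v x1 = 0\<^sub>v r" "0\<^sub>m r m11 *\<^sub>v x2 = 0\<^sub>v r" "0\<^sub>m r n *\<^sub>v u = 0\<^sub>v r" "0\<^sub>m r p *\<^sub>v z = 0\<^sub>v r" for r
    unfolding d(1-4)[symmetric] by simp_all
  have 1: "A_bar m m11 A *\<^sub>v (x1 @\<^sub>v x2) + B_bar m11 n C2 *\<^sub>v u = (A\<^sup>\<dagger> *\<^sub>v x1 + C2\<^sup>\<dagger> *\<^sub>v u) @\<^sub>v 0\<^sub>v m11"
    unfolding A_bar_def B_bar_def using c A C2
    by (simp add: append_rows_mult_vec four_block_mult_vec d z append_vec_add[of _ m _ _ m11])
  have 2: "C_bar m11 p B *\<^sub>v (x1 @\<^sub>v x2) + D_bar D2 *\<^sub>v u = B\<^sup>\<dagger> *\<^sub>v x1 + D2\<^sup>\<dagger> *\<^sub>v u"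
    unfolding C_bar_def D_bar_def by (simp add: append_cols_mult_vec d z)
  have x: "x1 @\<^sub>v x2 \<in> carrier_vec (m + m11)" using c by simp
  show ?thesis
    unfolding Sigma_X_block
    by (subst bounded_real_block_qform[OF X bar_carriers _ _ _ _ x c(3,4)])
       (use qform_smult_mat[OF one_carrier_mat c(3), of "g\<^sup>2"] in
          \<open>simp_all add: scalar_hermitian 1 2 qform_one c\<close>)
qed

lemma Sigma_X_hermitian:
  "X \<in> carrier_mat (m + m11) (m + m11) \<Longrightarrow> hermitian X \<Longrightarrow> hermitian (Sigma_X m m11 n p A B C2 D2 g X)"
  unfolding Sigma_X_block
  by (rule bounded_real_block_hermitian[OF _ _ bar_carriers]) (auto simp: scalar_hermitian)

lemma Sigma_X_carrier:
  "X \<in> carrier_mat (m + m11) (m + m11) \<Longrightarrow> hermitian X \<Longrightarrow>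
    Sigma_X m m11 n p A B C2 D2 g X \<in> carrier_mat ((m + m11) + (n + p)) ((m + m11) + (n + p))"
  unfolding Sigma_X_block
  by (rule bounded_real_block_carrier[OF _ _ bar_carriers]) (auto simp: scalar_hermitian)

text \<open>The cross terms contribute the pairing of \<open>K (P v)\<close> with \<open>L v\<close>, which is the form in which the
  projection lemma supplies \<open>K\<close>.\<close>

lemma design_matrix_qform:
  assumes X: "X \<in> carrier_mat (m + m11) (m + m11)" "hermitian X" and K: "K \<in> carrier_mat (m11 + ny) (m11 + n)"
  defines "P \<equiv> Pi_mat m m11 n p" and "L \<equiv> Lambda_X m m11 n ny p C1 D1 X"
  defines "S \<equiv> Sigma_X m m11 n p A B C2 D2 g X"
  shows "neg_def (S + P\<^sup>\<dagger> * K\<^sup>\<dagger> * L + L\<^sup>\<dagger> * K * P) \<longleftrightarrow>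
    (\<forall>v \<in> carrier_vec ((m + m11) + (n + p)). v \<noteq> 0\<^sub>v ((m + m11) + (n + p)) \<longrightarrow>
       qform S v + 2 * Re ((K *\<^sub>v (P *\<^sub>v v)) \<bullet>c (L *\<^sub>v v)) < 0)"
proof -
  let ?q = "(m + m11) + (n + p)" and ?Q = "P\<^sup>\<dagger> * K\<^sup>\<dagger> * L + L\<^sup>\<dagger> * K * P"
  have P: "P \<in> carrier_mat (m11 + n) ?q" and L: "L \<in> carrier_mat (m11 + ny) ?q"
    unfolding P_def L_def by (rule Pi_mat_carrier, rule Lambda_X_carrier[OF X(1)])
  have S: "S \<in> carrier_mat ?q ?q" "hermitian S"
    unfolding S_def using Sigma_X_carrier[OF X] Sigma_X_hermitian[OF X] by auto
  have Q: "?Q \<in> carrier_mat ?q ?q" using P L K by (auto intro!: carrier_matI)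
  have "S + P\<^sup>\<dagger> * K\<^sup>\<dagger> * L + L\<^sup>\<dagger> * K * P = S + ?Q"
    by (rule assoc_add_mat[of _ ?q ?q]) (use S P L K in \<open>auto intro!: carrier_matI\<close>)
  moreover have "hermitian (- (S + ?Q))"
    using S(2) qform_cross(1)[OF P L K] carrier_matD[OF S(1)] carrier_matD[OF Q]
    unfolding hermitian_def adjoint_uminus by (subst adjoint_add) auto
  moreover have "- (S + ?Q) \<in> carrier_mat ?q ?q" using S Q by auto
  moreover have "0 < qform (- (S + ?Q)) v \<longleftrightarrow> qform S v + 2 * Re ((K *\<^sub>v (P *\<^sub>v v)) \<bullet>c (L *\<^sub>v v)) < 0"
    if v: "v \<in> carrier_vec ?q" for v
    unfolding qform_uminus_mat[OF add_carrier_mat[OF Q, of S] v] qform_add_mat[OF S(1) Q v]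
      qform_cross(2)[OF P L K v] by (rule neg_0_less_iff_less)
  ultimately show ?thesis
    unfolding neg_def_def by (simp only: pos_def_iff[of _ ?q]) blast
qed

end

lemma append_vec_assoc: "(x @\<^sub>v y) @\<^sub>v z = x @\<^sub>v (y @\<^sub>v z)"
  by (rule eq_vecI) auto

lemma qform_congruence:
  assumes "M \<in> carrier_mat n n" "T \<in> carrier_mat n k" "v \<in> carrier_vec k"
  shows "qform (T\<^sup>\<dagger> * M * T) v = qform M (T *\<^sub>v v)"
proof -
  note d = carrier_matD[OF assms(1)] carrier_matD[OF assms(2)] carrier_vecD[OF assms(3)]
  have "(T\<^sup>\<dagger> * M * T) *\<^sub>v v = T\<^sup>\<dagger> *\<^sub>v (M *\<^sub>v (T *\<^sub>v v))" by (simp add: assoc_mult_vec d)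
  then show ?thesis unfolding qform_def by (simp only:) (subst cscalar_adjoint; simp add: d)
qed

lemma hermitian_form_real:
  assumes "hermitian M" "dim_col M = dim_vec v"
  shows "(M *\<^sub>v v) \<bullet>c v = complex_of_real (qform M v)"
proof -
  have "cnj ((M *\<^sub>v v) \<bullet>c v) = (M *\<^sub>v v) \<bullet>c v"
    using hermitian_cscalar[OF assms, of v] assms hermitian_square[of M] by (simp add: cscalar_cnj)
  then have "Im ((M *\<^sub>v v) \<bullet>c v) = 0" by (simp add: complex_eq_iff)
  then show ?thesis unfolding qform_def by (simp add: complex_eq_iff)
qed

lemma K_mat_mult:
  assumes "A11 \<in> carrier_mat m11 m11" "B11 \<in> carrier_mat m11 ny" "C11 \<in> carrier_mat n m11" "J11 \<in> carrier_mat n ny"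
    "x2 \<in> carrier_vec m11" "u \<in> carrier_vec n"
  shows "K_mat A11 B11 C11 J11 *\<^sub>v (x2 @\<^sub>v u) =
    (A11\<^sup>\<dagger> *\<^sub>v x2 + C11\<^sup>\<dagger> *\<^sub>v u) @\<^sub>v (B11\<^sup>\<dagger> *\<^sub>v x2 + J11\<^sup>\<dagger> *\<^sub>v u)"
  unfolding K_mat_def using assms by (intro four_block_mult_vec) auto

lemma K_mat_carrier:
  assumes "A11 \<in> carrier_mat m11 m11" "B11 \<in> carrier_mat m11 ny" "C11 \<in> carrier_mat n m11" "J11 \<in> carrier_mat n ny"
  shows "K_mat A11 B11 C11 J11 \<in> carrier_mat (m11 + ny) (m11 + n)"
  unfolding K_mat_def using assms by (intro carrier_matI) auto

lemma K_mat_surj: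
  assumes K: "K \<in> carrier_mat (m11 + ny) (m11 + n)"
  obtains A11 B11 C11 J11 where "A11 \<in> carrier_mat m11 m11" "B11 \<in> carrier_mat m11 ny"
    "C11 \<in> carrier_mat n m11" "J11 \<in> carrier_mat n ny" "K_mat A11 B11 C11 J11 = K"
proof -
  define A11 B11 C11 J11 where
    "A11 = (mat m11 m11 (\<lambda>(i,j). K $$ (i,j)))\<^sup>\<dagger>"
    and "B11 = (mat ny m11 (\<lambda>(i,j). K $$ (m11 + i, j)))\<^sup>\<dagger>"
    and "C11 = (mat m11 n (\<lambda>(i,j). K $$ (i, m11 + j)))\<^sup>\<dagger>"
    and "J11 = (mat ny n (\<lambda>(i,j). K $$ (m11 + i, m11 + j)))\<^sup>\<dagger>"
  have "K_mat A11 B11 C11 J11 = K"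
    unfolding K_mat_def A11_def B11_def C11_def J11_def adjoint_adjoint
    using K by (intro eq_matI) auto
  moreover have "A11 \<in> carrier_mat m11 m11" "B11 \<in> carrier_mat m11 ny"
    "C11 \<in> carrier_mat n m11" "J11 \<in> carrier_mat n ny"
    unfolding A11_def B11_def C11_def J11_def by auto
  ultimately show ?thesis using that by blast
qed

text \<open>Here \<open>s\<close> stands for differentiation: \<open>x2\<close> is the state of the adjoint filter with input \<open>u\<close> and
  output \<open>y\<close>, and \<open>x1\<close> is the state of the adjoint spectral factor with input \<open>(y, u)\<close> and output \<open>z\<close>.
  The design matrix evaluated at \<open>(x1, x2, u, z)\<close> is the dissipation inequality of this system.\<close>

lemma design_dissipation:
  assumes A: "A \<in> carrier_mat m m" and B: "B \<in> carrier_mat m p"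
    and C1: "C1 \<in> carrier_mat ny m" and C2: "C2 \<in> carrier_mat n m"
    and D1: "D1 \<in> carrier_mat ny p" and D2: "D2 \<in> carrier_mat n p"
    and design: "design_inequality m m11 n ny p A B C1 C2 D1 D2 g A11 B11 C11 J11"
    and c: "x1 \<in> carrier_vec m" "x2 \<in> carrier_vec m11" "u \<in> carrier_vec n"
    and y: "y = B11\<^sup>\<dagger> *\<^sub>v x2 + J11\<^sup>\<dagger> *\<^sub>v u" and x2: "s \<cdot>\<^sub>v x2 = A11\<^sup>\<dagger> *\<^sub>v x2 + C11\<^sup>\<dagger> *\<^sub>v u"
    and x1: "s \<cdot>\<^sub>v x1 = A\<^sup>\<dagger> *\<^sub>v x1 + C1\<^sup>\<dagger> *\<^sub>v y + C2\<^sup>\<dagger> *\<^sub>v u"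
    and z: "z = B\<^sup>\<dagger> *\<^sub>v x1 + D1\<^sup>\<dagger> *\<^sub>v y + D2\<^sup>\<dagger> *\<^sub>v u"
    and nz: "x1 \<noteq> 0\<^sub>v m \<or> x2 \<noteq> 0\<^sub>v m11 \<or> u \<noteq> 0\<^sub>v n"
  obtains X where "X \<in> carrier_mat (m + m11) (m + m11)" "pos_def X"
    "2 * Re s * qform X (x1 @\<^sub>v x2) + sqnorm z < g\<^sup>2 * sqnorm u"
proof -
  have c11: "A11 \<in> carrier_mat m11 m11" "B11 \<in> carrier_mat m11 ny" "C11 \<in> carrier_mat n m11" "J11 \<in> carrier_mat n ny"
    using design unfolding design_inequality_def by auto
  note KM = K_mat_carrier[OF c11]
  obtain X where X: "X \<in> carrier_mat (m + m11) (m + m11)" "hermitian X" "pos_def X"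
    and neg: "neg_def (Sigma_X m m11 n p A B C2 D2 g X
       + (Pi_mat m m11 n p)\<^sup>\<dagger> * (K_mat A11 B11 C11 J11)\<^sup>\<dagger> * Lambda_X m m11 n ny p C1 D1 X
       + (Lambda_X m m11 n ny p C1 D1 X)\<^sup>\<dagger> * K_mat A11 B11 C11 J11 * Pi_mat m m11 n p)"
    using design unfolding design_inequality_def Let_def by auto
  note d = carrier_matD[OF A] carrier_matD[OF B] carrier_matD[OF C1] carrier_matD[OF C2]
    carrier_matD[OF D1] carrier_matD[OF D2] carrier_matD[OF X(1)] c11[THEN carrier_matD(1)] c11[THEN carrier_matD(2)]
  have zc: "z \<in> carrier_vec p" and yc: "y \<in> carrier_vec ny"
    unfolding z y by (auto intro!: carrier_vecI simp: d)
  have xc: "x1 @\<^sub>v x2 \<in> carrier_vec (m + m11)" using c by simp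
  have "X *\<^sub>v (x1 @\<^sub>v x2) \<in> carrier_vec (m + m11)" by (simp add: d)
  then obtain \<xi>1 \<xi>2 where xi: "X *\<^sub>v (x1 @\<^sub>v x2) = \<xi>1 @\<^sub>v \<xi>2" "\<xi>1 \<in> carrier_vec m" "\<xi>2 \<in> carrier_vec m11"
    by (rule vec_split)
  note e = d c[THEN carrier_vecD] zc[THEN carrier_vecD] yc[THEN carrier_vecD] xi(2,3)[THEN carrier_vecD]
  let ?v = "(x1 @\<^sub>v x2) @\<^sub>v u @\<^sub>v z"
  have "?v \<in> carrier_vec ((m + m11) + (n + p))" using c zc by simp
  moreover have "?v \<noteq> 0\<^sub>v ((m + m11) + (n + p))"
    using nz c zc xc by (auto simp: append_vec_eq_zero)
  ultimately have "qform (Sigma_X m m11 n p A B C2 D2 g X) ?v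
      + 2 * Re ((K_mat A11 B11 C11 J11 *\<^sub>v (Pi_mat m m11 n p *\<^sub>v ?v)) \<bullet>c (Lambda_X m m11 n ny p C1 D1 X *\<^sub>v ?v)) < 0"
    using neg unfolding design_matrix_qform[OF A B C1 C2 D1 D2 X(1,2) KM] by blast
  moreover have "K_mat A11 B11 C11 J11 *\<^sub>v (Pi_mat m m11 n p *\<^sub>v ?v) = (s \<cdot>\<^sub>v x2) @\<^sub>v y"
    unfolding Pi_mat_mult[OF A B C1 C2 D1 D2 c zc] K_mat_mult[OF c11 c(2,3)] x2 y ..
  ultimately have *: "2 * Re ((\<xi>1 @\<^sub>v \<xi>2) \<bullet>c ((A\<^sup>\<dagger> *\<^sub>v x1 + C2\<^sup>\<dagger> *\<^sub>v u) @\<^sub>v 0\<^sub>v m11))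
      + 2 * Re (z \<bullet>c (B\<^sup>\<dagger> *\<^sub>v x1 + D2\<^sup>\<dagger> *\<^sub>v u)) - g\<^sup>2 * sqnorm u - sqnorm z
      + 2 * Re (((s \<cdot>\<^sub>v x2) @\<^sub>v y) \<bullet>c (\<xi>2 @\<^sub>v (C1 *\<^sub>v \<xi>1 + D1 *\<^sub>v z))) < 0"
    unfolding Sigma_X_qform[OF A B C1 C2 D1 D2 X(1,2) c zc] xi(1)
      Lambda_X_mult[OF A B C1 C2 D1 D2 X(1) xc c(3) zc xi] by simp
  have a1: "Re (y \<bullet>c (C1 *\<^sub>v \<xi>1)) = Re (\<xi>1 \<bullet>c (C1\<^sup>\<dagger> *\<^sub>v y))"
    by (subst Re_cscalar_commute, simp add: e, subst cscalar_adjoint; simp add: e)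
  have a2: "Re (y \<bullet>c (D1 *\<^sub>v z)) = Re (z \<bullet>c (D1\<^sup>\<dagger> *\<^sub>v y))"
    by (subst Re_cscalar_commute, simp add: e, subst cscalar_adjoint; simp add: e)
  have a3: "\<xi>2 \<bullet>c 0\<^sub>v m11 = 0" using xi(3) cscalar_zero_right[of \<xi>2] by simp
  have b1: "Re (\<xi>1 \<bullet>c (A\<^sup>\<dagger> *\<^sub>v x1 + C2\<^sup>\<dagger> *\<^sub>v u)) + Re (\<xi>1 \<bullet>c (C1\<^sup>\<dagger> *\<^sub>v y)) = Re (\<xi>1 \<bullet>c (s \<cdot>\<^sub>v x1))"
    unfolding x1 by (simp add: cscalar_add_right e)
  have b2: "Re (z \<bullet>c (B\<^sup>\<dagger> *\<^sub>v x1 + D2\<^sup>\<dagger> *\<^sub>v u)) + Re (z \<bullet>c (D1\<^sup>\<dagger> *\<^sub>v y)) = sqnorm z"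
  proof -
    have "z \<bullet>c z = z \<bullet>c (B\<^sup>\<dagger> *\<^sub>v x1 + D1\<^sup>\<dagger> *\<^sub>v y + D2\<^sup>\<dagger> *\<^sub>v u)" using z by simp
    then show ?thesis by (simp add: cscalar_add_right e)
  qed
  have "x1 \<bullet>c \<xi>1 + x2 \<bullet>c \<xi>2 = (x1 @\<^sub>v x2) \<bullet>c (X *\<^sub>v (x1 @\<^sub>v x2))"
    unfolding xi(1) by (simp add: cscalar_append e)
  also have "\<dots> = complex_of_real (qform X (x1 @\<^sub>v x2))"
    using hermitian_cscalar[OF X(2), of "x1 @\<^sub>v x2" "x1 @\<^sub>v x2"] hermitian_form_real[OF X(2), of "x1 @\<^sub>v x2"]
    by (simp add: e)
  finally have "Re (s * (x1 \<bullet>c \<xi>1) + s * (x2 \<bullet>c \<xi>2)) = Re s * qform X (x1 @\<^sub>v x2)"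
    by (simp flip: distrib_left)
  moreover have "Re (\<xi>1 \<bullet>c (s \<cdot>\<^sub>v x1)) = Re (s * (x1 \<bullet>c \<xi>1))"
    by (subst Re_cscalar_commute) (simp_all add: e cscalar_smult_left)
  moreover have "(s \<cdot>\<^sub>v x2) \<bullet>c \<xi>2 = s * (x2 \<bullet>c \<xi>2)" by (simp add: e cscalar_smult_left)
  ultimately have b3: "Re (\<xi>1 \<bullet>c (s \<cdot>\<^sub>v x1)) + Re ((s \<cdot>\<^sub>v x2) \<bullet>c \<xi>2) = Re s * qform X (x1 @\<^sub>v x2)"
    by simp
  have "2 * Re (\<xi>1 \<bullet>c (A\<^sup>\<dagger> *\<^sub>v x1 + C2\<^sup>\<dagger> *\<^sub>v u))
      + 2 * Re (z \<bullet>c (B\<^sup>\<dagger> *\<^sub>v x1 + D2\<^sup>\<dagger> *\<^sub>v u)) - g\<^sup>2 * sqnorm u - sqnorm z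
      + 2 * (Re ((s \<cdot>\<^sub>v x2) \<bullet>c \<xi>2) + (Re (y \<bullet>c (C1 *\<^sub>v \<xi>1)) + Re (y \<bullet>c (D1 *\<^sub>v z)))) < 0"
    using * a3 by (simp add: cscalar_append cscalar_add_right[of "C1 *\<^sub>v \<xi>1"] e)
  then have "2 * Re s * qform X (x1 @\<^sub>v x2) + sqnorm z < g\<^sup>2 * sqnorm u"
    using a1 a2 b1 b2 b3[symmetric] unfolding mult.assoc[of 2] by simp
  then show ?thesis by (rule that[OF X(1,3)])
qed

text \<open>Strict definiteness leaves room for a perturbation. It allows \<open>X1\<close> to be enlarged to \<open>X1 + e I\<close>,
  which makes the coupling condition between \<open>X1\<close> and \<open>Y1\<close> strict.\<close>

lemma lyapunov_perturb:
  assumes M: "M \<in> carrier_mat k k" and N: "N \<in> carrier_mat k k" and neg: "neg_def M"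
  shows "\<exists>e>0. \<forall>v \<in> carrier_vec k. v \<noteq> 0\<^sub>v k \<longrightarrow> qform M v + e * qform N v < 0"
proof -
  have M': "- M \<in> carrier_mat k k" using M by simp
  have pos: "qform (- M) v > 0" if "v \<in> carrier_vec k" "v \<noteq> 0\<^sub>v k" for v
    using neg that unfolding neg_def_def pos_def_iff[OF M'] by blast
  have "qform (- M) v \<ge> 0" if "v \<in> carrier_vec k" for v
    using pos[OF that] M' by (cases "v = 0\<^sub>v k") (auto simp: qform_def)
  then obtain \<rho> where \<rho>: "\<rho> > 0" "\<And>v. v \<in> carrier_vec k \<Longrightarrow> v \<noteq> 0\<^sub>v k \<Longrightarrow> qform N v < \<rho> * qform (- M) v"
    using finsler[OF N M'] pos by (metis less_irrefl)
  have "qform M v + 1 / \<rho> * qform N v < 0" if "v \<in> carrier_vec k" "v \<noteq> 0\<^sub>v k" for v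
    using \<rho>(2)[OF that] \<rho>(1) by (simp add: qform_uminus_mat[OF M that(1)] field_simps)
  then show ?thesis using \<rho>(1) by (intro exI[of _ "1 / \<rho>"]) simp
qed

text \<open>With \<open>Q = S - Y\<^sup>-\<^sup>1\<close>, positive because of the coupling condition, take \<open>X\<close> with rows \<open>(S, Q)\<close> and
  \<open>(Q, Q)\<close>. Its form at \<open>(x1, x2)\<close> is \<open>Y\<^sup>-\<^sup>1(x1) + Q(x1 + x2)\<close>. Thus \<open>X\<close> has \<open>S\<close> as its leading block,
  while the leading block of its inverse is \<open>Y\<close>; the two final claims express these facts.\<close>

lemma completion_matrix:
  assumes S: "S \<in> carrier_mat m m" "hermitian S" and Y: "Y \<in> carrier_mat m m" "pos_def Y"
    and coupling: "\<And>x y. x \<in> carrier_vec m \<Longrightarrow> y \<in> carrier_vec m \<Longrightarrow> x \<noteq> 0\<^sub>v m \<or> y \<noteq> 0\<^sub>v m \<Longrightarrow>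
      qform (four_block_mat S (1\<^sub>m m) (1\<^sub>m m) Y) (x @\<^sub>v y) > 0"
  obtains X where "X \<in> carrier_mat (m + m) (m + m)" "pos_def X"
    "\<And>x1 x2. x1 \<in> carrier_vec m \<Longrightarrow> x2 \<in> carrier_vec m \<Longrightarrow> vec_last (X *\<^sub>v (x1 @\<^sub>v x2)) m = 0\<^sub>v m \<Longrightarrow>
       \<exists>\<xi> \<in> carrier_vec m. X *\<^sub>v (x1 @\<^sub>v x2) = \<xi> @\<^sub>v 0\<^sub>v m \<and> x1 = Y *\<^sub>v \<xi> \<and> x2 = - x1"
    "\<And>x1. x1 \<in> carrier_vec m \<Longrightarrow> vec_first (X *\<^sub>v (x1 @\<^sub>v 0\<^sub>v m)) m = S *\<^sub>v x1"
proof -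
  obtain Z where Z: "Z \<in> carrier_mat m m" "Y * Z = 1\<^sub>m m" "Z * Y = 1\<^sub>m m" "pos_def Z"
    using pos_def_inverse[OF Y] by blast
  have hY: "hermitian Y" and hZ: "hermitian Z" using Y Z by (auto simp: pos_def_def)
  define Q where "Q = S - Z"
  have Q: "Q \<in> carrier_mat m m" using S Z by (auto simp: Q_def)
  have hQ: "hermitian Q" unfolding Q_def hermitian_def using S(2) hZ S(1) Z(1)
    by (subst adjoint_minus) (auto simp: hermitian_def)
  note d = carrier_matD[OF S(1)] carrier_matD[OF Y(1)] carrier_matD[OF Z(1)] carrier_matD[OF Q]
  have Sx: "S *\<^sub>v x = Z *\<^sub>v x + Q *\<^sub>v x" if "x \<in> carrier_vec m" for x
    using that d unfolding Q_def by (intro eq_vecI) (simp_all add: minus_mult_vec)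
  have YZ: "Y *\<^sub>v (Z *\<^sub>v x) = x" if "x \<in> carrier_vec m" for x
    using assoc_mult_vec[of Y Z x] Z that by (simp add: d)
  have Qpos: "qform Q x > 0" if x: "x \<in> carrier_vec m" "x \<noteq> 0\<^sub>v m" for x
  proof -
    \<comment> \<open>This \<open>y\<close> minimizes the coupling form for given \<open>x\<close>; the minimum is \<open>Q(x)\<close>.\<close>
    let ?y = "- (Z *\<^sub>v x)"
    have y: "?y \<in> carrier_vec m" by (simp add: d)
    have Yy: "Y *\<^sub>v ?y = - x"
    proof -
      have "?y = (-1) \<cdot>\<^sub>v (Z *\<^sub>v x)" by (rule eq_vecI) auto
      then have "Y *\<^sub>v ?y = (-1) \<cdot>\<^sub>v (Y *\<^sub>v (Z *\<^sub>v x))" by (simp add: mult_vec_smult d del: smult_vec_def)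
      then show ?thesis using x by (simp add: YZ) (rule eq_vecI; simp)
    qed
    have "0 < qform (four_block_mat S (1\<^sub>m m) (1\<^sub>m m) Y) (x @\<^sub>v ?y)"
      by (rule coupling) (use x y in auto)
    also have "four_block_mat S (1\<^sub>m m) (1\<^sub>m m) Y *\<^sub>v (x @\<^sub>v ?y) = (S *\<^sub>v x + ?y) @\<^sub>v (x + Y *\<^sub>v ?y)"
      using x y by (subst four_block_mult_vec) (auto simp: d)
    then have "qform (four_block_mat S (1\<^sub>m m) (1\<^sub>m m) Y) (x @\<^sub>v ?y) = Re ((S *\<^sub>v x + ?y) \<bullet>c x) + Re ((x + Y *\<^sub>v ?y) \<bullet>c ?y)"
      using x y unfolding qform_def by (simp add: cscalar_append d)
    also have "x + Y *\<^sub>v ?y = 0\<^sub>v m" unfolding Yy using x by (intro eq_vecI) auto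
    also have "0\<^sub>v m \<bullet>c ?y = 0" using y cscalar_zero_left[of ?y] by simp
    also have "S *\<^sub>v x + ?y = Q *\<^sub>v x" unfolding Sx[OF x(1)] by (intro eq_vecI) (auto simp: d)
    finally show ?thesis by (simp add: qform_def)
  qed
  define X where "X = four_block_mat S Q Q Q"
  have X: "X \<in> carrier_mat (m + m) (m + m)" using S Q by (auto simp: X_def)
  have Xv: "X *\<^sub>v (x1 @\<^sub>v x2) = (S *\<^sub>v x1 + Q *\<^sub>v x2) @\<^sub>v (Q *\<^sub>v x1 + Q *\<^sub>v x2)"
    if "x1 \<in> carrier_vec m" "x2 \<in> carrier_vec m" for x1 x2
    unfolding X_def using that by (subst four_block_mult_vec) (auto simp: d)
  have "hermitian X" unfolding hermitian_def X_def
    using S Q hQ by (subst adjoint_four_block) (auto simp: hermitian_def)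
  moreover have "qform X v > 0" if v: "v \<in> carrier_vec (m + m)" "v \<noteq> 0\<^sub>v (m + m)" for v
  proof -
    obtain x1 x2 where x: "v = x1 @\<^sub>v x2" "x1 \<in> carrier_vec m" "x2 \<in> carrier_vec m"
      using vec_split[OF v(1)] by blast
    have "Re ((Q *\<^sub>v x1) \<bullet>c x2) = Re ((Q *\<^sub>v x2) \<bullet>c x1)"
      using hermitian_cscalar[OF hQ, of x1 x2] x by (simp add: d Re_cscalar_commute)
    then have e: "qform X v = qform Z x1 + qform Q (x1 + x2)"
      using x unfolding qform_def x(1) Xv[OF x(2,3)] Sx[OF x(2)]
      by (simp add: cscalar_append cscalar_add_left cscalar_add_right mult_vec_add d)
    have z: "qform Z (0\<^sub>v m) = 0" "qform Q (0\<^sub>v m) = 0" using Z Q by (auto simp: qform_def)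
    have Zp: "x1 \<noteq> 0\<^sub>v m \<Longrightarrow> qform Z x1 > 0" using Z(4) x(2) unfolding pos_def_iff[OF Z(1)] by blast
    have Qp: "x1 + x2 \<noteq> 0\<^sub>v m \<Longrightarrow> qform Q (x1 + x2) > 0" using Qpos[of "x1 + x2"] x by simp
    have "x1 \<noteq> 0\<^sub>v m \<or> x1 + x2 \<noteq> 0\<^sub>v m"
      using v(2) x by (auto simp: append_vec_eq_zero)
    then show ?thesis using z Zp Qp unfolding e
      by (cases "x1 = 0\<^sub>v m"; cases "x1 + x2 = 0\<^sub>v m") auto
  qed
  ultimately have "pos_def X" by (simp add: pos_def_iff[OF X])
  show ?thesis
  proof (rule that[OF X \<open>pos_def X\<close>])
    fix x1 :: "complex vec" assume "x1 \<in> carrier_vec m"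
    then show "vec_first (X *\<^sub>v (x1 @\<^sub>v 0\<^sub>v m)) m = S *\<^sub>v x1"
      unfolding vec_first_def using Q by (subst Xv) (auto simp: d intro!: eq_vecI)
  next
    fix x1 x2 :: "complex vec" assume x: "x1 \<in> carrier_vec m" "x2 \<in> carrier_vec m"
      and last: "vec_last (X *\<^sub>v (x1 @\<^sub>v x2)) m = 0\<^sub>v m"
    have "vec_last (X *\<^sub>v (x1 @\<^sub>v x2)) m = Q *\<^sub>v x1 + Q *\<^sub>v x2"
      unfolding vec_last_def Xv[OF x] by (intro eq_vecI) (auto simp: d)
    then have Q0: "Q *\<^sub>v (x1 + x2) = 0\<^sub>v m" using last x by (simp add: mult_vec_add d)
    have s0: "x1 + x2 = 0\<^sub>v m"
    proof (rule ccontr)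
      assume "x1 + x2 \<noteq> 0\<^sub>v m"
      then have "qform Q (x1 + x2) > 0" using Qpos x by simp
      moreover have "qform Q (x1 + x2) = 0" unfolding qform_def Q0 using x cscalar_zero_left[of "x1 + x2"] by simp
      ultimately show False by simp
    qed
    have x2: "x2 = - x1"
    proof (rule eq_vecI)
      fix i assume i: "i < dim_vec (- x1)"
      have "(x1 + x2) $ i = 0" using s0 i x by simp
      then show "x2 $ i = (- x1) $ i" using i x by (simp add: eq_neg_iff_add_eq_0 add.commute)
    qed (use x in simp)
    have Qs: "Q *\<^sub>v x1 + Q *\<^sub>v x2 = 0\<^sub>v m" using Q0 x by (simp add: mult_vec_add d)
    have "S *\<^sub>v x1 + Q *\<^sub>v x2 = Z *\<^sub>v x1 + (Q *\<^sub>v x1 + Q *\<^sub>v x2)"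
      unfolding Sx[OF x(1)] by (intro eq_vecI) (auto simp: d)
    also have "\<dots> = Z *\<^sub>v x1" unfolding Qs by (intro eq_vecI) (auto simp: d)
    finally have "X *\<^sub>v (x1 @\<^sub>v x2) = (Z *\<^sub>v x1) @\<^sub>v 0\<^sub>v m" unfolding Xv[OF x] Qs by simp
    moreover have "x1 = Y *\<^sub>v (Z *\<^sub>v x1)" using YZ x by simp
    ultimately show "\<exists>\<xi> \<in> carrier_vec m. X *\<^sub>v (x1 @\<^sub>v x2) = \<xi> @\<^sub>v 0\<^sub>v m \<and> x1 = Y *\<^sub>v \<xi> \<and> x2 = - x1"
      using x2 by (intro bexI[of _ "Z *\<^sub>v x1"]) (auto simp: d)
  qed
qed

text \<open>On the kernel of \<open>Pi_mat\<close> only \<open>x1\<close> and \<open>z\<close> survive; completing the square in \<open>z\<close> leaves the Lyapunov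
  form of \<open>S\<close> at \<open>x1\<close>. On the kernel of \<open>Lambda_X\<close> the vector \<open>X (x1, x2)\<close> is \<open>(\<xi>, 0)\<close> with \<open>x1 = Y1 \<xi>\<close>
  and \<open>(\<xi>, z)\<close> in the kernel of \<open>C1 @\<^sub>c D1\<close>, that is, in the image of \<open>N\<close>; the form becomes that of the
  projected inequality.\<close>

lemma design_exists:
  assumes A: "A \<in> carrier_mat m m" and B: "B \<in> carrier_mat m p"
    and C1: "C1 \<in> carrier_mat ny m" and C2: "C2 \<in> carrier_mat n m"
    and D1: "D1 \<in> carrier_mat ny p" and D2: "D2 \<in> carrier_mat n p"
    and N: "dim_row N = m + p" "mat_image N = mat_kernel (C1 @\<^sub>c D1)"
    and lmi: "lmi_feasible m n p l A B C2 D2 N g X1 Y1"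
  shows "\<exists>A11 B11 C11 J11. design_inequality m m n ny p A B C1 C2 D1 D2 g A11 B11 C11 J11"
proof -
  have X1: "X1 \<in> carrier_mat m m" "hermitian X1" and Y1: "Y1 \<in> carrier_mat m m" "hermitian Y1" "pos_def Y1"
    and lyap: "neg_def (A * X1 + X1 * A\<^sup>\<dagger> + B * B\<^sup>\<dagger>)"
    and psd: "pos_semidef (four_block_mat X1 (1\<^sub>m m) (1\<^sub>m m) Y1)"
    and lmi2: "neg_def (
       four_block_mat N\<^sup>\<dagger> (0\<^sub>m (dim_col N) n) (0\<^sub>m n (m + p)) (1\<^sub>m n) *
       bounded_real_block Y1 A B C2 D2 (1\<^sub>m p) (complex_of_real (g\<^sup>2) \<cdot>\<^sub>m 1\<^sub>m n) *
       four_block_mat N (0\<^sub>m (m + p) n) (0\<^sub>m n (dim_col N)) (1\<^sub>m n))"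
    using lmi unfolding lmi_feasible_def bounded_real_block_def by auto
  note d = carrier_matD[OF A] carrier_matD[OF B] carrier_matD[OF C1] carrier_matD[OF C2]
      carrier_matD[OF D1] carrier_matD[OF D2] carrier_matD[OF X1(1)] carrier_matD[OF Y1(1)] N(1)
  define L where "L = A * X1 + X1 * A\<^sup>\<dagger> + B * B\<^sup>\<dagger>"
  have L: "L \<in> carrier_mat m m" unfolding L_def by (intro carrier_matI) (simp_all add: d)
  have AA: "A + A\<^sup>\<dagger> \<in> carrier_mat m m" by (intro carrier_matI) (simp_all add: d)
  obtain e where e: "e > 0" "\<And>v. v \<in> carrier_vec m \<Longrightarrow> v \<noteq> 0\<^sub>v m \<Longrightarrow> qform L v + e * qform (A + A\<^sup>\<dagger>) v < 0"
    using lyapunov_perturb[OF L AA] lyap unfolding L_def by blast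
  define S where "S = X1 + complex_of_real e \<cdot>\<^sub>m 1\<^sub>m m"
  have S: "S \<in> carrier_mat m m" "hermitian S"
    using X1 unfolding S_def hermitian_def by (auto simp: adjoint_add adjoint_smult)
  have Sv: "S *\<^sub>v v = X1 *\<^sub>v v + complex_of_real e \<cdot>\<^sub>v v" if "v \<in> carrier_vec m" for v
    using that unfolding S_def by (simp add: add_mult_vec smult_mult_vec d)
  have coupling: "qform (four_block_mat S (1\<^sub>m m) (1\<^sub>m m) Y1) (x @\<^sub>v y) > 0"
    if xy: "x \<in> carrier_vec m" "y \<in> carrier_vec m" "x \<noteq> 0\<^sub>v m \<or> y \<noteq> 0\<^sub>v m" for x y
  proof -
    have 1: "qform (four_block_mat S (1\<^sub>m m) (1\<^sub>m m) Y1) (x @\<^sub>v y) =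
        qform (four_block_mat X1 (1\<^sub>m m) (1\<^sub>m m) Y1) (x @\<^sub>v y) + e * sqnorm x"
      using xy S unfolding qform_def
      by (simp add: four_block_mult_vec Sv d cscalar_append cscalar_add_left cscalar_smult_left)
    have 2: "qform (four_block_mat X1 (1\<^sub>m m) (1\<^sub>m m) Y1) (x @\<^sub>v y) \<ge> 0"
      using psd xy unfolding pos_semidef_def qform_def by (simp add: d)
    show ?thesis
    proof (cases "x = 0\<^sub>v m")
      case False
      then have "e * sqnorm x > 0" using e(1) cscalar_self_pos[of x] xy by simp
      then show ?thesis using 1 2 by linarith
    next
      case True
      then have "y \<noteq> 0\<^sub>v m" using xy by simp
      then have "qform Y1 y > 0" using Y1(3) xy(2) unfolding pos_def_iff[OF Y1(1)] by blast
      moreover have "qform (four_block_mat X1 (1\<^sub>m m) (1\<^sub>m m) Y1) (x @\<^sub>v y) = qform Y1 y"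
      proof -
        have "X1 *\<^sub>v 0\<^sub>v m = 0\<^sub>v m" "(0\<^sub>v m + y) = y" "0\<^sub>v m + Y1 *\<^sub>v y = Y1 *\<^sub>v y" "(0\<^sub>v m + y) \<bullet>c 0\<^sub>v m = 0"
          using xy mult_vec_zero[of X1] cscalar_zero_right[of y] by (auto simp: d)
        then show ?thesis
          using True xy unfolding qform_def by (simp add: four_block_mult_vec d cscalar_append)
      qed
      ultimately show ?thesis using 1 True e(1) cscalar_self_nonneg[of x] by simp
    qed
  qed
  obtain X where X: "X \<in> carrier_mat (m + m) (m + m)" "pos_def X"
    and Xlast: "\<And>x1 x2. x1 \<in> carrier_vec m \<Longrightarrow> x2 \<in> carrier_vec m \<Longrightarrow> vec_last (X *\<^sub>v (x1 @\<^sub>v x2)) m = 0\<^sub>v m \<Longrightarrow>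
       \<exists>\<xi> \<in> carrier_vec m. X *\<^sub>v (x1 @\<^sub>v x2) = \<xi> @\<^sub>v 0\<^sub>v m \<and> x1 = Y1 *\<^sub>v \<xi> \<and> x2 = - x1"
    and Xfirst: "\<And>x1. x1 \<in> carrier_vec m \<Longrightarrow> vec_first (X *\<^sub>v (x1 @\<^sub>v 0\<^sub>v m)) m = S *\<^sub>v x1"
    using completion_matrix[OF S Y1(1,3) coupling] by blast
  have hX: "hermitian X" using X(2) by (simp add: pos_def_def)
  let ?q = "(m + m) + (n + p)"
  let ?S = "Sigma_X m m n p A B C2 D2 g X" and ?P = "Pi_mat m m n p" and ?L = "Lambda_X m m n ny p C1 D1 X"
  have "\<exists>K \<in> carrier_mat (m + ny) (m + n). \<forall>v \<in> carrier_vec ?q. v \<noteq> 0\<^sub>v ?q \<longrightarrow>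
    qform ?S v + 2 * Re ((K *\<^sub>v (?P *\<^sub>v v)) \<bullet>c (?L *\<^sub>v v)) < 0"
  proof (rule projection_lemma)
    show "?S \<in> carrier_mat ?q ?q" by (rule Sigma_X_carrier[OF A B C1 C2 D1 D2 X(1) hX])
    show "hermitian ?S" by (rule Sigma_X_hermitian[OF A B C1 C2 D1 D2 X(1) hX])
    show P: "?P \<in> carrier_mat (m + n) ?q" by (rule Pi_mat_carrier[OF A B C1 C2 D1 D2])
    show "?L \<in> carrier_mat (m + ny) ?q" by (rule Lambda_X_carrier[OF A B C1 C2 D1 D2 X(1)])
    note dP = carrier_matD[OF P]
    show "w = 0\<^sub>v (m + n)" if w: "w \<in> carrier_vec (m + n)" "?P\<^sup>\<dagger> *\<^sub>v w = 0\<^sub>v ?q" for w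
    proof (rule ccontr)
      assume nz: "w \<noteq> 0\<^sub>v (m + n)"
      obtain x2 u where xu: "w = x2 @\<^sub>v u" "x2 \<in> carrier_vec m" "u \<in> carrier_vec n"
        using vec_split[OF w(1)] by blast
      let ?v = "(0\<^sub>v m @\<^sub>v x2) @\<^sub>v u @\<^sub>v 0\<^sub>v p"
      have v: "?v \<in> carrier_vec ?q" using xu by simp
      have "w \<bullet>c w = (?P *\<^sub>v ?v) \<bullet>c w"
        unfolding xu(1) by (subst Pi_mat_mult[OF A B C1 C2 D1 D2]) (use xu in auto)
      also have "\<dots> = ?v \<bullet>c (?P\<^sup>\<dagger> *\<^sub>v w)" using v w(1) carrier_vecD[OF w(1)] by (intro cscalar_adjoint) (simp_all only: dP carrier_vecD)
      also have "\<dots> = 0" unfolding w(2) using v cscalar_zero_right[of ?v] by simp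
      finally show False using cscalar_self_pos[of w] w(1) nz by simp
    qed
    show "qform ?S v < 0" if v: "v \<in> carrier_vec ?q" "v \<noteq> 0\<^sub>v ?q" "?P *\<^sub>v v = 0\<^sub>v (m + n)" for v
    proof -
      obtain x1 x2 u z where vx: "v = (x1 @\<^sub>v x2) @\<^sub>v u @\<^sub>v z"
        and c: "x1 \<in> carrier_vec m" "x2 \<in> carrier_vec m" "u \<in> carrier_vec n" "z \<in> carrier_vec p"
        using v(1) by (metis vec_split)
      have "x2 @\<^sub>v u = 0\<^sub>v (m + n)" using v(3) unfolding vx Pi_mat_mult[OF A B C1 C2 D1 D2 c] .
      then have z0: "x2 = 0\<^sub>v m" "u = 0\<^sub>v n" using c by (auto simp: append_vec_eq_zero)
      then have nz: "x1 \<noteq> 0\<^sub>v m \<or> z \<noteq> 0\<^sub>v p" using v(2) c unfolding vx by auto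
      note dd = d c[THEN carrier_vecD]
      have zz: "C2\<^sup>\<dagger> *\<^sub>v 0\<^sub>v n = 0\<^sub>v m" "D2\<^sup>\<dagger> *\<^sub>v 0\<^sub>v n = 0\<^sub>v p"
        using mult_vec_zero[of "C2\<^sup>\<dagger>"] mult_vec_zero[of "D2\<^sup>\<dagger>"] by (simp_all add: d)
      have "X *\<^sub>v (x1 @\<^sub>v 0\<^sub>v m) \<in> carrier_vec (m + m)" using X by (simp add: carrier_matD[OF X(1)])
      then obtain \<xi>1 \<xi>2 where xi: "X *\<^sub>v (x1 @\<^sub>v 0\<^sub>v m) = \<xi>1 @\<^sub>v \<xi>2" "\<xi>1 \<in> carrier_vec m" "\<xi>2 \<in> carrier_vec m"
        by (rule vec_split)
      have "vec_first (\<xi>1 @\<^sub>v \<xi>2) m = \<xi>1" using xi by (intro eq_vecI) (auto simp: vec_first_def)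
      then have xi1: "\<xi>1 = S *\<^sub>v x1" using Xfirst[OF c(1)] xi(1) by simp
      have "\<xi>2 \<bullet>c 0\<^sub>v m = 0" using xi(3) cscalar_zero_right[of \<xi>2] by simp
      moreover have "Re ((0\<^sub>v n :: complex vec) \<bullet>c 0\<^sub>v n) = 0" by simp
      ultimately have 1: "qform ?S v = 2 * Re ((S *\<^sub>v x1) \<bullet>c (A\<^sup>\<dagger> *\<^sub>v x1)) + 2 * Re (z \<bullet>c (B\<^sup>\<dagger> *\<^sub>v x1)) - sqnorm z"
        unfolding vx unfolding Sigma_X_qform[OF A B C1 C2 D1 D2 X(1) hX c] unfolding z0 zz xi(1)
        using xi by (simp add: xi1 cscalar_append d carrier_matD[OF S(1)])
      define b where "b = B\<^sup>\<dagger> *\<^sub>v x1"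
      have b: "b \<in> carrier_vec p" by (simp add: b_def d)
      have 2: "qform L x1 = 2 * Re ((X1 *\<^sub>v x1) \<bullet>c (A\<^sup>\<dagger> *\<^sub>v x1)) + sqnorm b"
      proof -
        have "(A *\<^sub>v (X1 *\<^sub>v x1)) \<bullet>c x1 = (X1 *\<^sub>v x1) \<bullet>c (A\<^sup>\<dagger> *\<^sub>v x1)"
          "(B *\<^sub>v b) \<bullet>c x1 = b \<bullet>c b" unfolding b_def by (subst cscalar_adjoint; simp add: dd)+
        moreover have "Re ((X1 *\<^sub>v (A\<^sup>\<dagger> *\<^sub>v x1)) \<bullet>c x1) = Re ((X1 *\<^sub>v x1) \<bullet>c (A\<^sup>\<dagger> *\<^sub>v x1))"
          by (subst hermitian_cscalar[OF X1(2)]; simp add: dd Re_cscalar_commute)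
        ultimately show ?thesis unfolding qform_def L_def
          by (simp add: add_mult_vec assoc_mult_vec dd cscalar_add_left flip: b_def)
      qed
      have 3: "qform (A + A\<^sup>\<dagger>) x1 = 2 * Re (x1 \<bullet>c (A\<^sup>\<dagger> *\<^sub>v x1))"
      proof -
        have "(A *\<^sub>v x1) \<bullet>c x1 = x1 \<bullet>c (A\<^sup>\<dagger> *\<^sub>v x1)" by (subst cscalar_adjoint; simp add: dd)
        moreover have "Re ((A\<^sup>\<dagger> *\<^sub>v x1) \<bullet>c x1) = Re (x1 \<bullet>c (A\<^sup>\<dagger> *\<^sub>v x1))" by (rule Re_cscalar_commute) (simp add: dd)
        ultimately show ?thesis unfolding qform_def by (simp add: add_mult_vec dd cscalar_add_left)
      qed
      have 4: "2 * Re ((S *\<^sub>v x1) \<bullet>c (A\<^sup>\<dagger> *\<^sub>v x1)) = qform L x1 - sqnorm b + e * qform (A + A\<^sup>\<dagger>) x1"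
        unfolding Sv[OF c(1)] 2 3 by (simp add: cscalar_add_left cscalar_smult_left dd)
      have 5: "sqnorm (z - b) = sqnorm z - 2 * Re (z \<bullet>c b) + sqnorm b"
        using Re_cscalar_commute[of b z] b by (simp add: cscalar_minus_left cscalar_minus_right dd)
      have 6: "qform ?S v = (qform L x1 + e * qform (A + A\<^sup>\<dagger>) x1) - sqnorm (z - b)"
        using 1[folded b_def] 4 5 by simp
      show ?thesis
      proof (cases "x1 = 0\<^sub>v m")
        case False
        then show ?thesis using e(2)[OF c(1)] cscalar_self_nonneg[of "z - b"] unfolding 6 by linarith
      next
        case True
        have "b = 0\<^sub>v p" unfolding b_def True using mult_vec_zero[of "B\<^sup>\<dagger>"] by (simp add: d)
        then have "z - b = z" using c by (intro eq_vecI) auto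
        moreover have "sqnorm z > 0" using cscalar_self_pos[of z] nz True c by simp
        moreover have "qform L x1 = 0" "qform (A + A\<^sup>\<dagger>) x1 = 0" using L AA unfolding True by (auto simp: qform_def)
        ultimately show ?thesis unfolding 6 by simp
      qed
    qed
    show "qform ?S v < 0" if v: "v \<in> carrier_vec ?q" "v \<noteq> 0\<^sub>v ?q" "?L *\<^sub>v v = 0\<^sub>v (m + ny)" for v
    proof -
      obtain x1 x2 u z where vx: "v = (x1 @\<^sub>v x2) @\<^sub>v u @\<^sub>v z"
        and c: "x1 \<in> carrier_vec m" "x2 \<in> carrier_vec m" "u \<in> carrier_vec n" "z \<in> carrier_vec p"
        using v(1) by (metis vec_split)
      note dd = d c[THEN carrier_vecD]
      have "X *\<^sub>v (x1 @\<^sub>v x2) \<in> carrier_vec (m + m)" using X by (simp add: carrier_matD[OF X(1)])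
      then obtain \<xi>1 \<xi>2 where xi: "X *\<^sub>v (x1 @\<^sub>v x2) = \<xi>1 @\<^sub>v \<xi>2" "\<xi>1 \<in> carrier_vec m" "\<xi>2 \<in> carrier_vec m"
        by (rule vec_split)
      have xc: "x1 @\<^sub>v x2 \<in> carrier_vec (m + m)" using c by simp
      have "\<xi>2 @\<^sub>v (C1 *\<^sub>v \<xi>1 + D1 *\<^sub>v z) = 0\<^sub>v (m + ny)"
        using v(3) unfolding vx Lambda_X_mult[OF A B C1 C2 D1 D2 X(1) xc c(3,4) xi] .
      then have k: "\<xi>2 = 0\<^sub>v m" "C1 *\<^sub>v \<xi>1 + D1 *\<^sub>v z = 0\<^sub>v ny"
        using xi by (auto simp: append_vec_eq_zero d)
      have "vec_last (X *\<^sub>v (x1 @\<^sub>v x2)) m = 0\<^sub>v m"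
        unfolding xi(1) k(1) using xi(2) by (intro eq_vecI) (auto simp: vec_last_def)
      then obtain \<xi> where "\<xi> \<in> carrier_vec m" "X *\<^sub>v (x1 @\<^sub>v x2) = \<xi> @\<^sub>v 0\<^sub>v m" "x1 = Y1 *\<^sub>v \<xi>" "x2 = - x1"
        using Xlast[OF c(1,2)] by blast
      moreover from this have "\<xi> = \<xi>1" using xi by (metis append_vec_eq)
      ultimately have x1: "x1 = Y1 *\<^sub>v \<xi>1" and x2: "x2 = - x1" by auto
      have "\<xi>1 @\<^sub>v z \<in> mat_kernel (C1 @\<^sub>c D1)"
        using k(2) xi c unfolding mat_kernel_def by (simp add: append_cols_mult_vec d)
      then obtain w where w: "w \<in> carrier_vec (dim_col N)" "\<xi>1 @\<^sub>v z = N *\<^sub>v w"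
        unfolding N(2)[symmetric] mat_image_def by auto
      have nz: "w \<noteq> 0\<^sub>v (dim_col N) \<or> u \<noteq> 0\<^sub>v n"
      proof (rule ccontr)
        assume "\<not> ?thesis"
        then have w0: "w = 0\<^sub>v (dim_col N)" and u0: "u = 0\<^sub>v n" by auto
        have "\<xi>1 @\<^sub>v z = 0\<^sub>v (m + p)" unfolding w w0 using N(1) by simp
        then have "\<xi>1 = 0\<^sub>v m" "z = 0\<^sub>v p" using xi c by (auto simp: append_vec_eq_zero)
        moreover from this have "x1 = 0\<^sub>v m" unfolding x1 using mult_vec_zero[of Y1] by (simp add: d)
        moreover from this have "x2 = 0\<^sub>v m" unfolding x2 by (intro eq_vecI) auto
        ultimately show False using v(2) u0 unfolding vx by simp
      qed
      let ?M = "bounded_real_block Y1 A B C2 D2 (1\<^sub>m p) (complex_of_real (g\<^sup>2) \<cdot>\<^sub>m 1\<^sub>m n)"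
      let ?T = "four_block_mat N (0\<^sub>m (m + p) n) (0\<^sub>m n (dim_col N)) (1\<^sub>m n)"
      have M: "?M \<in> carrier_mat (m + (p + n)) (m + (p + n))"
        by (rule bounded_real_block_carrier[OF Y1(1,2) A B C2 D2]) (auto simp: scalar_hermitian)
      have T: "?T \<in> carrier_mat (m + (p + n)) (dim_col N + n)" using N(1) by (intro carrier_matI) auto
      have Td: "?T\<^sup>\<dagger> = four_block_mat N\<^sup>\<dagger> (0\<^sub>m (dim_col N) n) (0\<^sub>m n (m + p)) (1\<^sub>m n)"
        using N(1) by (subst adjoint_four_block[where ?r1.0 = "m + p" and ?r2.0 = n and ?c1.0 = "dim_col N" and ?c2.0 = n]) auto
      have TMT: "?T\<^sup>\<dagger> * ?M * ?T \<in> carrier_mat (dim_col N + n) (dim_col N + n)" using T M by (intro carrier_matI) auto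
      have wu: "w @\<^sub>v u \<in> carrier_vec (dim_col N + n)" "w @\<^sub>v u \<noteq> 0\<^sub>v (dim_col N + n)"
        using w c nz by (auto simp: append_vec_eq_zero)
      have "qform (- (?T\<^sup>\<dagger> * ?M * ?T)) (w @\<^sub>v u) > 0"
        using lmi2 wu unfolding Td[symmetric] neg_def_def pos_def_iff[OF uminus_carrier_mat[OF TMT]] by blast
      then have "qform ?M (?T *\<^sub>v (w @\<^sub>v u)) < 0"
        unfolding qform_uminus_mat[OF TMT wu(1)] qform_congruence[OF M T wu(1)] by simp
      also have "?T *\<^sub>v (w @\<^sub>v u) = (N *\<^sub>v w) @\<^sub>v u"
      proof -
        have "0\<^sub>m (m + p) n *\<^sub>v u = 0\<^sub>v (m + p)" "0\<^sub>m n (dim_col N) *\<^sub>v w = 0\<^sub>v n"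
          using zero_mult_vec[of "m + p" u] zero_mult_vec[of n w] w c by auto
        moreover have "N *\<^sub>v w + 0\<^sub>v (m + p) = N *\<^sub>v w" "0\<^sub>v n + u = u" using c N(1) by auto
        ultimately show ?thesis using w c N(1) by (subst four_block_mult_vec) auto
      qed
      also have "(N *\<^sub>v w) @\<^sub>v u = \<xi>1 @\<^sub>v z @\<^sub>v u" by (simp add: append_vec_assoc flip: w(2))
      also have "qform ?M (\<xi>1 @\<^sub>v z @\<^sub>v u) =
          2 * Re ((Y1 *\<^sub>v \<xi>1) \<bullet>c (A *\<^sub>v \<xi>1 + B *\<^sub>v z)) + 2 * Re (u \<bullet>c (C2 *\<^sub>v \<xi>1 + D2 *\<^sub>v z)) - sqnorm z - g\<^sup>2 * sqnorm u"
        using qform_smult_mat[OF one_carrier_mat c(3), of "g\<^sup>2"]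
        by (subst bounded_real_block_qform[OF Y1(1,2) A B C2 D2 _ _ _ _ xi(2) c(4,3)])
           (simp_all add: scalar_hermitian qform_one c)
      also have "\<dots> = qform ?S v"
      proof -
        have 1: "Re ((Y1 *\<^sub>v \<xi>1) \<bullet>c (A *\<^sub>v \<xi>1)) = Re (\<xi>1 \<bullet>c (A\<^sup>\<dagger> *\<^sub>v x1))"
          using cscalar_adjoint[of A \<xi>1 x1] Re_cscalar_commute[of x1 "A *\<^sub>v \<xi>1"] xi by (simp add: dd flip: x1)
        have 2: "Re ((Y1 *\<^sub>v \<xi>1) \<bullet>c (B *\<^sub>v z)) = Re (z \<bullet>c (B\<^sup>\<dagger> *\<^sub>v x1))"
          using cscalar_adjoint[of B z x1] Re_cscalar_commute[of x1 "B *\<^sub>v z"] xi by (simp add: dd flip: x1)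
        have 3: "Re (u \<bullet>c (C2 *\<^sub>v \<xi>1)) = Re (\<xi>1 \<bullet>c (C2\<^sup>\<dagger> *\<^sub>v u))"
          using cscalar_adjoint[of C2 \<xi>1 u] Re_cscalar_commute[of u "C2 *\<^sub>v \<xi>1"] xi by (simp add: dd)
        have 4: "Re (u \<bullet>c (D2 *\<^sub>v z)) = Re (z \<bullet>c (D2\<^sup>\<dagger> *\<^sub>v u))"
          using cscalar_adjoint[of D2 z u] Re_cscalar_commute[of u "D2 *\<^sub>v z"] xi by (simp add: dd)
        have 5: "(0\<^sub>v m :: complex vec) \<bullet>c 0\<^sub>v m = 0" by simp
        show ?thesis
          unfolding vx Sigma_X_qform[OF A B C1 C2 D1 D2 X(1) hX c] xi(1) k(1)
          using 1 2 3 4 5 xi by (simp add: cscalar_append cscalar_add_right dd)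
      qed
      finally show ?thesis .
    qed
  qed
  then obtain K where K: "K \<in> carrier_mat (m + ny) (m + n)"
    "\<forall>v \<in> carrier_vec ?q. v \<noteq> 0\<^sub>v ?q \<longrightarrow> qform ?S v + 2 * Re ((K *\<^sub>v (?P *\<^sub>v v)) \<bullet>c (?L *\<^sub>v v)) < 0"
    by blast
  obtain A11 B11 C11 J11 where K': "A11 \<in> carrier_mat m m" "B11 \<in> carrier_mat m ny"
    "C11 \<in> carrier_mat n m" "J11 \<in> carrier_mat n ny" "K_mat A11 B11 C11 J11 = K"
    using K_mat_surj[OF K(1)] by blast
  have "design_inequality m m n ny p A B C1 C2 D1 D2 g A11 B11 C11 J11"
    unfolding design_inequality_def Let_def K'(5)
    using K' X hX K(2) design_matrix_qform[OF A B C1 C2 D1 D2 X(1) hX K(1), of g] by blast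
  then show ?thesis by blast
qed

section \<open>Rational transfer functions in state space form\<close>

lemma mat_inv_det:
  assumes M: "M \<in> carrier_mat n n" and det: "det M \<noteq> 0"
  shows "mat_inv M \<in> carrier_mat n n" "M * mat_inv M = 1\<^sub>m n" "mat_inv M * M = 1\<^sub>m n"
proof -
  have "M \<in> Units (ring_mat TYPE(complex) n undefined)" using det_non_zero_imp_unit[OF M det] .
  then obtain N where "mat_inverse M = Some N" using mat_inverse(1)[OF M] by fastforce
  then show "mat_inv M \<in> carrier_mat n n" "M * mat_inv M = 1\<^sub>m n" "mat_inv M * M = 1\<^sub>m n"
    using mat_inverse(2)[OF M] by (auto simp: mat_inv_def)
qed

lemma mat_inv_carrier: "M \<in> carrier_mat n n \<Longrightarrow> mat_inv M \<in> carrier_mat n n"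
  using mat_inverse(2)[of M n] by (auto simp: mat_inv_def split: option.splits)

lemma mat_inv_entry:
  assumes M: "M \<in> carrier_mat n n" and det: "det M \<noteq> 0" and ij: "i < n" "j < n"
  shows "mat_inv M $$ (i, j) = cofactor M j i / det M"
proof -
  note I = mat_inv_det[OF M det] and adj = adj_mat[OF M]
  have "adj_mat M = mat_inv M * M * adj_mat M" using adj(1) I(3) by simp
  also have "\<dots> = mat_inv M * (M * adj_mat M)" by (rule assoc_mult_mat[OF I(1) M adj(1)])
  also have "\<dots> = det M \<cdot>\<^sub>m mat_inv M"
    unfolding adj(2) using I(1) by (simp add: mult_smult_distrib[OF I(1) one_carrier_mat])
  finally have "adj_mat M $$ (i, j) = det M * mat_inv M $$ (i, j)" using I(1) ij by simp
  then show ?thesis using M ij det by (simp add: adj_mat_def field_simps)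
qed

lemma resolvent_det:
  assumes A: "A \<in> carrier_mat m m"
  shows "det (s \<cdot>\<^sub>m 1\<^sub>m (dim_row A) - A) = poly (char_poly A) (s::complex)"
  unfolding char_poly_def using A
  by (intro poly_det_cong[symmetric, of _ m]) (auto simp: char_poly_matrix_def)

text \<open>Cramer's rule: the cofactors of the characteristic matrix have degree below \<open>m\<close>.\<close>

lemma resolvent_entry:
  assumes A: "A \<in> carrier_mat m m" and ij: "i < m" "j < m"
  shows "\<exists>p. (p = 0 \<or> degree p < m) \<and> (\<forall>s. poly (char_poly A) s \<noteq> 0 \<longrightarrow>
    mat_inv (s \<cdot>\<^sub>m 1\<^sub>m (dim_row A) - A) $$ (i, j) = poly p (s::complex) / poly (char_poly A) s)"
proof -
  let ?M = "char_poly_matrix A"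
  have M: "?M \<in> carrier_mat m m" using A by simp
  define p where "p = cofactor ?M j i"
  have dA: "dim_row A = m" "dim_col A = m" using A by auto
  have del: "mat_delete ?M j i \<in> carrier_mat (m - 1) (m - 1)" by (rule mat_delete_carrier[OF M])
  have "degree (det (mat_delete ?M j i)) \<le> 1 * (m - 1)"
  proof (rule degree_det_le[OF _ del])
    fix a b assume "a < m - 1" "b < m - 1"
    then show "degree (mat_delete ?M j i $$ (a, b)) \<le> 1"
      using ij unfolding mat_delete_def char_poly_matrix_def
      by (auto simp: dA intro!: order_trans[OF degree_add_le_max] split: if_splits)
  qed
  moreover have "degree p \<le> degree (det (mat_delete ?M j i))"
    unfolding p_def cofactor_def by (cases "even (j + i)") auto
  ultimately have "degree p < m" using ij by simp
  moreover have "mat_inv (s \<cdot>\<^sub>m 1\<^sub>m (dim_row A) - A) $$ (i, j) = poly p s / poly (char_poly A) s"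
    if s: "poly (char_poly A) s \<noteq> 0" for s
  proof -
    let ?S = "s \<cdot>\<^sub>m 1\<^sub>m (dim_row A) - A"
    have S: "?S \<in> carrier_mat m m" using A by auto
    have delS: "mat_delete ?S j i \<in> carrier_mat (m - 1) (m - 1)" by (rule mat_delete_carrier[OF S])
    have "poly (det (mat_delete ?M j i)) s = det (mat_delete ?S j i)"
    proof (rule poly_det_cong[OF delS del])
      fix a b assume "a < m - 1" "b < m - 1"
      then show "poly (mat_delete ?M j i $$ (a, b)) s = mat_delete ?S j i $$ (a, b)"
        using ij unfolding mat_delete_def char_poly_matrix_def by (auto simp: dA)
    qed
    then have "poly p s = cofactor ?S j i" unfolding p_def cofactor_def by simp
    then show ?thesis using mat_inv_entry[OF S _ ij] s resolvent_det[OF A, of s] by simp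
  qed
  ultimately show ?thesis by blast
qed

lemma state_space_carrier:
  assumes "A \<in> carrier_mat m m" "B \<in> carrier_mat m c" "C \<in> carrier_mat r m" "D \<in> carrier_mat r c"
  shows "state_space A B C D s \<in> carrier_mat r c"
  unfolding state_space_def using assms by (intro carrier_matI) auto

lemma degree_sum_less_or_zero:
  fixes f :: "'b \<Rightarrow> 'a::comm_ring_1 poly"
  assumes "\<And>x. x \<in> S \<Longrightarrow> f x = 0 \<or> degree (f x) < m"
  shows "sum f S = 0 \<or> degree (sum f S) < m"
  using assms
proof (induction S rule: infinite_finite_induct)
  case (insert x S)
  then have a: "f x = 0 \<or> degree (f x) < m" and b: "sum f S = 0 \<or> degree (sum f S) < m" by auto
  have "f x + sum f S = 0 \<or> degree (f x + sum f S) < m"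
    using a b degree_add_le_max[of "f x" "sum f S"] by auto
  then show ?case using insert by simp
qed auto

lemma state_space_entry:
  assumes A: "A \<in> carrier_mat m m" and B: "B \<in> carrier_mat m c" and C: "C \<in> carrier_mat r m"
    and D: "D \<in> carrier_mat r c" and ij: "i < r" "j < c"
  shows "\<exists>p. (p = 0 \<or> degree p < degree (char_poly A)) \<and> (\<forall>s. poly (char_poly A) s \<noteq> 0 \<longrightarrow>
    state_space A B C D s $$ (i, j) = D $$ (i, j) + poly p (s::complex) / poly (char_poly A) s)"
proof -
  have "\<forall>k l. \<exists>p. k < m \<longrightarrow> l < m \<longrightarrow> (p = 0 \<or> degree p < m) \<and> (\<forall>s. poly (char_poly A) s \<noteq> 0 \<longrightarrow>
    mat_inv (s \<cdot>\<^sub>m 1\<^sub>m (dim_row A) - A) $$ (k, l) = poly p (s::complex) / poly (char_poly A) s)"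
    using resolvent_entry[OF A] by blast
  then obtain P where P: "\<And>k l. k < m \<Longrightarrow> l < m \<Longrightarrow> P k l = 0 \<or> degree (P k l) < m"
    "\<And>k l s. k < m \<Longrightarrow> l < m \<Longrightarrow> poly (char_poly A) s \<noteq> 0 \<Longrightarrow>
      mat_inv (s \<cdot>\<^sub>m 1\<^sub>m (dim_row A) - A) $$ (k, l) = poly (P k l) (s::complex) / poly (char_poly A) s"
    by metis
  define p where "p = (\<Sum>l<m. \<Sum>k<m. Polynomial.smult (C $$ (i, k) * B $$ (l, j)) (P k l))"
  have "p = 0 \<or> degree p < m" unfolding p_def
  proof (intro degree_sum_less_or_zero)
    fix l k assume "l \<in> {..<m}" "k \<in> {..<m}"
    then show "Polynomial.smult (C $$ (i, k) * B $$ (l, j)) (P k l) = 0 \<or> degree (Polynomial.smult (C $$ (i, k) * B $$ (l, j)) (P k l)) < m"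
      using P(1)[of k l] degree_smult_le[of "C $$ (i, k) * B $$ (l, j)" "P k l"] by auto
  qed
  then have "p = 0 \<or> degree p < degree (char_poly A)" using degree_monic_char_poly[OF A] by simp
  moreover have "state_space A B C D s $$ (i, j) = D $$ (i, j) + poly p s / poly (char_poly A) s"
    if s: "poly (char_poly A) s \<noteq> 0" for s
  proof -
    let ?S = "s \<cdot>\<^sub>m 1\<^sub>m (dim_row A) - A"
    have S: "mat_inv ?S \<in> carrier_mat m m" by (rule mat_inv_carrier) (use A in auto)
    have dims: "dim_row (mat_inv ?S) = m" "dim_col (mat_inv ?S) = m" using S by auto
    have CS: "dim_col (C * mat_inv ?S) = dim_row B" using B dims by simp
    have "state_space A B C D s $$ (i, j) = D $$ (i, j) + (C * mat_inv ?S * B) $$ (i, j)"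
      unfolding state_space_def using B C D ij by (simp del: index_mult_mat(1))
    also have "(C * mat_inv ?S * B) $$ (i, j) = (\<Sum>l<m. (C * mat_inv ?S) $$ (i, l) * B $$ (l, j))"
      using B C ij CS by (subst mult_mat_sum) auto
    also have "\<dots> = (\<Sum>l<m. (\<Sum>k<m. C $$ (i, k) * mat_inv ?S $$ (k, l)) * B $$ (l, j))"
      using C ij dims by (intro sum.cong refl arg_cong2[where f="(*)"]) (subst mult_mat_sum, auto)
    also have "\<dots> = (\<Sum>l<m. \<Sum>k<m. C $$ (i, k) * B $$ (l, j) * poly (P k l) s / poly (char_poly A) s)"
      by (intro sum.cong refl) (simp add: P(2)[OF _ _ s] sum_distrib_right sum_distrib_left mult_ac)
    also have "\<dots> = poly p s / poly (char_poly A) s"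
      unfolding p_def by (simp add: poly_sum sum_divide_distrib mult.assoc)
    finally show ?thesis .
  qed
  ultimately show ?thesis by blast
qed

lemma hurwitz_char_poly: "A \<in> carrier_mat m m \<Longrightarrow> hurwitz A \<Longrightarrow> Re s \<ge> 0 \<Longrightarrow> poly (char_poly A) s \<noteq> 0"
  using eigenvalue_root_char_poly[of A m s] unfolding hurwitz_def by fastforce

text \<open>The finitely many roots have a rightmost one.\<close>

lemma hurwitz_margin:
  assumes q: "q \<noteq> 0" and stable: "\<And>s. poly q s = 0 \<Longrightarrow> Re s < 0"
  shows "\<exists>\<tau>>0. \<forall>s. Re s > - \<tau> \<longrightarrow> poly q (s::complex) \<noteq> 0"
proof -
  let ?Z = "insert (-1) (Re ` {s. poly q s = 0})"
  have fin: "finite ?Z" using poly_roots_finite[OF q] by simp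
  have neg: "x < 0" if "x \<in> ?Z" for x using that stable by auto
  have M0: "Max ?Z < 0" by (rule neg, rule Max_in[OF fin]) simp
  have root: "poly q s \<noteq> 0" if "Re s > - (- Max ?Z)" for s
  proof
    assume "poly q s = 0"
    then have "Re s \<in> ?Z" by blast
    then have "Re s \<le> Max ?Z" by (rule Max_ge[OF fin])
    then show False using that by linarith
  qed
  show ?thesis
  proof (intro exI conjI allI impI)
    show "0 < - Max ?Z" using M0 by linarith
    show "poly q s \<noteq> 0" if "Re s > - (- Max ?Z)" for s by (rule root[OF that])
  qed
qed

lemma rational_analytic_at:
  assumes eq: "\<And>s. poly q s \<noteq> 0 \<Longrightarrow> f s = poly p s / poly q s" and z: "poly q (z::complex) \<noteq> 0"
  shows "f analytic_on {z}"
proof -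
  have "open {s. poly q s \<noteq> 0}" by (intro open_Collect_neq continuous_intros)
  moreover have "(\<lambda>s. poly p s / poly q s) holomorphic_on {s. poly q s \<noteq> 0}" by (intro holomorphic_intros) auto
  then have "f holomorphic_on {s. poly q s \<noteq> 0}" by (rule holomorphic_transform) (simp add: eq)
  ultimately show ?thesis using z unfolding analytic_at by blast
qed

lemma analytic_not_pole: "f analytic_on {z} \<Longrightarrow> \<not> is_pole f z"
  unfolding analytic_at by (elim exE conjE) (rule not_is_pole_holomorphic)

definition stable_fraction :: "complex poly \<Rightarrow> complex poly \<Rightarrow> (complex \<Rightarrow> complex) \<Rightarrow> bool" where
  "stable_fraction p q f \<longleftrightarrow> degree p \<le> degree q \<and> (\<forall>s. Re s \<ge> 0 \<longrightarrow> poly q s \<noteq> 0) \<and>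
     (\<forall>s. poly q s \<noteq> 0 \<longrightarrow> f s = poly p s / poly q s)"

lemma stable_fractionD:
  assumes "stable_fraction p q f"
  shows "degree p \<le> degree q" "Re s \<ge> 0 \<Longrightarrow> poly q s \<noteq> 0" "poly q s \<noteq> 0 \<Longrightarrow> f s = poly p s / poly q s" "q \<noteq> 0"
  using assms unfolding stable_fraction_def by (auto dest: spec[of _ 0])

definition stable_entries :: "nat \<Rightarrow> nat \<Rightarrow> tfun \<Rightarrow> bool" where
  "stable_entries r c X \<longleftrightarrow> (\<forall>s. X s \<in> carrier_mat r c) \<and>
     (\<forall>i<r. \<forall>j<c. \<exists>p q. stable_fraction p q (\<lambda>s. X s $$ (i, j)))"

lemma stable_entriesE:
  assumes "stable_entries r c X" "i < r" "j < c"
  obtains p q where "stable_fraction p q (\<lambda>s. X s $$ (i, j))"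
  using assms unfolding stable_entries_def by blast

lemma stable_entries_carrier: "stable_entries r c X \<Longrightarrow> X s \<in> carrier_mat r c"
  unfolding stable_entries_def by blast

lemma stable_entries_analytic:
  assumes X: "stable_entries r c X" and z: "Re z \<ge> 0" and ij: "i < r" "j < c"
  shows "(\<lambda>s. X s $$ (i, j)) analytic_on {z}"
proof -
  obtain p q where "stable_fraction p q (\<lambda>s. X s $$ (i, j))" by (rule stable_entriesE[OF X ij])
  note pq = stable_fractionD[OF this]
  show ?thesis by (rule rational_analytic_at[OF pq(3) pq(2)[OF z]])
qed

lemma stable_entries_no_pole:
  assumes X: "stable_entries r c X" and pole: "pole X s"
  shows "Re s < 0"
proof (rule ccontr)
  assume "\<not> Re s < 0"
  then have s: "Re s \<ge> 0" by simp
  obtain i j where "i < r" "j < c" "is_pole (\<lambda>z. X z $$ (i, j)) s"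
    using pole stable_entries_carrier[OF X, of s] unfolding pole_def by auto
  then show False using analytic_not_pole[OF stable_entries_analytic[OF X s]] by simp
qed

lemma stable_entries_proper:
  assumes X: "stable_entries r c X"
  shows "proper_rational_mat r c X"
  unfolding proper_rational_mat_def
proof (intro conjI allI impI)
  show "X s \<in> carrier_mat r c" for s by (rule stable_entries_carrier[OF X])
  fix i j assume ij: "i < r" "j < c"
  obtain p q where "stable_fraction p q (\<lambda>s. X s $$ (i, j))" by (rule stable_entriesE[OF X ij])
  note pq = stable_fractionD[OF this]
  show "\<exists>p q. q \<noteq> 0 \<and> degree p \<le> degree q \<and> (\<forall>s. poly q s \<noteq> 0 \<longrightarrow> X s $$ (i, j) = poly p s / poly q s)"
    by (intro exI[of _ p] exI[of _ q] conjI allI impI pq(1,3,4))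
qed

lemma stable_entries_analytic_mat:
  assumes X: "stable_entries r c X"
  shows "\<exists>\<tau>>0. analytic_mat X {s. Re s > - \<tau>}"
proof -
  define den where "den i j = (SOME q. \<exists>p. stable_fraction p q (\<lambda>s. X s $$ (i, j)))" for i j
  have den: "\<exists>p. stable_fraction p (den i j) (\<lambda>s. X s $$ (i, j))" if ij: "i < r" "j < c" for i j
    unfolding den_def by (rule someI_ex) (metis stable_entriesE[OF X ij])
  define Q where "Q = (\<Prod>i<r. \<Prod>j<c. den i j)"
  have Q0: "poly Q s = 0 \<longleftrightarrow> (\<exists>i<r. \<exists>j<c. poly (den i j) s = 0)" for s
    unfolding Q_def by (auto simp: poly_prod prod_zero_iff)
  have stab: "Re s < 0" if "poly Q s = 0" for s
    using that den stable_fractionD(2) unfolding Q0 by (meson not_le)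
  have "poly Q 0 \<noteq> 0" using stab[of 0] by auto
  then have "Q \<noteq> 0" by auto
  obtain \<tau> where \<tau>: "\<tau> > 0" "\<forall>s. Re s > - \<tau> \<longrightarrow> poly Q s \<noteq> 0"
    using hurwitz_margin[OF \<open>Q \<noteq> 0\<close> stab] by blast
  have "analytic_mat X {s. Re s > - \<tau>}"
    unfolding analytic_mat_def
  proof (intro allI impI)
    fix i j assume "i < dim_row (X 0)" "j < dim_col (X 0)"
    then have ij: "i < r" "j < c" using stable_entries_carrier[OF X, of 0] by auto
    obtain p where "stable_fraction p (den i j) (\<lambda>s. X s $$ (i, j))" using den[OF ij] by blast
    note p = stable_fractionD(3)[OF this]
    have "(\<lambda>s. X s $$ (i, j)) analytic_on {z}" if "Re z > - \<tau>" for z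
    proof (rule rational_analytic_at[OF p])
      show "poly (den i j) z \<noteq> 0" using \<tau>(2)[rule_format, OF that] ij unfolding Q0 by blast
    qed
    then show "(\<lambda>s. X s $$ (i, j)) analytic_on {s. Re s > - \<tau>}"
      unfolding analytic_on_analytic_at[of _ "{s. Re s > - \<tau>}"] by simp
  qed
  then show ?thesis using \<tau>(1) by auto
qed

lemma state_space_stable_entries:
  assumes A: "A \<in> carrier_mat m m" and B: "B \<in> carrier_mat m c" and C: "C \<in> carrier_mat r m"
    and D: "D \<in> carrier_mat r c" and hur: "hurwitz A"
  shows "stable_entries r c (state_space A B C D)"
  unfolding stable_entries_def
proof (intro conjI allI impI)
  fix s show "state_space A B C D s \<in> carrier_mat r c" by (rule state_space_carrier[OF A B C D])
next
  fix i j assume ij: "i < r" "j < c"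
  let ?q = "char_poly A"
  obtain p where p: "p = 0 \<or> degree p < degree ?q"
    "\<And>s. poly ?q s \<noteq> 0 \<Longrightarrow> state_space A B C D s $$ (i, j) = D $$ (i, j) + poly p s / poly ?q s"
    using state_space_entry[OF A B C D ij] by blast
  have "degree (Polynomial.smult (D $$ (i, j)) ?q + p) \<le> degree ?q"
    using p(1) by (intro degree_add_le degree_smult_le) auto
  moreover have "state_space A B C D s $$ (i, j) = poly (Polynomial.smult (D $$ (i, j)) ?q + p) s / poly ?q s"
    if "poly ?q s \<noteq> 0" for s using p(2)[OF that] that by (simp add: add_divide_distrib)
  ultimately have "stable_fraction (Polynomial.smult (D $$ (i, j)) ?q + p) ?q (\<lambda>s. state_space A B C D s $$ (i, j))"
    using hurwitz_char_poly[OF A hur] unfolding stable_fraction_def by blast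
  then show "\<exists>p q. stable_fraction p q (\<lambda>s. state_space A B C D s $$ (i, j))" by blast
qed

section \<open>Entrywise limits\<close>

text \<open>Matrices whose dimensions are terms carry no topology, so limits are taken entry by entry.\<close>

definition mat_tendsto :: "nat \<Rightarrow> nat \<Rightarrow> ('a \<Rightarrow> complex mat) \<Rightarrow> complex mat \<Rightarrow> 'a filter \<Rightarrow> bool" where
  "mat_tendsto r c X L F \<longleftrightarrow> (\<forall>x. X x \<in> carrier_mat r c) \<and> L \<in> carrier_mat r c \<and>
     (\<forall>i<r. \<forall>j<c. ((\<lambda>x. X x $$ (i, j)) \<longlongrightarrow> L $$ (i, j)) F)"

lemma mat_tendsto_carrier: "mat_tendsto r c X L F \<Longrightarrow> X x \<in> carrier_mat r c" "mat_tendsto r c X L F \<Longrightarrow> L \<in> carrier_mat r c"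
  unfolding mat_tendsto_def by auto

lemma mat_tendsto_entry: "mat_tendsto r c X L F \<Longrightarrow> i < r \<Longrightarrow> j < c \<Longrightarrow> ((\<lambda>x. X x $$ (i, j)) \<longlongrightarrow> L $$ (i, j)) F"
  unfolding mat_tendsto_def by auto

lemma mat_tendsto_const: "L \<in> carrier_mat r c \<Longrightarrow> mat_tendsto r c (\<lambda>_. L) L F"
  unfolding mat_tendsto_def by auto

lemma mat_tendsto_dims:
  assumes "mat_tendsto r c X L F"
  shows "dim_row (X x) = r" "dim_col (X x) = c" "dim_row L = r" "dim_col L = c"
  using assms unfolding mat_tendsto_def by (auto simp: carrier_matD)

lemma mat_tendstoI:
  assumes "\<And>x. dim_row (X x) = r" "\<And>x. dim_col (X x) = c" "dim_row L = r" "dim_col L = c"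
    "\<And>i j. i < r \<Longrightarrow> j < c \<Longrightarrow> ((\<lambda>x. X x $$ (i, j)) \<longlongrightarrow> L $$ (i, j)) F"
  shows "mat_tendsto r c X L F"
  unfolding mat_tendsto_def using assms by (auto intro!: carrier_matI)

lemma mat_tendsto_add:
  assumes "mat_tendsto r c X L F" "mat_tendsto r c Y M F"
  shows "mat_tendsto r c (\<lambda>x. X x + Y x) (L + M) F"
  by (intro mat_tendstoI)
     (simp_all add: mat_tendsto_dims[OF assms(1)] mat_tendsto_dims[OF assms(2)]
        tendsto_add mat_tendsto_entry[OF assms(1)] mat_tendsto_entry[OF assms(2)])

lemma mat_tendsto_minus:
  assumes "mat_tendsto r c X L F" "mat_tendsto r c Y M F"
  shows "mat_tendsto r c (\<lambda>x. X x - Y x) (L - M) F"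
  by (intro mat_tendstoI)
     (simp_all add: mat_tendsto_dims[OF assms(1)] mat_tendsto_dims[OF assms(2)]
        tendsto_diff mat_tendsto_entry[OF assms(1)] mat_tendsto_entry[OF assms(2)])

lemma mat_tendsto_uminus:
  assumes "mat_tendsto r c X L F"
  shows "mat_tendsto r c (\<lambda>x. - X x) (- L) F"
  by (intro mat_tendstoI)
     (simp_all add: mat_tendsto_dims[OF assms] tendsto_minus mat_tendsto_entry[OF assms])

lemma mat_tendsto_smult:
  assumes "mat_tendsto r c X L F"
  shows "mat_tendsto r c (\<lambda>x. a \<cdot>\<^sub>m X x) (a \<cdot>\<^sub>m L) F"
  by (intro mat_tendstoI)
     (simp_all add: mat_tendsto_dims[OF assms] tendsto_mult mat_tendsto_entry[OF assms])

lemma mat_tendsto_adjoint: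
  assumes "mat_tendsto r c X L F"
  shows "mat_tendsto c r (\<lambda>x. (X x)\<^sup>\<dagger>) L\<^sup>\<dagger> F"
  by (intro mat_tendstoI)
     (simp_all add: mat_tendsto_dims[OF assms] tendsto_cnj mat_tendsto_entry[OF assms])

lemma mat_tendsto_mult:
  assumes X: "mat_tendsto r k X L F" and Y: "mat_tendsto k c Y M F"
  shows "mat_tendsto r c (\<lambda>x. X x * Y x) (L * M) F"
  unfolding mat_tendsto_def
proof (intro conjI allI impI)
  fix i j assume ij: "i < r" "j < c"
  have d: "dim_row (X x) = r" "dim_col (X x) = k" "dim_row (Y x) = k" "dim_col (Y x) = c"
    "dim_row L = r" "dim_col L = k" "dim_row M = k" "dim_col M = c" for x
    using X Y by (auto simp: mat_tendsto_def carrier_matD)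
  have "((\<lambda>x. \<Sum>l<k. X x $$ (i, l) * Y x $$ (l, j)) \<longlongrightarrow> (\<Sum>l<k. L $$ (i, l) * M $$ (l, j))) F"
    using X Y ij by (intro tendsto_sum tendsto_mult) (auto simp: mat_tendsto_def)
  then show "((\<lambda>x. (X x * Y x) $$ (i, j)) \<longlongrightarrow> (L * M) $$ (i, j)) F"
    using ij by (simp add: mult_mat_sum d del: index_mult_mat(1))
next
  show "X x * Y x \<in> carrier_mat r c" for x
    by (rule mult_carrier_mat[OF mat_tendsto_carrier(1)[OF X] mat_tendsto_carrier(1)[OF Y]])
  show "L * M \<in> carrier_mat r c"
    by (rule mult_carrier_mat[OF mat_tendsto_carrier(2)[OF X] mat_tendsto_carrier(2)[OF Y]])
qed

lemma mat_tendsto_four_block: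
  assumes "mat_tendsto r1 c1 A A' F" "mat_tendsto r1 c2 B B' F" "mat_tendsto r2 c1 C C' F" "mat_tendsto r2 c2 D D' F"
  shows "mat_tendsto (r1 + r2) (c1 + c2) (\<lambda>x. four_block_mat (A x) (B x) (C x) (D x)) (four_block_mat A' B' C' D') F"
  unfolding mat_tendsto_def
proof (intro conjI allI impI)
  fix i j assume ij: "i < r1 + r2" "j < c1 + c2"
  have d: "dim_row (A x) = r1" "dim_col (A x) = c1" "dim_row (D x) = r2" "dim_col (D x) = c2"
    "dim_row A' = r1" "dim_col A' = c1" "dim_row D' = r2" "dim_col D' = c2" for x
    using assms by (auto simp: mat_tendsto_def carrier_matD)
  show "((\<lambda>x. four_block_mat (A x) (B x) (C x) (D x) $$ (i, j)) \<longlongrightarrow> four_block_mat A' B' C' D' $$ (i, j)) F"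
    using assms ij unfolding mat_tendsto_def by (simp add: d)
qed (use assms in \<open>auto simp: mat_tendsto_def\<close>)

lemma mat_tendsto_sub:
  assumes "mat_tendsto r c X L F" "r' \<le> r" "c0 + c' \<le> c"
  shows "mat_tendsto r' c' (\<lambda>x. mat r' c' (\<lambda>(i, j). X x $$ (i, c0 + j))) (mat r' c' (\<lambda>(i, j). L $$ (i, c0 + j))) F"
  using assms unfolding mat_tendsto_def by auto

lemma mat_tendsto_unique:
  assumes "mat_tendsto r c X L F" "mat_tendsto r c Y M F" "eventually (\<lambda>x. X x = Y x) F" "F \<noteq> bot"
  shows "L = M"
proof (rule eq_matI)
  fix i j assume "i < dim_row M" "j < dim_col M"
  then have ij: "i < r" "j < c" using mat_tendsto_carrier(2)[OF assms(2)] by auto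
  have "((\<lambda>x. Y x $$ (i, j)) \<longlongrightarrow> L $$ (i, j)) F"
    by (rule Lim_transform_eventually[OF mat_tendsto_entry[OF assms(1) ij]])
       (use assms(3) in \<open>auto elim!: eventually_mono\<close>)
  then show "L $$ (i, j) = M $$ (i, j)"
    using tendsto_unique[OF assms(4)] mat_tendsto_entry[OF assms(2) ij] by blast
qed (use assms in \<open>auto simp: mat_tendsto_def carrier_matD\<close>)

lemma mat_tendsto_qform:
  assumes "mat_tendsto n n X L F" "v \<in> carrier_vec n"
  shows "((\<lambda>x. qform (X x) v) \<longlongrightarrow> qform L v) F"
proof -
  obtain x where v: "v = vec n x" using assms(2) by (metis carrier_vecD eq_vecI index_vec dim_vec)
  show ?thesis
    unfolding v qform_sum[OF mat_tendsto_carrier(1)[OF assms(1)]] qform_sum[OF mat_tendsto_carrier(2)[OF assms(1)]]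
    using assms(1) by (intro tendsto_intros) (auto simp: mat_tendsto_def)
qed

lemma mat_tendsto_mult_vec:
  assumes "mat_tendsto r n X L F" "v \<in> carrier_vec n"
  shows "((\<lambda>x. sqnorm (X x *\<^sub>v v)) \<longlongrightarrow> sqnorm (L *\<^sub>v v)) F"
proof -
  have "((\<lambda>x. qform ((X x)\<^sup>\<dagger> * X x) v) \<longlongrightarrow> qform (L\<^sup>\<dagger> * L) v) F"
    by (rule mat_tendsto_qform[OF mat_tendsto_mult[OF mat_tendsto_adjoint[OF assms(1)] assms(1)] assms(2)])
  then show ?thesis
    by (simp only: qform_gram[OF mat_tendsto_carrier(1)[OF assms(1)] assms(2)]
        qform_gram[OF mat_tendsto_carrier(2)[OF assms(1)] assms(2)])
qed

section \<open>The imaginary axis\<close>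

lemma para_conj_axis: "X\<^sup>H (im_axis r) = (X (im_axis r))\<^sup>\<dagger>"
  unfolding para_conj_def by simp

text \<open>The filter along which \<open>freq_value\<close> is a limit. At a finite frequency it is principal, so that the
  limit is the value and one argument covers finite and infinite frequencies.\<close>

definition axis_filter :: "ereal \<Rightarrow> real filter" where
  "axis_filter \<omega> = (case \<omega> of ereal r \<Rightarrow> principal {r} | PInfty \<Rightarrow> at_top | MInfty \<Rightarrow> at_bot)"

lemma axis_filter_simps:
  "axis_filter (ereal r) = principal {r}" "axis_filter \<infinity> = at_top" "axis_filter (- \<infinity>) = at_bot"
  unfolding axis_filter_def PInfty_eq_infinity[symmetric] MInfty_eq_minfinity[symmetric]
  by (simp_all only: ereal.case uminus_ereal.simps)

lemma freq_value_simps: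
  "freq_value X (ereal r) = X (im_axis r)"
  "freq_value X \<infinity> = mat (dim_row (X 0)) (dim_col (X 0)) (\<lambda>(i, j). Lim at_top (\<lambda>r. X (im_axis r) $$ (i, j)))"
  "freq_value X (- \<infinity>) = mat (dim_row (X 0)) (dim_col (X 0)) (\<lambda>(i, j). Lim at_bot (\<lambda>r. X (im_axis r) $$ (i, j)))"
  unfolding freq_value_def PInfty_eq_infinity[symmetric] MInfty_eq_minfinity[symmetric]
  by (simp_all only: ereal.case uminus_ereal.simps)

lemma axis_filter_not_bot: "axis_filter \<omega> \<noteq> bot"
  by (cases \<omega>) (simp_all add: axis_filter_simps principal_eq_bot_iff)

lemma freq_value_eq:
  assumes "mat_tendsto r c (\<lambda>x. X (im_axis x)) L (axis_filter \<omega>)"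
  shows "freq_value X \<omega> = L"
proof (cases \<omega>)
  case (real x)
  let ?Y = "\<lambda>x. X (im_axis x)"
  have "mat_tendsto r c ?Y (?Y x) (principal {x})"
    using mat_tendsto_dims[OF assms] by (intro mat_tendstoI tendsto_principal_singleton)
  moreover have "mat_tendsto r c ?Y L (principal {x})"
    using assms unfolding real axis_filter_simps .
  ultimately have "?Y x = L"
    by (rule mat_tendsto_unique) (simp_all add: principal_eq_bot_iff)
  then show ?thesis unfolding real freq_value_simps .
next
  case PInf
  have 0: "X 0 \<in> carrier_mat r c" using mat_tendsto_carrier(1)[OF assms, of 0] by simp
  have "Lim at_top (\<lambda>x. X (im_axis x) $$ (i, j)) = L $$ (i, j)" if "i < r" "j < c" for i j
    using mat_tendsto_entry[OF assms that] unfolding PInf axis_filter_simps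
    by (intro tendsto_Lim) auto
  then show ?thesis unfolding PInf freq_value_simps
    using 0 mat_tendsto_carrier(2)[OF assms] by (intro eq_matI) auto
next
  case MInf
  have 0: "X 0 \<in> carrier_mat r c" using mat_tendsto_carrier(1)[OF assms, of 0] by simp
  have "Lim at_bot (\<lambda>x. X (im_axis x) $$ (i, j)) = L $$ (i, j)" if "i < r" "j < c" for i j
    using mat_tendsto_entry[OF assms that] unfolding MInf axis_filter_simps
    by (intro tendsto_Lim) auto
  then show ?thesis unfolding MInf freq_value_simps
    using 0 mat_tendsto_carrier(2)[OF assms] by (intro eq_matI) auto
qed

lemma filterlim_axis_at_infinity:
  "filterlim (\<lambda>x. im_axis x) at_infinity at_top"
  "filterlim (\<lambda>x. im_axis x) at_infinity at_bot"
proof -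
  have "filterlim (\<lambda>x::real. norm x) at_top at_bot"
    by (rule filterlim_at_infinity_imp_norm_at_top[OF filterlim_at_bot_imp_at_infinity[OF filterlim_ident]])
  then show "filterlim (\<lambda>x. im_axis x) at_infinity at_bot"
    by (simp add: filterlim_at_infinity_conv_norm_at_top norm_mult)
  show "filterlim (\<lambda>x. im_axis x) at_infinity at_top"
    using filterlim_abs_real by (simp add: filterlim_at_infinity_conv_norm_at_top norm_mult)
qed

lemma poly_ratio_limit:
  fixes p q :: "complex poly"
  assumes "degree p \<le> degree q" "q \<noteq> 0"
  shows "\<exists>l. ((\<lambda>x. poly p x / poly q x) \<longlongrightarrow> l) at_infinity"
proof -
  define c where "c = coeff p (degree q) / lead_coeff q"
  define r where "r = p - Polynomial.smult c q"
  have c0: "coeff r (degree q) = 0" using assms by (simp add: r_def c_def)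
  have deg: "degree r \<le> degree q" using assms by (auto simp: r_def intro!: degree_diff_le order_trans[OF degree_smult_le])
  have "((\<lambda>x. poly r x / poly q x) \<longlongrightarrow> 0) at_infinity"
  proof (cases "r = 0")
    case False
    then have "degree r < degree q" using degree_less_if_less_eqI[OF deg c0] by simp
    then show ?thesis by (rule poly_divide_tendsto_0_at_infinity)
  qed simp
  then have "((\<lambda>x. c + poly r x / poly q x) \<longlongrightarrow> c + 0) at_infinity" by (intro tendsto_intros)
  moreover have "eventually (\<lambda>x. c + poly r x / poly q x = poly p x / poly q x) at_infinity"
  proof -
    have fin: "finite {x. poly q x = 0}" by (rule poly_roots_finite[OF assms(2)])
    obtain b where b: "\<forall>x\<in>{x. poly q x = 0}. norm x \<le> b"
      using finite_imp_bounded[OF fin] unfolding bounded_iff ..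
    have "eventually (\<lambda>x. poly q x \<noteq> 0) at_infinity"
      unfolding eventually_at_infinity
    proof (intro exI allI impI notI)
      fix x :: complex assume "b + 1 \<le> norm x" "poly q x = 0"
      moreover from this b have "norm x \<le> b" by blast
      ultimately show False by linarith
    qed
    then show ?thesis by eventually_elim (simp add: r_def field_simps)
  qed
  ultimately have "((\<lambda>x. poly p x / poly q x) \<longlongrightarrow> c + 0) at_infinity" by (rule Lim_transform_eventually)
  then show ?thesis by blast
qed

lemma stable_entries_axis_continuous:
  assumes X: "stable_entries r c X"
  shows "mat_tendsto r c (\<lambda>x. X (im_axis x)) (X (im_axis w)) (at w)"
proof (rule mat_tendstoI)
  fix i j assume ij: "i < r" "j < c"
  have "Re (im_axis w) \<ge> 0" by simp
  from analytic_at_imp_isCont[OF stable_entries_analytic[OF X this ij]]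
  show "((\<lambda>x. X (im_axis x) $$ (i, j)) \<longlongrightarrow> X (im_axis w) $$ (i, j)) (at w)"
    by (rule isCont_tendsto_compose) (intro tendsto_intros)
qed (simp_all add: carrier_matD[OF stable_entries_carrier[OF X]])

lemma stable_entries_axis_limit:
  assumes X: "stable_entries r c X"
  obtains L where "mat_tendsto r c (\<lambda>x. X (im_axis x)) L (axis_filter w)"
proof -
  have car: "X s \<in> carrier_mat r c" for s using X unfolding stable_entries_def by blast
  have at_inf: "\<exists>L. mat_tendsto r c (\<lambda>x. X (im_axis x)) L F"
    if F: "filterlim (\<lambda>x. im_axis x) at_infinity F" for F
  proof -
    have lim: "\<exists>l. ((\<lambda>x. X (im_axis x) $$ (i, j)) \<longlongrightarrow> l) F" if ij: "i < r" "j < c" for i j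
    proof -
      obtain p q where "stable_fraction p q (\<lambda>s. X s $$ (i, j))" by (rule stable_entriesE[OF X ij])
      note pq = stable_fractionD[OF this]
      obtain l where l: "((\<lambda>x. poly p x / poly q x) \<longlongrightarrow> l) at_infinity"
        using poly_ratio_limit[OF pq(1,4)] by (elim exE)
      have eq: "(\<lambda>x. X (im_axis x) $$ (i, j)) =
          (\<lambda>x. poly p (im_axis x) / poly q (im_axis x))"
        by (intro ext pq(3) pq(2)) simp
      show ?thesis unfolding eq by (rule exI, rule filterlim_compose[OF l F])
    qed
    define l where "l i j = (SOME l. ((\<lambda>x. X (im_axis x) $$ (i, j)) \<longlongrightarrow> l) F)" for i j
    have "((\<lambda>x. X (im_axis x) $$ (i, j)) \<longlongrightarrow> l i j) F" if "i < r" "j < c" for i j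
      unfolding l_def by (rule someI_ex[OF lim[OF that]])
    then have "mat_tendsto r c (\<lambda>x. X (im_axis x)) (mat r c (\<lambda>(i, j). l i j)) F"
      unfolding mat_tendsto_def using car by auto
    then show ?thesis by blast
  qed
  show ?thesis
  proof (cases w)
    case (real x)
    have "mat_tendsto r c (\<lambda>x. X (im_axis x)) (X (im_axis x)) (axis_filter w)"
      unfolding real axis_filter_simps mat_tendsto_def using car
      by (auto intro!: tendsto_principal_singleton)
    then show ?thesis by (rule that)
  next
    case PInf
    then show ?thesis using at_inf[OF filterlim_axis_at_infinity(1)] that
      by (auto simp: axis_filter_simps)
  next
    case MInf
    then show ?thesis using at_inf[OF filterlim_axis_at_infinity(2)] that
      by (auto simp: axis_filter_simps)
  qed
qed

section \<open>The power spectrum on the imaginary axis\<close>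

text \<open>When \<open>\<Phi>\<close> is \<open>Phi\<close> and \<open>K\<close> is \<open>H11\<close>, both taken at a point of the imaginary axis, this is
  the quadratic form of the error spectrum \<open>P_e\<close> there.\<close>

abbreviation (input) error_form :: "complex mat \<Rightarrow> complex mat \<Rightarrow> complex vec \<Rightarrow> real" where
  "error_form \<Phi> K u \<equiv> qform \<Phi> ((K\<^sup>\<dagger> *\<^sub>v u) @\<^sub>v u)"

lemma finite_eventually_at: "finite (S::real set) \<Longrightarrow> eventually (\<lambda>x. x \<notin> S) (at w)"
proof (induction S rule: finite_induct)
  case (insert y S)
  have "eventually (\<lambda>x. x \<noteq> y) (at w)" by (rule eventually_neq_at_within)
  then show ?case using insert.IH by eventually_elim simp
qed simp

lemma tf_eq_axis:
  assumes "X \<doteq> Y"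
  shows "finite {x. X (im_axis x) \<noteq> Y (im_axis x)}"
proof -
  have "finite {s. X s \<noteq> Y s}" using assms unfolding tf_eq_def eventually_cofinite .
  then have "finite ((\<lambda>x. im_axis x) -` {s. X s \<noteq> Y s})"
    by (rule finite_vimageI) (auto simp: inj_on_def)
  then show ?thesis by (simp add: vimage_def)
qed

lemma G11_axis:
  "G11 n ny G s = mat ny n (\<lambda>(i, j). G s $$ (i, 0 + j))" "G12 n nw ny G s = mat ny nw (\<lambda>(i, j). G s $$ (i, n + j))"
  unfolding G11_def G12_def by simp_all

lemma Phi_carrier:
  assumes "Su \<in> carrier_mat n n" "Sw \<in> carrier_mat nw nw"
  shows "Phi n nw ny G Su Sw s \<in> carrier_mat (ny + n) (ny + n)"
    "Psi n nw ny G Su Sw s \<in> carrier_mat ny ny"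
  unfolding Phi_def Psi_def G11_def G12_def para_conj_def using assms by (auto intro!: carrier_matI)

text \<open>Formulated for an arbitrary filter, this yields continuity of \<open>Phi\<close> along the axis as well as its
  limits at infinite frequency.\<close>

lemma mat_tendsto_Phi:
  assumes G: "mat_tendsto r c (\<lambda>x. G (im_axis x)) L F" and r: "ny \<le> r" "n + nw \<le> c"
    and Su: "Su \<in> carrier_mat n n" and Sw: "Sw \<in> carrier_mat nw nw"
  defines "g1 \<equiv> mat ny n (\<lambda>(i, j). L $$ (i, 0 + j))" and "g2 \<equiv> mat ny nw (\<lambda>(i, j). L $$ (i, n + j))"
  shows "mat_tendsto (ny + n) (ny + n) (\<lambda>x. Phi n nw ny G Su Sw (im_axis x))
    (four_block_mat (g1 * transpose_mat Su * g1\<^sup>\<dagger> + g2 * transpose_mat Sw * g2\<^sup>\<dagger>)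
      (- (g1 * (1\<^sub>m n + transpose_mat Su))) (- ((1\<^sub>m n + transpose_mat Su) * g1\<^sup>\<dagger>))
      (transpose_mat Su + 2 \<cdot>\<^sub>m 1\<^sub>m n)) F"
proof -
  have g1: "mat_tendsto ny n (\<lambda>x. G11 n ny G (im_axis x)) g1 F"
    unfolding g1_def G11_axis by (rule mat_tendsto_sub[OF G]) (use r in auto)
  have g2: "mat_tendsto ny nw (\<lambda>x. G12 n nw ny G (im_axis x)) g2 F"
    unfolding g2_def G11_axis by (rule mat_tendsto_sub[OF G]) (use r in auto)
  show ?thesis
    unfolding Phi_def Psi_def para_conj_axis
    using Su Sw
    by (intro mat_tendsto_four_block mat_tendsto_add mat_tendsto_mult mat_tendsto_uminus mat_tendsto_adjoint
        mat_tendsto_const) (use g1 g2 in auto)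
qed

lemma transpose_hermitian:
  assumes "hermitian S" shows "hermitian (transpose_mat S)"
proof -
  have "(transpose_mat S)\<^sup>\<dagger> = transpose_mat (S\<^sup>\<dagger>)" by (rule eq_matI) auto
  then show ?thesis using assms unfolding hermitian_def by simp
qed

lemma qform_transpose:
  assumes "S \<in> carrier_mat n n" "v \<in> carrier_vec n"
  shows "qform (transpose_mat S) v = qform S (conjugate v)"
proof -
  obtain x where v: "v = vec n x" using assms(2) by (metis carrier_vecD eq_vecI index_vec dim_vec)
  have c: "conjugate v = vec n (\<lambda>i. cnj (x i))" unfolding v by (rule eq_vecI) auto
  have T: "transpose_mat S \<in> carrier_mat n n" using assms by simp
  have "(\<Sum>i<n. (\<Sum>j<n. transpose_mat S $$ (i,j) * x j) * cnj (x i)) = (\<Sum>i<n. \<Sum>j<n. S $$ (j,i) * x j * cnj (x i))"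
    using assms(1) by (intro sum.cong refl) (auto simp: sum_distrib_right)
  also have "\<dots> = (\<Sum>j<n. \<Sum>i<n. S $$ (j,i) * x j * cnj (x i))" by (rule sum.swap)
  also have "\<dots> = (\<Sum>i<n. (\<Sum>j<n. S $$ (i,j) * cnj (x j)) * cnj (cnj (x i)))"
    by (intro sum.cong refl) (simp add: sum_distrib_left sum_distrib_right mult_ac)
  finally show ?thesis
    unfolding c unfolding v qform_sum[OF T] qform_sum[OF assms(1)] by (simp only:)
qed

lemma Psi_axis_nonneg:
  assumes Su: "Su \<in> carrier_mat n n" "pos_def Su" and Sw: "Sw \<in> carrier_mat nw nw" "pos_def Sw"
    and y: "y \<in> carrier_vec ny"
  shows "qform (Psi n nw ny G Su Sw (im_axis x)) y \<ge> 0"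
proof -
  have nonneg: "qform (X * transpose_mat S * X\<^sup>\<dagger>) y \<ge> 0"
    if X: "X \<in> carrier_mat ny k" and S: "S \<in> carrier_mat k k" "pos_def S" for X S k
  proof -
    have T: "transpose_mat S \<in> carrier_mat k k" using S by simp
    have w: "conjugate (X\<^sup>\<dagger> *\<^sub>v y) \<in> carrier_vec k" using X by (auto intro!: carrier_vecI)
    have "qform (X * transpose_mat S * X\<^sup>\<dagger>) y = qform (transpose_mat S) (X\<^sup>\<dagger> *\<^sub>v y)"
      using qform_congruence[OF T adjoint_carrier[OF X] y] by simp
    also have "\<dots> = qform S (conjugate (X\<^sup>\<dagger> *\<^sub>v y))"
      by (rule qform_transpose[OF S(1)]) (use X in simp)
    also have "\<dots> \<ge> 0"
    proof (cases "conjugate (X\<^sup>\<dagger> *\<^sub>v y) = 0\<^sub>v k")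
      case True
      then show ?thesis using S by (simp add: qform_def)
    next
      case False
      then show ?thesis using S w pos_def_iff[OF S(1)] by (simp add: less_imp_le)
    qed
    finally show ?thesis .
  qed
  have g: "G11 n ny G s \<in> carrier_mat ny n" "G12 n nw ny G s \<in> carrier_mat ny nw" for s
    unfolding G11_def G12_def by auto
  show ?thesis
    unfolding Psi_def para_conj_axis
    using nonneg[OF g(1) Su] nonneg[OF g(2) Sw] g Su(1) Sw(1) y
    by (subst qform_add_mat[of _ ny]) (auto intro!: carrier_matI simp: carrier_matD[OF g(1)] carrier_matD[OF g(2)])
qed

lemma Phi_axis_hermitian:
  assumes Su: "Su \<in> carrier_mat n n" "hermitian Su" and Sw: "Sw \<in> carrier_mat nw nw" "hermitian Sw"
  shows "hermitian (Phi n nw ny G Su Sw (im_axis x))"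
proof -
  let ?s = "im_axis x"
  have g: "dim_row (G11 n ny G ?s) = ny" "dim_col (G11 n ny G ?s) = n"
    "dim_row (G12 n nw ny G ?s) = ny" "dim_col (G12 n nw ny G ?s) = nw"
    unfolding G11_def G12_def by auto
  note d = g carrier_matD[OF Su(1)] carrier_matD[OF Sw(1)]
  have h: "(transpose_mat Su)\<^sup>\<dagger> = transpose_mat Su" "(transpose_mat Sw)\<^sup>\<dagger> = transpose_mat Sw"
    using transpose_hermitian Su(2) Sw(2) by (auto simp: hermitian_def)
  have sq: "(X * S * X\<^sup>\<dagger>)\<^sup>\<dagger> = X * S * X\<^sup>\<dagger>" if "S\<^sup>\<dagger> = S" "dim_col X = dim_row S" "dim_row S = dim_col S" for X S :: "complex mat"
  proof -
    have "(X * S * X\<^sup>\<dagger>)\<^sup>\<dagger> = X * (S * X\<^sup>\<dagger>)" using that by (simp add: adjoint_mult)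
    also have "\<dots> = X * S * X\<^sup>\<dagger>"
      by (rule assoc_mult_mat[symmetric, of X "dim_row X" "dim_col S" S "dim_col S" "X\<^sup>\<dagger>" "dim_row X"])
         (use that in \<open>auto intro!: carrier_matI\<close>)
    finally show ?thesis .
  qed
  have P: "(Psi n nw ny G Su Sw ?s)\<^sup>\<dagger> = Psi n nw ny G Su Sw ?s"
    unfolding Psi_def para_conj_axis by (subst adjoint_add) (auto simp: d h sq)
  have S1: "(1\<^sub>m n + transpose_mat Su)\<^sup>\<dagger> = 1\<^sub>m n + transpose_mat Su"
    by (subst adjoint_add) (auto simp: d h)
  have S2: "(transpose_mat Su + 2 \<cdot>\<^sub>m 1\<^sub>m n)\<^sup>\<dagger> = transpose_mat Su + 2 \<cdot>\<^sub>m 1\<^sub>m n"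
    by (subst adjoint_add) (auto simp: d h adjoint_smult)
  have O: "(- (G11 n ny G ?s * (1\<^sub>m n + transpose_mat Su)))\<^sup>\<dagger> = - ((1\<^sub>m n + transpose_mat Su) * (G11 n ny G ?s)\<^sup>\<dagger>)"
    by (simp add: adjoint_uminus adjoint_mult d S1)
  have O': "(- ((1\<^sub>m n + transpose_mat Su) * (G11 n ny G ?s)\<^sup>\<dagger>))\<^sup>\<dagger> = - (G11 n ny G ?s * (1\<^sub>m n + transpose_mat Su))"
    by (simp add: adjoint_uminus adjoint_mult d S1)
  have Pc: "Psi n nw ny G Su Sw ?s \<in> carrier_mat ny ny" using Phi_carrier(2)[OF Su(1) Sw(1)] .
  show ?thesis
    unfolding hermitian_def Phi_def para_conj_axis
    by (subst adjoint_four_block[OF Pc, where ?r2.0 = n and ?c2.0 = n])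
       (auto simp: d P O O' S2 intro!: carrier_matI)
qed

lemma P_e_axis:
  assumes H: "H (im_axis x) \<in> carrier_mat n ny"
    and Su: "Su \<in> carrier_mat n n" "hermitian Su" and Sw: "Sw \<in> carrier_mat nw nw" "hermitian Sw"
  defines "s \<equiv> im_axis x"
  shows "P_e n nw ny G Su Sw H s \<in> carrier_mat n n" "hermitian (P_e n nw ny G Su Sw H s)"
    "u \<in> carrier_vec n \<Longrightarrow> qform (P_e n nw ny G Su Sw H s) u = qform (Phi n nw ny G Su Sw s) (((H s)\<^sup>\<dagger> *\<^sub>v u) @\<^sub>v u)"
proof -
  let ?T = "(H s)\<^sup>\<dagger> @\<^sub>r 1\<^sub>m n"
  note Hs = H[folded s_def]
  have T: "?T \<in> carrier_mat (ny + n) n" using Hs by (intro carrier_matI) auto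
  have Td: "?T\<^sup>\<dagger> = H s @\<^sub>c 1\<^sub>m n"
    unfolding append_rows_def append_cols_def using Hs
    by (subst adjoint_four_block[where ?r1.0 = ny and ?r2.0 = n and ?c1.0 = n and ?c2.0 = 0]) auto
  note P = Phi_carrier(1)[OF Su(1) Sw(1)]
  have e: "P_e n nw ny G Su Sw H s = ?T\<^sup>\<dagger> * Phi n nw ny G Su Sw s * ?T"
    unfolding P_e_def Td unfolding s_def para_conj_axis ..
  note d = carrier_matD[OF T] carrier_matD[OF P]
  show "P_e n nw ny G Su Sw H s \<in> carrier_mat n n"
    unfolding e by (intro carrier_matI) (simp_all add: carrier_matD[OF Hs])
  have "(?T\<^sup>\<dagger> * Phi n nw ny G Su Sw s * ?T)\<^sup>\<dagger> = ?T\<^sup>\<dagger> * ((Phi n nw ny G Su Sw s)\<^sup>\<dagger> * ?T)"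
    by (simp add: adjoint_mult carrier_matD[OF Hs] carrier_matD[OF P])
  also have "(Phi n nw ny G Su Sw s)\<^sup>\<dagger> = Phi n nw ny G Su Sw s"
    using Phi_axis_hermitian[OF Su Sw] unfolding hermitian_def s_def .
  also have "?T\<^sup>\<dagger> * (Phi n nw ny G Su Sw s * ?T) = ?T\<^sup>\<dagger> * Phi n nw ny G Su Sw s * ?T"
    by (rule assoc_mult_mat[symmetric, OF adjoint_carrier[OF T] P T])
  finally show "hermitian (P_e n nw ny G Su Sw H s)" unfolding hermitian_def e .
  assume u: "u \<in> carrier_vec n"
  show "qform (P_e n nw ny G Su Sw H s) u = qform (Phi n nw ny G Su Sw s) (((H s)\<^sup>\<dagger> *\<^sub>v u) @\<^sub>v u)"
    unfolding e qform_congruence[OF P T u] using u Hs by (subst append_rows_mult_vec) auto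
qed

lemma mat_less_scalar_iff:
  assumes P: "P \<in> carrier_mat n n" "hermitian P"
  shows "P \<prec> complex_of_real c \<cdot>\<^sub>m 1\<^sub>m n \<longleftrightarrow>
    (\<forall>u \<in> carrier_vec n. u \<noteq> 0\<^sub>v n \<longrightarrow> qform P u < c * sqnorm u)"
proof -
  have C: "complex_of_real c \<cdot>\<^sub>m 1\<^sub>m n - P \<in> carrier_mat n n" using P by auto
  have "hermitian (complex_of_real c \<cdot>\<^sub>m 1\<^sub>m n - P)"
    using P scalar_hermitian(1)[of c n] unfolding hermitian_def by (subst adjoint_minus) auto
  then show ?thesis
    unfolding mat_less_def pos_def_iff[OF C]
    using P by (simp add: qform_minus_mat[of _ n] qform_smult_mat[of _ n] qform_one)
qed

lemma contraction_iff:
  assumes H: "H \<in> carrier_mat n ny"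
  shows "H * H\<^sup>\<dagger> \<prec> 1\<^sub>m n \<longleftrightarrow>
    (\<forall>u \<in> carrier_vec n. u \<noteq> 0\<^sub>v n \<longrightarrow> sqnorm (H\<^sup>\<dagger> *\<^sub>v u) < sqnorm u)"
proof -
  have c: "H * H\<^sup>\<dagger> \<in> carrier_mat n n" using H by auto
  have h: "hermitian (H * H\<^sup>\<dagger>)" using H by (auto simp: hermitian_def adjoint_mult)
  have one: "complex_of_real 1 \<cdot>\<^sub>m 1\<^sub>m n = (1\<^sub>m n :: complex mat)" by (rule eq_matI) auto
  have "qform (H * H\<^sup>\<dagger>) u = sqnorm (H\<^sup>\<dagger> *\<^sub>v u)" if "u \<in> carrier_vec n" for u
    using qform_gram[OF adjoint_carrier[OF H] that] by simp
  then show ?thesis using mat_less_scalar_iff[OF c h, of 1] unfolding one by simp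
qed

lemma four_block_qform_scale:
  assumes P: "P \<in> carrier_mat ny ny" and B: "B \<in> carrier_mat ny n" and C: "C \<in> carrier_mat n ny"
    and D: "D \<in> carrier_mat n n" and y: "y \<in> carrier_vec ny" and u: "u \<in> carrier_vec n"
  shows "qform (four_block_mat P B C D) ((complex_of_real t \<cdot>\<^sub>v y) @\<^sub>v u) =
    t\<^sup>2 * qform P y + t * (Re ((B *\<^sub>v u) \<bullet>c y) + Re ((C *\<^sub>v y) \<bullet>c u)) + qform D u"
proof -
  note d = carrier_matD[OF P] carrier_matD[OF B] carrier_matD[OF C] carrier_matD[OF D] carrier_vecD[OF y] carrier_vecD[OF u]
  have "four_block_mat P B C D *\<^sub>v ((complex_of_real t \<cdot>\<^sub>v y) @\<^sub>v u) =
      (complex_of_real t \<cdot>\<^sub>v (P *\<^sub>v y) + B *\<^sub>v u) @\<^sub>v (complex_of_real t \<cdot>\<^sub>v (C *\<^sub>v y) + D *\<^sub>v u)"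
    by (subst four_block_mult_vec) (simp_all add: d mult_vec_smult)
  then show ?thesis
    unfolding qform_def
    by (simp add: cscalar_append cscalar_add_left cscalar_smult_left cscalar_smult_right d power2_eq_square distrib_left)
qed

text \<open>As a function of \<open>y\<close> the form is convex, its quadratic part \<open>Psi\<close> being nonnegative. The right-hand
  side interpolates between the values at \<open>y\<close> and at \<open>0\<close>.\<close>

lemma Phi_form_scale:
  fixes x t :: real
  assumes Su: "Su \<in> carrier_mat n n" "hermitian Su" "pos_def Su" and Sw: "Sw \<in> carrier_mat nw nw" "hermitian Sw" "pos_def Sw"
    and y: "y \<in> carrier_vec ny" and u: "u \<in> carrier_vec n" and t: "0 \<le> t" "t \<le> 1"
  defines "s \<equiv> im_axis x"
  shows "qform (Phi n nw ny G Su Sw s) ((complex_of_real t \<cdot>\<^sub>v y) @\<^sub>v u) \<le>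
    t * qform (Phi n nw ny G Su Sw s) (y @\<^sub>v u) + (1 - t) * qform (transpose_mat Su + 2 \<cdot>\<^sub>m 1\<^sub>m n) u"
proof -
  let ?P = "Psi n nw ny G Su Sw s" and ?B = "- (G11 n ny G s * (1\<^sub>m n + transpose_mat Su))"
    and ?C = "- ((1\<^sub>m n + transpose_mat Su) * (G11 n ny G)\<^sup>H s)" and ?D = "transpose_mat Su + 2 \<cdot>\<^sub>m 1\<^sub>m n"
  have P: "?P \<in> carrier_mat ny ny" by (rule Phi_carrier(2)[OF Su(1) Sw(1)])
  have B: "?B \<in> carrier_mat ny n" and C: "?C \<in> carrier_mat n ny" and D: "?D \<in> carrier_mat n n"
    using Su(1) by (auto simp: G11_def para_conj_def intro!: carrier_matI)
  define b where "b = Re ((?B *\<^sub>v u) \<bullet>c y) + Re ((?C *\<^sub>v y) \<bullet>c u)"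
  have form: "qform (Phi n nw ny G Su Sw s) ((complex_of_real t \<cdot>\<^sub>v y) @\<^sub>v u) = t\<^sup>2 * qform ?P y + t * b + qform ?D u" for t
    unfolding Phi_def b_def by (rule four_block_qform_scale[OF P B C D y u])
  have one: "complex_of_real 1 \<cdot>\<^sub>v y = y" by (rule eq_vecI) auto
  have P0: "qform ?P y \<ge> 0" unfolding s_def by (rule Psi_axis_nonneg[OF Su(1,3) Sw(1,3) y])
  have "t\<^sup>2 * qform ?P y \<le> t * qform ?P y"
    using t P0 by (intro mult_right_mono) (auto simp: power2_eq_square mult_left_le)
  then show ?thesis using form[of t] form[of 1] unfolding one by (simp add: left_diff_distrib distrib_left)
qed

section \<open>Feasible filters\<close>

lemma adjoint_append_rows:
  assumes "A \<in> carrier_mat r1 c" "B \<in> carrier_mat r2 c"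
  shows "(A @\<^sub>r B)\<^sup>\<dagger> = A\<^sup>\<dagger> @\<^sub>c (B :: complex mat)\<^sup>\<dagger>"
  unfolding append_rows_def append_cols_def using assms
  by (subst adjoint_four_block[where ?r1.0 = r1 and ?r2.0 = r2 and ?c1.0 = c and ?c2.0 = 0]) auto

lemma singular_adjoint:
  assumes M: "M \<in> carrier_mat n n" and v: "v \<in> carrier_vec n" "v \<noteq> 0\<^sub>v n" "M *\<^sub>v v = 0\<^sub>v n"
  shows "\<exists>w \<in> carrier_vec n. w \<noteq> 0\<^sub>v n \<and> (M::complex mat)\<^sup>\<dagger> *\<^sub>v w = 0\<^sub>v n"
proof (rule ccontr)
  assume "\<not> ?thesis"
  then have ker: "w = 0\<^sub>v n" if "w \<in> carrier_vec n" "M\<^sup>\<dagger> *\<^sub>v w = 0\<^sub>v n" for w using that by blast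
  obtain N where N: "N \<in> carrier_mat n n" "M\<^sup>\<dagger> * N = 1\<^sub>m n"
    using trivial_kernel_invertible[OF adjoint_carrier[OF M] ker] by blast
  have "(M\<^sup>\<dagger> * N)\<^sup>\<dagger> = N\<^sup>\<dagger> * M" using M N(1) by (simp add: adjoint_mult)
  then have 1: "N\<^sup>\<dagger> * M = 1\<^sub>m n" unfolding N(2) by simp
  have "v = (N\<^sup>\<dagger> * M) *\<^sub>v v" unfolding 1 using v by simp
  also have "\<dots> = N\<^sup>\<dagger> *\<^sub>v (M *\<^sub>v v)" using M N v by (intro assoc_mult_vec) auto
  also have "\<dots> = 0\<^sub>v n" unfolding v(3) using N by (intro eq_vecI) auto
  finally show False using v(2) by simp
qed

text \<open>The state of the adjoint system satisfies its equation at \<open>cnj s\<close>. This does no harm, because the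
  dissipation inequality involves only the real part of the frequency.\<close>

lemma resolvent_adjoint:
  assumes A: "A \<in> carrier_mat m m" and hur: "hurwitz A" and s: "Re s \<ge> 0" and w: "w \<in> carrier_vec m"
  defines "x \<equiv> (mat_inv (s \<cdot>\<^sub>m 1\<^sub>m (dim_row A) - A))\<^sup>\<dagger> *\<^sub>v w"
  shows "x \<in> carrier_vec m" "cnj s \<cdot>\<^sub>v x = A\<^sup>\<dagger> *\<^sub>v x + w"
proof -
  let ?M = "s \<cdot>\<^sub>m 1\<^sub>m (dim_row A) - A"
  have M: "?M \<in> carrier_mat m m" using A by auto
  have "det ?M \<noteq> 0" using resolvent_det[OF A, of s] hurwitz_char_poly[OF A hur s] by simp
  note I = mat_inv_det[OF M this]
  show x: "x \<in> carrier_vec m" unfolding x_def using I(1) by (auto intro!: carrier_vecI)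
  have "(mat_inv ?M * ?M)\<^sup>\<dagger> = ?M\<^sup>\<dagger> * (mat_inv ?M)\<^sup>\<dagger>" using M I(1) by (intro adjoint_mult) auto
  then have 1: "?M\<^sup>\<dagger> * (mat_inv ?M)\<^sup>\<dagger> = 1\<^sub>m m" unfolding I(3) by simp
  have "?M\<^sup>\<dagger> *\<^sub>v x = (?M\<^sup>\<dagger> * (mat_inv ?M)\<^sup>\<dagger>) *\<^sub>v w"
    unfolding x_def using M I(1) w by (intro assoc_mult_vec[symmetric]) auto
  then have 2: "?M\<^sup>\<dagger> *\<^sub>v x = w" unfolding 1 using w by simp
  have "?M\<^sup>\<dagger> = cnj s \<cdot>\<^sub>m 1\<^sub>m m - A\<^sup>\<dagger>" using A by (subst adjoint_minus) (auto simp: adjoint_smult)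
  then have "?M\<^sup>\<dagger> *\<^sub>v x = cnj s \<cdot>\<^sub>v x - A\<^sup>\<dagger> *\<^sub>v x" using A x by (simp add: minus_mult_vec smult_mult_vec)
  then have 3: "cnj s \<cdot>\<^sub>v x - A\<^sup>\<dagger> *\<^sub>v x = w" using 2 by simp
  show "cnj s \<cdot>\<^sub>v x = A\<^sup>\<dagger> *\<^sub>v x + w" unfolding 3[symmetric] using x A by (intro eq_vecI) auto
qed

lemma state_space_adjoint_vec:
  assumes A: "A \<in> carrier_mat m m" and B: "B \<in> carrier_mat m c" and C: "C \<in> carrier_mat r m"
    and D: "D \<in> carrier_mat r c" and u: "u \<in> carrier_vec r"
  shows "(state_space A B C D s)\<^sup>\<dagger> *\<^sub>v u =
    B\<^sup>\<dagger> *\<^sub>v ((mat_inv (s \<cdot>\<^sub>m 1\<^sub>m (dim_row A) - A))\<^sup>\<dagger> *\<^sub>v (C\<^sup>\<dagger> *\<^sub>v u)) + D\<^sup>\<dagger> *\<^sub>v u"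
proof -
  have I: "mat_inv (s \<cdot>\<^sub>m 1\<^sub>m (dim_row A) - A) \<in> carrier_mat m m"
    by (rule mat_inv_carrier) (use A in auto)
  note d = carrier_matD[OF I] carrier_matD[OF B] carrier_matD[OF C] carrier_matD[OF D] carrier_vecD[OF u]
  obtain R where R: "R = mat_inv (s \<cdot>\<^sub>m 1\<^sub>m (dim_row A) - A)" by blast
  note d = d[folded R]
  have Su: "(D + C * R * B)\<^sup>\<dagger> = D\<^sup>\<dagger> + B\<^sup>\<dagger> * (R\<^sup>\<dagger> * C\<^sup>\<dagger>)"
    by (subst adjoint_add) (simp_all add: d adjoint_mult)
  have "(D\<^sup>\<dagger> + B\<^sup>\<dagger> * (R\<^sup>\<dagger> * C\<^sup>\<dagger>)) *\<^sub>v u = D\<^sup>\<dagger> *\<^sub>v u + B\<^sup>\<dagger> *\<^sub>v (R\<^sup>\<dagger> *\<^sub>v (C\<^sup>\<dagger> *\<^sub>v u))"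
    by (simp add: add_mult_vec assoc_mult_vec d)
  then show ?thesis unfolding state_space_def R[symmetric] Su
    by (simp add: comm_add_vec[of _ c] d)
qed

text \<open>An eigenvector of \<open>A11\<^sup>\<dagger>\<close> for an eigenvalue in the closed right half-plane is a motion of the system
  with input \<open>u = 0\<close>, and the stability of \<open>A\<close> supplies the matching \<open>x1\<close>. All terms on the left of the
  dissipation inequality are then nonnegative, while its right-hand side vanishes.\<close>

lemma design_hurwitz:
  assumes A: "A \<in> carrier_mat m m" and B: "B \<in> carrier_mat m p"
    and C1: "C1 \<in> carrier_mat ny m" and C2: "C2 \<in> carrier_mat n m"
    and D1: "D1 \<in> carrier_mat ny p" and D2: "D2 \<in> carrier_mat n p"
    and design: "design_inequality m m11 n ny p A B C1 C2 D1 D2 g A11 B11 C11 J11"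
    and hur: "hurwitz A"
  shows "hurwitz A11"
  unfolding hurwitz_def
proof (intro allI impI, rule ccontr)
  have c11: "A11 \<in> carrier_mat m11 m11" "B11 \<in> carrier_mat m11 ny" "C11 \<in> carrier_mat n m11" "J11 \<in> carrier_mat n ny"
    using design unfolding design_inequality_def by auto
  fix \<mu> assume ev: "eigenvalue A11 \<mu>" and "\<not> Re \<mu> < 0"
  then have mu: "Re \<mu> \<ge> 0" by simp
  let ?M = "\<mu> \<cdot>\<^sub>m 1\<^sub>m m11 - A11"
  have M: "?M \<in> carrier_mat m11 m11" using c11 by auto
  obtain v where v: "v \<in> carrier_vec m11" "v \<noteq> 0\<^sub>v m11" "A11 *\<^sub>v v = \<mu> \<cdot>\<^sub>v v"
    using ev c11 unfolding eigenvalue_def eigenvector_def by auto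
  have "?M *\<^sub>v v = 0\<^sub>v m11" using v c11 by (intro eq_vecI) (simp_all add: minus_mult_vec smult_mult_vec)
  then obtain x2 where x2: "x2 \<in> carrier_vec m11" "x2 \<noteq> 0\<^sub>v m11" "?M\<^sup>\<dagger> *\<^sub>v x2 = 0\<^sub>v m11"
    using singular_adjoint[OF M v(1,2)] by blast
  have Md: "?M\<^sup>\<dagger> = cnj \<mu> \<cdot>\<^sub>m 1\<^sub>m m11 - A11\<^sup>\<dagger>" using c11 by (subst adjoint_minus) (auto simp: adjoint_smult)
  have diff: "cnj \<mu> \<cdot>\<^sub>v x2 - A11\<^sup>\<dagger> *\<^sub>v x2 = 0\<^sub>v m11"
    using x2 c11 unfolding Md by (simp add: minus_mult_vec smult_mult_vec)
  have e2: "cnj \<mu> \<cdot>\<^sub>v x2 = A11\<^sup>\<dagger> *\<^sub>v x2 + C11\<^sup>\<dagger> *\<^sub>v 0\<^sub>v n"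
  proof (rule eq_vecI)
    fix i assume i: "i < dim_vec (A11\<^sup>\<dagger> *\<^sub>v x2 + C11\<^sup>\<dagger> *\<^sub>v 0\<^sub>v n)"
    have "(cnj \<mu> \<cdot>\<^sub>v x2 - A11\<^sup>\<dagger> *\<^sub>v x2) $ i = 0" unfolding diff using i c11 by simp
    then show "(cnj \<mu> \<cdot>\<^sub>v x2) $ i = (A11\<^sup>\<dagger> *\<^sub>v x2 + C11\<^sup>\<dagger> *\<^sub>v 0\<^sub>v n) $ i"
      using i c11 x2(1) by simp
  qed (use c11 x2 in simp)
  define y where "y = B11\<^sup>\<dagger> *\<^sub>v x2 + J11\<^sup>\<dagger> *\<^sub>v 0\<^sub>v n"
  define w where "w = C1\<^sup>\<dagger> *\<^sub>v y + C2\<^sup>\<dagger> *\<^sub>v 0\<^sub>v n"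
  have w: "w \<in> carrier_vec m" unfolding w_def using C1 C2 by (auto intro!: carrier_vecI)
  define x1 where "x1 = (mat_inv (\<mu> \<cdot>\<^sub>m 1\<^sub>m (dim_row A) - A))\<^sup>\<dagger> *\<^sub>v w"
  note x1 = resolvent_adjoint[OF A hur mu w, folded x1_def]
  have e1: "cnj \<mu> \<cdot>\<^sub>v x1 = A\<^sup>\<dagger> *\<^sub>v x1 + C1\<^sup>\<dagger> *\<^sub>v y + C2\<^sup>\<dagger> *\<^sub>v 0\<^sub>v n"
    unfolding x1(2) w_def using A C1 C2 by (intro eq_vecI) auto
  define z where "z = B\<^sup>\<dagger> *\<^sub>v x1 + D1\<^sup>\<dagger> *\<^sub>v y + D2\<^sup>\<dagger> *\<^sub>v 0\<^sub>v n"
  obtain X where X: "X \<in> carrier_mat (m + m11) (m + m11)" "pos_def X"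
    and neg: "2 * Re (cnj \<mu>) * qform X (x1 @\<^sub>v x2) + sqnorm z < g\<^sup>2 * Re ((0\<^sub>v n :: complex vec) \<bullet>c 0\<^sub>v n)"
    by (rule design_dissipation[OF A B C1 C2 D1 D2 design x1(1) x2(1) zero_carrier_vec y_def e2 e1 z_def]) (use x2 in auto)
  have v12: "x1 @\<^sub>v x2 \<in> carrier_vec (m + m11)" "x1 @\<^sub>v x2 \<noteq> 0\<^sub>v (m + m11)"
    using x1(1) x2 by (auto simp: append_vec_eq_zero)
  have "qform X (x1 @\<^sub>v x2) > 0" using iffD1[OF pos_def_iff[OF X(1)] X(2)] v12 by blast
  then have "2 * Re (cnj \<mu>) * qform X (x1 @\<^sub>v x2) \<ge> 0" using mu by simp
  moreover have "sqnorm z \<ge> 0" by (rule cscalar_self_nonneg)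
  ultimately show False using neg by simp
qed

text \<open>As both systems are stable, \<open>u\<close> determines the states \<open>x2\<close> and \<open>x1\<close> at \<open>i\<omega>\<close>, where the storage term of
  the dissipation inequality vanishes.\<close>

lemma design_gain:
  fixes x :: real
  assumes A: "A \<in> carrier_mat m m" and B: "B \<in> carrier_mat m p"
    and C1: "C1 \<in> carrier_mat ny m" and C2: "C2 \<in> carrier_mat n m"
    and D1: "D1 \<in> carrier_mat ny p" and D2: "D2 \<in> carrier_mat n p"
    and design: "design_inequality m m11 n ny p A B C1 C2 D1 D2 g A11 B11 C11 J11"
    and hur: "hurwitz A" and u: "u \<in> carrier_vec n" "u \<noteq> 0\<^sub>v n"
  defines "U \<equiv> state_space A B (C1 @\<^sub>r C2) (D1 @\<^sub>r D2) (im_axis x)"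
    and "H \<equiv> state_space A11 B11 C11 J11 (im_axis x)"
  shows "qform (U * U\<^sup>\<dagger>) ((H\<^sup>\<dagger> *\<^sub>v u) @\<^sub>v u) < g\<^sup>2 * sqnorm u"
proof -
  have c11: "A11 \<in> carrier_mat m11 m11" "B11 \<in> carrier_mat m11 ny" "C11 \<in> carrier_mat n m11" "J11 \<in> carrier_mat n ny"
    using design unfolding design_inequality_def by auto
  note hur11 = design_hurwitz[OF A B C1 C2 D1 D2 design hur]
  let ?s = "im_axis x"
  have s: "Re ?s \<ge> 0" by simp
  have C: "C1 @\<^sub>r C2 \<in> carrier_mat (ny + n) m" and D: "D1 @\<^sub>r D2 \<in> carrier_mat (ny + n) p"
    using C1 C2 D1 D2 by (auto intro!: carrier_matI)
  have w2: "C11\<^sup>\<dagger> *\<^sub>v u \<in> carrier_vec m11" using c11 by (auto intro!: carrier_vecI)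
  define x2 where "x2 = (mat_inv (?s \<cdot>\<^sub>m 1\<^sub>m (dim_row A11) - A11))\<^sup>\<dagger> *\<^sub>v (C11\<^sup>\<dagger> *\<^sub>v u)"
  note x2 = resolvent_adjoint[OF c11(1) hur11 s w2, folded x2_def]
  define y where "y = B11\<^sup>\<dagger> *\<^sub>v x2 + J11\<^sup>\<dagger> *\<^sub>v u"
  have y: "y \<in> carrier_vec ny" unfolding y_def using c11 by (auto intro!: carrier_vecI)
  have Hy: "H\<^sup>\<dagger> *\<^sub>v u = y"
    unfolding H_def state_space_adjoint_vec[OF c11 u(1)] y_def x2_def ..
  define w where "w = C1\<^sup>\<dagger> *\<^sub>v y + C2\<^sup>\<dagger> *\<^sub>v u"
  have w: "w \<in> carrier_vec m" unfolding w_def using C1 C2 by (auto intro!: carrier_vecI)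
  define x1 where "x1 = (mat_inv (?s \<cdot>\<^sub>m 1\<^sub>m (dim_row A) - A))\<^sup>\<dagger> *\<^sub>v w"
  note x1 = resolvent_adjoint[OF A hur s w, folded x1_def]
  have e1: "cnj ?s \<cdot>\<^sub>v x1 = A\<^sup>\<dagger> *\<^sub>v x1 + C1\<^sup>\<dagger> *\<^sub>v y + C2\<^sup>\<dagger> *\<^sub>v u"
    unfolding x1(2) w_def using A C1 C2 by (intro eq_vecI) auto
  define z where "z = B\<^sup>\<dagger> *\<^sub>v x1 + D1\<^sup>\<dagger> *\<^sub>v y + D2\<^sup>\<dagger> *\<^sub>v u"
  have yu: "y @\<^sub>v u \<in> carrier_vec (ny + n)" using y u by simp
  have "(C1 @\<^sub>r C2)\<^sup>\<dagger> *\<^sub>v (y @\<^sub>v u) = w" "(D1 @\<^sub>r D2)\<^sup>\<dagger> *\<^sub>v (y @\<^sub>v u) = D1\<^sup>\<dagger> *\<^sub>v y + D2\<^sup>\<dagger> *\<^sub>v u"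
    unfolding w_def adjoint_append_rows[OF C1 C2] adjoint_append_rows[OF D1 D2]
    using y u C1 C2 D1 D2 by (auto intro!: append_cols_mult_vec)
  then have Uz: "U\<^sup>\<dagger> *\<^sub>v (y @\<^sub>v u) = z"
    unfolding U_def state_space_adjoint_vec[OF A B C D yu] z_def x1_def
    using B D1 D2 by (intro eq_vecI) auto
  have Uc: "U \<in> carrier_mat (ny + n) p" unfolding U_def by (rule state_space_carrier[OF A B C D])
  have q: "qform (U * U\<^sup>\<dagger>) (y @\<^sub>v u) = sqnorm z"
    using qform_gram[OF adjoint_carrier[OF Uc] yu] Uz by simp
  have "2 * Re (cnj ?s) * q + sqnorm z = sqnorm z" for q by simp
  moreover obtain X where "2 * Re (cnj ?s) * qform X (x1 @\<^sub>v x2) + sqnorm z < g\<^sup>2 * sqnorm u"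
    by (rule design_dissipation[OF A B C1 C2 D1 D2 design x1(1) x2(1) u(1) y_def x2(2) e1 z_def]) (use u in auto)
  ultimately show ?thesis unfolding Hy q by simp
qed

lemma quantum_channel_stable:
  assumes channel: "quantum_channel n nw ny nd k A B C D" and G: "G = state_space A B C D"
  shows "stable_entries (ny + nd) (n + nw) G"
proof -
  have "A \<in> carrier_mat k k" "B \<in> carrier_mat k (n + nw)" "C \<in> carrier_mat (ny + nd) k"
    "D \<in> carrier_mat (ny + nd) (n + nw)" "hurwitz A"
    using channel unfolding quantum_channel_def minimal_realization_def is_realization_def by auto
  then show ?thesis unfolding G by (rule state_space_stable_entries)
qed

lemma Phi_axis_continuous:
  assumes G: "stable_entries (ny + nd) (n + nw) G"
    and Su: "Su \<in> carrier_mat n n" and Sw: "Sw \<in> carrier_mat nw nw"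
  shows "mat_tendsto (ny + n) (ny + n) (\<lambda>x. Phi n nw ny G Su Sw (im_axis x))
    (Phi n nw ny G Su Sw (im_axis w)) (at w)"
  using mat_tendsto_Phi[OF stable_entries_axis_continuous[OF G, of w], of ny n nw Su Sw] Su Sw
  unfolding Phi_def Psi_def para_conj_axis G11_axis by simp

lemma Phi_axis_limit:
  assumes G: "stable_entries (ny + nd) (n + nw) G"
    and Su: "Su \<in> carrier_mat n n" and Sw: "Sw \<in> carrier_mat nw nw"
  shows "\<exists>L. mat_tendsto (ny + n) (ny + n) (\<lambda>x. Phi n nw ny G Su Sw (im_axis x)) L (axis_filter w)"
proof -
  obtain L where "mat_tendsto (ny + nd) (n + nw) (\<lambda>x. G (im_axis x)) L (axis_filter w)"
    by (rule stable_entries_axis_limit[OF G])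
  from mat_tendsto_Phi[OF this _ _ Su Sw, of ny] show ?thesis by auto
qed

lemma qform_zero: "M \<in> carrier_mat k k \<Longrightarrow> qform M (0\<^sub>v k) = 0"
  using cscalar_zero_right[of "M *\<^sub>v 0\<^sub>v k"] by (simp add: qform_def)

lemma E22_carrier: "E22 n ny \<in> carrier_mat (ny + n) (ny + n)"
  unfolding E22_def by (intro carrier_matI) auto

lemma E22_qform:
  assumes "y \<in> carrier_vec ny" "u \<in> carrier_vec n"
  shows "qform (E22 n ny) (y @\<^sub>v u) = sqnorm u"
    "qform (four_block_mat (1\<^sub>m ny) (0\<^sub>m ny n) (0\<^sub>m n ny) (- 1\<^sub>m n)) (y @\<^sub>v u) = sqnorm y - sqnorm u"
proof -
  have z: "0\<^sub>m r n *\<^sub>v u = 0\<^sub>v r" "0\<^sub>m r ny *\<^sub>v y = 0\<^sub>v r" for r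
    using zero_mult_vec[of r u] zero_mult_vec[of r y] assms by auto
  have "E22 n ny *\<^sub>v (y @\<^sub>v u) = 0\<^sub>v ny @\<^sub>v u"
    unfolding E22_def using assms by (subst four_block_mult_vec) (auto simp: z)
  then show "qform (E22 n ny) (y @\<^sub>v u) = sqnorm u"
    using assms cscalar_zero_left[of y] unfolding qform_def by (simp add: cscalar_append)
  have "four_block_mat (1\<^sub>m ny) (0\<^sub>m ny n) (0\<^sub>m n ny) (- 1\<^sub>m n) *\<^sub>v (y @\<^sub>v u) = y @\<^sub>v (- u)"
    using assms by (subst four_block_mult_vec) (auto simp: z)
  then show "qform (four_block_mat (1\<^sub>m ny) (0\<^sub>m ny n) (0\<^sub>m n ny) (- 1\<^sub>m n)) (y @\<^sub>v u) = sqnorm y - sqnorm u"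
    using assms unfolding qform_def by (simp add: cscalar_append cscalar_uminus_left)
qed

text \<open>The factorization holds off a finite set, and both sides are continuous along the axis.\<close>

lemma factorization_axis:
  fixes w :: real
  assumes G: "stable_entries (ny + nd) (n + nw) G"
    and Su: "Su \<in> carrier_mat n n" and Sw: "Sw \<in> carrier_mat nw nw"
    and fact: "Phi_lambda n nw ny G Su Sw l \<doteq> (\<lambda>s. Ups s * Ups\<^sup>H s)"
    and U: "Ups \<doteq> U" "stable_entries (ny + n) p U"
  shows "Phi n nw ny G Su Sw (im_axis w) + complex_of_real (l\<^sup>2) \<cdot>\<^sub>m E22 n ny =
    U (im_axis w) * (U (im_axis w))\<^sup>\<dagger>"
proof (rule mat_tendsto_unique[where F = "at w"])
  let ?X = "\<lambda>x::real. Phi n nw ny G Su Sw (im_axis x) + complex_of_real (l\<^sup>2) \<cdot>\<^sub>m E22 n ny"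
  let ?Y = "\<lambda>x::real. U (im_axis x) * (U (im_axis x))\<^sup>\<dagger>"
  show "mat_tendsto (ny + n) (ny + n) ?X (?X w) (at w)"
    by (intro mat_tendsto_add Phi_axis_continuous[OF G Su Sw] mat_tendsto_const smult_carrier_mat E22_carrier)
  show "mat_tendsto (ny + n) (ny + n) ?Y (?Y w) (at w)"
    by (rule mat_tendsto_mult[OF stable_entries_axis_continuous[OF U(2)]
          mat_tendsto_adjoint[OF stable_entries_axis_continuous[OF U(2)]]])
  let ?S = "{x. Phi_lambda n nw ny G Su Sw l (im_axis x) \<noteq> Ups (im_axis x) * Ups\<^sup>H (im_axis x)}
    \<union> {x. Ups (im_axis x) \<noteq> U (im_axis x)}"
  have "finite ?S" using tf_eq_axis[OF fact] tf_eq_axis[OF U(1)] by simp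
  from finite_eventually_at[OF this]
  show "eventually (\<lambda>x. ?X x = ?Y x) (at w)"
    by (rule eventually_mono) (simp add: Phi_lambda_def para_conj_axis)
qed simp

text \<open>At \<open>(H\<^sup>\<dagger> u, u)\<close> the hypothesis on \<open>\<theta>\<close> reads \<open>|H\<^sup>\<dagger> u|\<^sup>2 - |u|\<^sup>2 < \<theta> (P_e(u) - g\<^sup>2 |u|\<^sup>2)\<close>, and the
  right-hand side is not positive. At infinite frequency the bound on \<open>P_e\<close> survives in the limit only
  as a weak inequality; the strictness comes from the hypothesis on \<open>\<theta>\<close>.\<close>

lemma theta_contraction:
  assumes G: "stable_entries (ny + nd) (n + nw) G"
    and Su: "Su \<in> carrier_mat n n" and Sw: "Sw \<in> carrier_mat nw nw"
    and H: "stable_entries n ny H"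
    and bound: "\<And>x u. u \<in> carrier_vec n \<Longrightarrow> error_form (Phi n nw ny G Su Sw (im_axis x)) (H (im_axis x)) u \<le> g\<^sup>2 * sqnorm u"
    and \<theta>: "\<theta> > 0" "pos_def (freq_value (\<lambda>s.
         complex_of_real \<theta> \<cdot>\<^sub>m (Phi n nw ny G Su Sw s - complex_of_real (g\<^sup>2) \<cdot>\<^sub>m E22 n ny)
         - four_block_mat (1\<^sub>m ny) (0\<^sub>m ny n) (0\<^sub>m n ny) (- 1\<^sub>m n)) w)"
  shows "freq_value H w * (freq_value H w)\<^sup>\<dagger> \<prec> 1\<^sub>m n"
proof -
  obtain P where P: "mat_tendsto (ny + n) (ny + n) (\<lambda>x. Phi n nw ny G Su Sw (im_axis x)) P (axis_filter w)"
    using Phi_axis_limit[OF G Su Sw] by blast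
  obtain L where L: "mat_tendsto n ny (\<lambda>x. H (im_axis x)) L (axis_filter w)"
    by (rule stable_entries_axis_limit[OF H])
  let ?E = "complex_of_real (g\<^sup>2) \<cdot>\<^sub>m E22 n ny"
  let ?J = "four_block_mat (1\<^sub>m ny) (0\<^sub>m ny n) (0\<^sub>m n ny) (- 1\<^sub>m n) :: complex mat"
  have E: "?E \<in> carrier_mat (ny + n) (ny + n)" by (intro smult_carrier_mat E22_carrier)
  have J: "?J \<in> carrier_mat (ny + n) (ny + n)" by (intro carrier_matI) auto
  have Pc: "P \<in> carrier_mat (ny + n) (ny + n)" by (rule mat_tendsto_carrier(2)[OF P])
  have PE: "P - ?E \<in> carrier_mat (ny + n) (ny + n)" using E by (rule minus_carrier_mat)
  have TPE: "complex_of_real \<theta> \<cdot>\<^sub>m (P - ?E) \<in> carrier_mat (ny + n) (ny + n)" using PE by simp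
  have M: "complex_of_real \<theta> \<cdot>\<^sub>m (P - ?E) - ?J \<in> carrier_mat (ny + n) (ny + n)" using J by (rule minus_carrier_mat)
  have "freq_value (\<lambda>s. complex_of_real \<theta> \<cdot>\<^sub>m (Phi n nw ny G Su Sw s - ?E) - ?J) w =
      complex_of_real \<theta> \<cdot>\<^sub>m (P - ?E) - ?J"
    by (rule freq_value_eq[OF mat_tendsto_minus[OF mat_tendsto_smult[OF mat_tendsto_minus[OF P mat_tendsto_const[OF E]]]
          mat_tendsto_const[OF J]]])
  then have pd: "pos_def (complex_of_real \<theta> \<cdot>\<^sub>m (P - ?E) - ?J)" using \<theta>(2) by simp
  have Lc: "L \<in> carrier_mat n ny" by (rule mat_tendsto_carrier(2)[OF L])
  have fv: "freq_value H w = L" by (rule freq_value_eq[OF L])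
  show ?thesis unfolding fv contraction_iff[OF Lc]
  proof (intro ballI impI)
    fix u :: "complex vec" assume u: "u \<in> carrier_vec n" "u \<noteq> 0\<^sub>v n"
    let ?y = "L\<^sup>\<dagger> *\<^sub>v u"
    have y: "?y \<in> carrier_vec ny" using Lc by (auto intro!: carrier_vecI)
    have yu: "?y @\<^sub>v u \<in> carrier_vec (ny + n)" "?y @\<^sub>v u \<noteq> 0\<^sub>v (ny + n)"
      using y u by (auto simp: append_vec_eq_zero)
    define T where "T K = four_block_mat K\<^sup>\<dagger> (0\<^sub>m ny 0) (1\<^sub>m n) (0\<^sub>m n 0)" for K :: "complex mat"
    have T: "mat_tendsto (ny + n) (n + 0) (\<lambda>x. T (H (im_axis x))) (T L) (axis_filter w)"
      unfolding T_def by (intro mat_tendsto_four_block mat_tendsto_adjoint[OF L] mat_tendsto_const) auto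
    have TK: "T K *\<^sub>v u = (K\<^sup>\<dagger> *\<^sub>v u) @\<^sub>v u" if "K \<in> carrier_mat n ny" for K
    proof -
      have "T K = K\<^sup>\<dagger> @\<^sub>r 1\<^sub>m n" unfolding T_def append_rows_def using that by simp
      then show ?thesis using that u by (simp add: append_rows_mult_vec)
    qed
    have TKc: "T K \<in> carrier_mat (ny + n) n" if "K \<in> carrier_mat n ny" for K
      using that unfolding T_def by (intro carrier_matI) auto
    have Hc: "H s \<in> carrier_mat n ny" for s by (rule stable_entries_carrier[OF H])
    have Phic: "Phi n nw ny G Su Sw s \<in> carrier_mat (ny + n) (ny + n)" for s by (rule Phi_carrier(1)[OF Su Sw])
    let ?Q = "\<lambda>x. (T (H (im_axis x)))\<^sup>\<dagger> * Phi n nw ny G Su Sw (im_axis x) * T (H (im_axis x))"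
    have "mat_tendsto (n + 0) (n + 0) ?Q ((T L)\<^sup>\<dagger> * P * T L) (axis_filter w)"
      by (rule mat_tendsto_mult[OF mat_tendsto_mult[OF mat_tendsto_adjoint[OF T] P] T])
    from mat_tendsto_qform[OF this] u(1)
    have "((\<lambda>x. qform (?Q x) u) \<longlongrightarrow> qform ((T L)\<^sup>\<dagger> * P * T L) u) (axis_filter w)" by simp
    moreover have "qform (?Q x) u \<le> g\<^sup>2 * sqnorm u" for x
      using bound[OF u(1), of x] unfolding qform_congruence[OF Phic TKc[OF Hc] u(1)] TK[OF Hc] .
    ultimately have "qform ((T L)\<^sup>\<dagger> * P * T L) u \<le> g\<^sup>2 * sqnorm u"
      using tendsto_upperbound[OF _ always_eventually axis_filter_not_bot] by blast
    then have 1: "qform P (?y @\<^sub>v u) \<le> g\<^sup>2 * sqnorm u"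
      unfolding qform_congruence[OF Pc TKc[OF Lc] u(1)] TK[OF Lc] .
    have "0 < qform (complex_of_real \<theta> \<cdot>\<^sub>m (P - ?E) - ?J) (?y @\<^sub>v u)"
      using iffD1[OF pos_def_iff[OF M] pd] yu by blast
    also have "\<dots> = \<theta> * (qform P (?y @\<^sub>v u) - g\<^sup>2 * sqnorm u) - (sqnorm ?y - sqnorm u)"
      unfolding qform_minus_mat[OF TPE J yu(1)] qform_smult_mat[OF PE yu(1)] qform_minus_mat[OF Pc E yu(1)]
        qform_smult_mat[OF E22_carrier yu(1)] E22_qform[OF y u(1)] ..
    also have "\<dots> \<le> - (sqnorm ?y - sqnorm u)"
      using \<theta>(1) 1 by (simp add: mult_nonneg_nonpos)
    finally show "sqnorm ?y < sqnorm u" by simp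
  qed
qed

lemma H11_minusI:
  assumes H: "stable_entries n ny H"
    and Su: "Su \<in> carrier_mat n n" "hermitian Su" and Sw: "Sw \<in> carrier_mat nw nw" "hermitian Sw"
    and power: "\<And>x u. u \<in> carrier_vec n \<Longrightarrow> u \<noteq> 0\<^sub>v n \<Longrightarrow> error_form (Phi n nw ny G Su Sw (im_axis x)) (H (im_axis x)) u < g\<^sup>2 * sqnorm u"
    and contr: "\<And>w. freq_value H w * (freq_value H w)\<^sup>\<dagger> \<prec> 1\<^sub>m n"
  shows "H \<in> H11_minus n nw ny G Su Sw g"
  unfolding H11_minus_def
proof (intro CollectI conjI allI impI)
  show "proper_rational_mat n ny H" by (rule stable_entries_proper[OF H])
  show "Re s < 0" if "pole H s" for s by (rule stable_entries_no_pole[OF H that])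
  show "\<exists>\<tau>>0. analytic_mat H {s. - \<tau> < Re s}" by (rule stable_entries_analytic_mat[OF H])
  show "freq_value H w * (freq_value H w)\<^sup>\<dagger> \<prec> 1\<^sub>m n" for w by (rule contr)
  fix x :: real
  note P = P_e_axis[of H x, OF stable_entries_carrier[OF H] Su Sw]
  show "P_e n nw ny G Su Sw H (im_axis x) \<prec> complex_of_real (g\<^sup>2) \<cdot>\<^sub>m 1\<^sub>m n"
    unfolding mat_less_scalar_iff[OF P(1,2)] using P(3) power by simp
qed

lemma design_member:
  assumes channel: "quantum_channel n nw ny nd k A B C D" and G: "G = state_space A B C D"
    and Su: "Su \<in> carrier_mat n n" "hermitian Su" and Sw: "Sw \<in> carrier_mat nw nw" "hermitian Sw"
    and factorization: "Phi_lambda n nw ny G Su Sw l \<doteq> (\<lambda>s. Ups s * Ups\<^sup>H s)"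
    and dims: "C1 \<in> carrier_mat ny m" "C2 \<in> carrier_mat n m"
      "D1 \<in> carrier_mat ny p" "D2 \<in> carrier_mat n p"
    and realization: "minimal_realization (ny + n) p m Al Bl (C1 @\<^sub>r C2) (D1 @\<^sub>r D2) Ups"
    and Al: "hurwitz Al"
    and g: "g\<^sup>2 = gbar\<^sup>2 - l\<^sup>2"
    and \<theta>: "\<theta> > 0"
      "\<forall>\<omega>::ereal. pos_def (freq_value (\<lambda>s.
         complex_of_real \<theta> \<cdot>\<^sub>m (Phi n nw ny G Su Sw s - complex_of_real (g\<^sup>2) \<cdot>\<^sub>m E22 n ny)
         - four_block_mat (1\<^sub>m ny) (0\<^sub>m ny n) (0\<^sub>m n ny) (- 1\<^sub>m n)) \<omega>)"
    and design: "design_inequality m m11 n ny p Al Bl C1 C2 D1 D2 gbar A11 B11 C11 J11"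
  shows "state_space A11 B11 C11 J11 \<in> H11_minus n nw ny G Su Sw g"
proof -
  let ?H = "state_space A11 B11 C11 J11" and ?U = "state_space Al Bl (C1 @\<^sub>r C2) (D1 @\<^sub>r D2)"
  have real: "Al \<in> carrier_mat m m" "Bl \<in> carrier_mat m p" "C1 @\<^sub>r C2 \<in> carrier_mat (ny + n) m"
    "D1 @\<^sub>r D2 \<in> carrier_mat (ny + n) p" "Ups \<doteq> ?U"
    using realization unfolding minimal_realization_def is_realization_def by auto
  have c11: "A11 \<in> carrier_mat m11 m11" "B11 \<in> carrier_mat m11 ny" "C11 \<in> carrier_mat n m11" "J11 \<in> carrier_mat n ny"
    using design unfolding design_inequality_def by auto
  have Gs: "stable_entries (ny + nd) (n + nw) G" by (rule quantum_channel_stable[OF channel G])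
  have Us: "stable_entries (ny + n) p ?U" by (rule state_space_stable_entries[OF real(1-4) Al])
  have Hs: "stable_entries n ny ?H"
    by (rule state_space_stable_entries[OF c11 design_hurwitz[OF real(1,2) dims design Al]])
  have power: "error_form (Phi n nw ny G Su Sw (im_axis x)) (?H (im_axis x)) u
      < g\<^sup>2 * sqnorm u" if u: "u \<in> carrier_vec n" "u \<noteq> 0\<^sub>v n" for x u
  proof -
    let ?s = "im_axis x"
    let ?v = "((?H ?s)\<^sup>\<dagger> *\<^sub>v u) @\<^sub>v u"
    have y: "(?H ?s)\<^sup>\<dagger> *\<^sub>v u \<in> carrier_vec ny" using stable_entries_carrier[OF Hs, of ?s] by (auto intro!: carrier_vecI)
    have v: "?v \<in> carrier_vec (ny + n)" using y u by simp
    have "qform (Phi n nw ny G Su Sw ?s + complex_of_real (l\<^sup>2) \<cdot>\<^sub>m E22 n ny) ?v < gbar\<^sup>2 * sqnorm u"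
      unfolding factorization_axis[OF Gs Su(1) Sw(1) factorization real(5) Us]
      by (rule design_gain[OF real(1,2) dims design Al u])
    also have "qform (Phi n nw ny G Su Sw ?s + complex_of_real (l\<^sup>2) \<cdot>\<^sub>m E22 n ny) ?v =
        qform (Phi n nw ny G Su Sw ?s) ?v + l\<^sup>2 * sqnorm u"
      unfolding qform_add_mat[OF Phi_carrier(1)[OF Su(1) Sw(1)] smult_carrier_mat[OF E22_carrier] v]
        qform_smult_mat[OF E22_carrier v] E22_qform(1)[OF y u(1)] ..
    finally show ?thesis unfolding g by (simp add: left_diff_distrib)
  qed
  have power': "error_form (Phi n nw ny G Su Sw (im_axis x)) (?H (im_axis x)) u
      \<le> g\<^sup>2 * sqnorm u" if u: "u \<in> carrier_vec n" for x u
  proof (cases "u = 0\<^sub>v n")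
    case True
    have "(?H (im_axis x))\<^sup>\<dagger> *\<^sub>v 0\<^sub>v n = 0\<^sub>v ny"
      using mult_vec_zero[of "(?H (im_axis x))\<^sup>\<dagger>"] carrier_matD[OF stable_entries_carrier[OF Hs, of "im_axis x"]] by simp
    then show ?thesis using True qform_zero[OF Phi_carrier(1)[OF Su(1) Sw(1)]] by simp
  next
    case False
    then show ?thesis using power[OF u] by (simp add: less_imp_le)
  qed
  show ?thesis
    by (rule H11_minusI[OF Hs Su Sw power])
       (use theta_contraction[OF Gs Su(1) Sw(1) Hs power' \<theta>(1)] \<theta>(2) in blast)+
qed

section \<open>Strictly contractive approximation\<close>

lemma stable_entries_smult:
  assumes "stable_entries r c X" shows "stable_entries r c (\<lambda>s. a \<cdot>\<^sub>m X s)"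
  unfolding stable_entries_def
proof (intro conjI allI impI)
  show "a \<cdot>\<^sub>m X s \<in> carrier_mat r c" for s using stable_entries_carrier[OF assms] by simp
  fix i j assume ij: "i < r" "j < c"
  obtain p q where pq: "stable_fraction p q (\<lambda>s. X s $$ (i, j))" by (rule stable_entriesE[OF assms ij])
  have "degree (Polynomial.smult a p) \<le> degree q" using stable_fractionD(1)[OF pq] degree_smult_le le_trans by blast
  then have "stable_fraction (Polynomial.smult a p) q (\<lambda>s. (a \<cdot>\<^sub>m X s) $$ (i, j))"
    using stable_fractionD[OF pq] ij carrier_matD[OF stable_entries_carrier[OF assms]] unfolding stable_fraction_def by simp
  then show "\<exists>p q. stable_fraction p q (\<lambda>s. (a \<cdot>\<^sub>m X s) $$ (i, j))" by blast
qed

text \<open>Otherwise the reciprocal ratio tends to zero along the axis.\<close>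

lemma bounded_ratio_degree:
  fixes p q :: "complex poly"
  assumes q: "\<And>x::real. poly q (im_axis x) \<noteq> 0"
    and bound: "\<And>x::real. cmod (poly p (im_axis x) / poly q (im_axis x)) \<le> M"
  shows "degree p \<le> degree q"
proof (rule ccontr)
  assume "\<not> degree p \<le> degree q"
  then have deg: "degree q < degree p" by simp
  have M: "M \<ge> 0" using bound[of 0] norm_ge_zero order_trans by blast
  have "((\<lambda>x. poly q (im_axis x) / poly p (im_axis x)) \<longlongrightarrow> 0) at_top"
    by (rule filterlim_compose[OF poly_divide_tendsto_0_at_infinity[OF deg] filterlim_axis_at_infinity(1)])
  then have "eventually (\<lambda>x. cmod (poly q (im_axis x) / poly p (im_axis x)) < 1 / (M + 1)) at_top"
    using M by (intro order_tendstoD(2)[where y = "cmod 0"] tendsto_norm) (auto intro: tendsto_norm_zero)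
  moreover have "eventually (\<lambda>x. poly p (im_axis x) \<noteq> 0) at_top"
  proof -
    have p0: "p \<noteq> 0" using deg by auto
    have "finite ((\<lambda>x. im_axis x) -` {s. poly p s = 0})"
      by (rule finite_vimageI[OF poly_roots_finite[OF p0]]) (auto simp: inj_on_def)
    from finite_imp_bounded[OF this]
    obtain b where b: "\<forall>x\<in>(\<lambda>x. im_axis x) -` {s. poly p s = 0}. norm x \<le> b"
      unfolding bounded_iff ..
    show ?thesis
    proof (rule eventually_mono[OF eventually_gt_at_top[of "\<bar>b\<bar>"]], rule notI)
      fix x :: real assume x: "\<bar>b\<bar> < x" "poly p (im_axis x) = 0"
      then have "x \<in> (\<lambda>x. im_axis x) -` {s. poly p s = 0}" by simp
      then have "norm x \<le> b" using b by blast
      then show False using x(1) by simp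
    qed
  qed
  ultimately have "eventually (\<lambda>x::real. False) at_top"
  proof eventually_elim
    case (elim x)
    let ?p = "cmod (poly p (im_axis x))" and ?q = "cmod (poly q (im_axis x))"
    have pos: "?p > 0" "?q > 0" using elim(2) q by auto
    have "?p \<le> M * ?q" using bound[of x] pos by (simp add: norm_divide pos_divide_le_eq)
    moreover have "?q * (M + 1) < ?p" using elim(1) pos M by (simp add: norm_divide divide_less_eq less_divide_eq)
    ultimately show False using pos by (simp add: algebra_simps)
  qed
  then show False by simp
qed

lemma cancel_common_roots:
  fixes p q :: "complex poly"
  assumes "q \<noteq> 0"
  shows "\<exists>d p' q'. p = d * p' \<and> q = d * q' \<and> (\<forall>s. poly p' s = 0 \<longrightarrow> poly q' s \<noteq> 0)"
  using assms
proof (induction "degree q" arbitrary: p q rule: less_induct)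
  case less
  show ?case
  proof (cases "\<exists>s. poly p s = 0 \<and> poly q s = 0")
    case False
    then have "p = 1 * p \<and> q = 1 * q \<and> (\<forall>s. poly p s = 0 \<longrightarrow> poly q s \<noteq> 0)" by auto
    then show ?thesis by blast
  next
    case True
    then obtain s p1 q1 where s: "p = [:-s, 1:] * p1" "q = [:-s, 1:] * q1"
      unfolding poly_eq_0_iff_dvd dvd_def by blast
    have q1: "q1 \<noteq> 0" using less.prems s(2) by auto
    then have "degree q1 < degree q" unfolding s(2) by (subst degree_mult_eq) auto
    from less.hyps[OF this q1] obtain d p' q' where
      "p1 = d * p'" "q1 = d * q'" "\<forall>s. poly p' s = 0 \<longrightarrow> poly q' s \<noteq> 0" by blast
    then show ?thesis unfolding s by (intro exI[of _ "[:-s, 1:] * d"] exI[of _ p'] exI[of _ q']) (simp only: mult.assoc)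
  qed
qed

text \<open>The denominator \<open>q\<close> may have removable roots in the right half-plane. In the reduced fraction
  \<open>p' / q'\<close> the identity \<open>f * q' = p'\<close> extends by continuity to the closed half-plane, so a root of \<open>q'\<close>
  there would be a common root of \<open>p'\<close> and \<open>q'\<close>.\<close>

lemma reduced_fraction_stable:
  fixes f :: "complex \<Rightarrow> complex"
  assumes q: "q \<noteq> 0" and eq: "\<And>s. poly q s \<noteq> 0 \<Longrightarrow> f s = poly p s / poly q s"
    and analytic: "\<And>z. Re z \<ge> 0 \<Longrightarrow> f analytic_on {z}"
    and bound: "\<And>x::real. cmod (f (im_axis x)) \<le> M"
  shows "\<exists>p q. stable_fraction p q (\<lambda>s. poly p s / poly q s) \<and> (\<forall>s. Re s \<ge> 0 \<longrightarrow> f s = poly p s / poly q s)"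
proof -
  obtain d p' q' where red: "p = d * p'" "q = d * q'" "\<forall>s. poly p' s = 0 \<longrightarrow> poly q' s \<noteq> 0"
    using cancel_common_roots[OF q] by blast
  have dq: "d \<noteq> 0" "q' \<noteq> 0" using q red by auto
  have id: "f s * poly q' s = poly p' s" if s: "Re s \<ge> 0" for s
  proof -
    have cont: "isCont f s" by (rule analytic_at_imp_isCont[OF analytic[OF s]])
    then have "((\<lambda>z. f z * poly q' z - poly p' z) \<longlongrightarrow> f s * poly q' s - poly p' s) (at s)"
      by (intro tendsto_intros) (auto simp: isCont_def)
    moreover have "eventually (\<lambda>z. f z * poly q' z - poly p' z = 0) (at s)"
    proof -
      have fin: "finite {z. poly q z = 0}" by (rule poly_roots_finite[OF q])
      have "eventually (\<lambda>z. z \<notin> {z. poly q z = 0}) (at s)"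
        using islimpt_finite[OF fin, of s] unfolding islimpt_iff_eventually not_not .
      then show ?thesis
        by (rule eventually_mono) (simp add: eq red)
    qed
    then have "((\<lambda>z. f z * poly q' z - poly p' z) \<longlongrightarrow> 0) (at s)"
      by (rule tendsto_eventually)
    ultimately have "f s * poly q' s - poly p' s = 0" using tendsto_unique[OF trivial_limit_at] by blast
    then show ?thesis by simp
  qed
  have nz: "poly q' s \<noteq> 0" if s: "Re s \<ge> 0" for s
  proof
    assume 0: "poly q' s = 0"
    then have "poly p' s = 0" using id[OF s] by simp
    then show False using 0 red(3) by blast
  qed
  have feq: "f s = poly p' s / poly q' s" if "Re s \<ge> 0" for s using id[OF that] nz[OF that] by (simp add: field_simps)
  have "degree p' \<le> degree q'"
  proof (rule bounded_ratio_degree)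
    show "poly q' (im_axis x) \<noteq> 0" for x by (rule nz) simp
    show "cmod (poly p' (im_axis x) / poly q' (im_axis x)) \<le> M" for x
      using bound[of x] feq[of "im_axis x"] by simp
  qed
  then have "stable_fraction p' q' (\<lambda>s. poly p' s / poly q' s)" using nz unfolding stable_fraction_def by simp
  then show ?thesis using feq by blast
qed

lemma bounded_rational_stable:
  assumes rat: "rational_mat r c X"
    and analytic: "\<And>z i j. Re z \<ge> 0 \<Longrightarrow> i < r \<Longrightarrow> j < c \<Longrightarrow> (\<lambda>s. X s $$ (i, j)) analytic_on {z}"
    and bound: "\<And>(x::real) i j. i < r \<Longrightarrow> j < c \<Longrightarrow> cmod (X (im_axis x) $$ (i, j)) \<le> M"
  shows "\<exists>F. stable_entries r c F \<and> (\<forall>s. Re s \<ge> 0 \<longrightarrow> F s = X s)"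
proof -
  have car: "X s \<in> carrier_mat r c" for s using rat unfolding rational_mat_def by blast
  have ex: "\<exists>h. \<exists>p q. h = (p, q) \<and> stable_fraction p q (\<lambda>s. poly p s / poly q s) \<and>
      (\<forall>s. Re s \<ge> 0 \<longrightarrow> X s $$ (i, j) = poly p s / poly q s)" if ij: "i < r" "j < c" for i j
  proof -
    obtain p q where "q \<noteq> 0" and eq: "\<forall>s. poly q s \<noteq> 0 \<longrightarrow> X s $$ (i, j) = poly p s / poly q s"
      using rat ij unfolding rational_mat_def by blast
    from reduced_fraction_stable[OF this(1) eq[rule_format] analytic[OF _ ij] bound[OF ij]]
    show ?thesis by blast
  qed
  define h where "h i j = (SOME h. \<exists>p q. h = (p, q) \<and> stable_fraction p q (\<lambda>s. poly p s / poly q s) \<and>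
      (\<forall>s. Re s \<ge> 0 \<longrightarrow> X s $$ (i, j) = poly p s / poly q s))" for i j
  have h: "stable_fraction (fst (h i j)) (snd (h i j)) (\<lambda>s. poly (fst (h i j)) s / poly (snd (h i j)) s)"
      "\<forall>s. Re s \<ge> 0 \<longrightarrow> X s $$ (i, j) = poly (fst (h i j)) s / poly (snd (h i j)) s" if ij: "i < r" "j < c" for i j
    using someI_ex[OF ex[OF ij]] unfolding h_def[symmetric] by auto
  define F where "F s = mat r c (\<lambda>(i, j). poly (fst (h i j)) s / poly (snd (h i j)) s)" for s
  have "stable_entries r c F" unfolding stable_entries_def
  proof (intro conjI allI impI exI)
    show "F s \<in> carrier_mat r c" for s by (simp add: F_def)
    show "stable_fraction (fst (h i j)) (snd (h i j)) (\<lambda>s. F s $$ (i, j))" if "i < r" "j < c" for i j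
      using h(1)[OF that] that by (simp add: F_def)
  qed
  moreover have "F s = X s" if s: "Re s \<ge> 0" for s
  proof (rule eq_matI)
    fix i j assume "i < dim_row (X s)" "j < dim_col (X s)"
    then have ij: "i < r" "j < c" using car[of s] by auto
    then show "F s $$ (i, j) = X s $$ (i, j)" using h(2)[OF ij] s by (simp add: F_def)
  qed (use car[of s] in \<open>auto simp: F_def\<close>)
  ultimately show ?thesis by blast
qed

lemma contraction_adjoint_entry:
  assumes H: "H \<in> carrier_mat n ny"
    and contr: "\<And>u. u \<in> carrier_vec n \<Longrightarrow> sqnorm (H\<^sup>\<dagger> *\<^sub>v u) \<le> sqnorm u"
    and ij: "i < n" "j < ny"
  shows "cmod (H $$ (i, j)) \<le> 1"
proof -
  let ?u = "unit_vec n i :: complex vec"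
  have e: "(H\<^sup>\<dagger> *\<^sub>v ?u) $ j = cnj (H $$ (i, j))"
    using H ij by (subst mult_vec_sum) (auto simp: unit_vec_def if_distrib sum.If_cases cong: if_cong)
  have "(cmod ((H\<^sup>\<dagger> *\<^sub>v ?u) $ j))\<^sup>2 \<le> (\<Sum>k<dim_vec (H\<^sup>\<dagger> *\<^sub>v ?u). (cmod ((H\<^sup>\<dagger> *\<^sub>v ?u) $ k))\<^sup>2)"
    using H ij by (intro member_le_sum) auto
  also have "\<dots> = sqnorm (H\<^sup>\<dagger> *\<^sub>v ?u)" unfolding cscalar_self by simp
  also have "\<dots> \<le> sqnorm ?u" by (rule contr) simp
  also have "\<dots> = (\<Sum>k<n. (cmod (?u $ k))\<^sup>2)" unfolding cscalar_self by simp
  also have "\<dots> = (\<Sum>k<n. if k = i then 1 else 0)" using ij by (intro sum.cong) auto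
  also have "\<dots> = 1" using ij by simp
  finally have "(cmod (H $$ (i, j)))\<^sup>2 \<le> 1\<^sup>2" unfolding e by simp
  then show ?thesis by (rule power2_le_imp_le) simp
qed

text \<open>By convexity the scaled form is at most \<open>t g\<^sup>2 |u|\<^sup>2 + (1 - t) c |u|\<^sup>2\<close>, where \<open>c\<close> bounds the form of the
  constant block \<open>transpose_mat Su + 2 \<cdot>\<^sub>m 1\<^sub>m n\<close> and hence does not depend on the frequency.\<close>

lemma error_form_scale:
  fixes g g' :: real
  assumes Hc: "\<And>s. H s \<in> carrier_mat n ny"
    and Su: "Su \<in> carrier_mat n n" "hermitian Su" "pos_def Su" and Sw: "Sw \<in> carrier_mat nw nw" "hermitian Sw" "pos_def Sw"
    and power: "\<And>x u. u \<in> carrier_vec n \<Longrightarrow> u \<noteq> 0\<^sub>v n \<Longrightarrow> error_form (Phi n nw ny G Su Sw (im_axis x)) (H (im_axis x)) u < g\<^sup>2 * sqnorm u"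
    and g: "0 < g" "g < g'"
  shows "\<exists>t>0. t < 1 \<and> (\<forall>x u. u \<in> carrier_vec n \<longrightarrow> u \<noteq> 0\<^sub>v n \<longrightarrow> error_form (Phi n nw ny G Su Sw (im_axis x)) (complex_of_real t \<cdot>\<^sub>m H (im_axis x)) u < g'\<^sup>2 * sqnorm u)"
proof -
  let ?D = "transpose_mat Su + 2 \<cdot>\<^sub>m 1\<^sub>m n"
  have D: "?D \<in> carrier_mat n n" using Su(1) by auto
  obtain c where c: "c > 0" "\<forall>u \<in> carrier_vec n. qform ?D u \<le> c * sqnorm u"
    using form_bound[OF D] by blast
  have gg: "g\<^sup>2 < g'\<^sup>2" using g by (simp add: power_strict_mono)
  \<comment> \<open>Up to \<open>(g'\<^sup>2 - g\<^sup>2) / c\<close> the loss \<open>e * c\<close> fits into the gap; \<open>1/2\<close> keeps \<open>1 - e\<close> positive.\<close>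
  define e where "e = min (1/2) ((g'\<^sup>2 - g\<^sup>2) / c)"
  have e: "0 < e" "e < 1" "e * c \<le> g'\<^sup>2 - g\<^sup>2"
  proof -
    show "0 < e" "e < 1" using gg c(1) by (auto simp: e_def)
    have "e * c \<le> (g'\<^sup>2 - g\<^sup>2) / c * c" using c(1) by (intro mult_right_mono) (auto simp: e_def)
    then show "e * c \<le> g'\<^sup>2 - g\<^sup>2" using c(1) by simp
  qed
  have "error_form (Phi n nw ny G Su Sw (im_axis x)) (complex_of_real (1 - e) \<cdot>\<^sub>m H (im_axis x)) u < g'\<^sup>2 * sqnorm u"
    if u: "u \<in> carrier_vec n" "u \<noteq> 0\<^sub>v n" for x u
  proof -
    let ?s = "im_axis x"
    let ?y = "(H ?s)\<^sup>\<dagger> *\<^sub>v u" and ?N = "sqnorm u"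
    have y: "?y \<in> carrier_vec ny" using Hc[of ?s] by (auto intro!: carrier_vecI)
    have N: "?N > 0" using cscalar_self_pos[of u] u by simp
    have e1: "0 \<le> 1 - e" "1 - e \<le> 1" using e by auto
    have "(complex_of_real (1 - e) \<cdot>\<^sub>m H ?s)\<^sup>\<dagger> *\<^sub>v u = complex_of_real (1 - e) \<cdot>\<^sub>v ?y"
      using Hc[of ?s] u(1) by (simp add: adjoint_smult smult_mult_vec)
    then have "error_form (Phi n nw ny G Su Sw ?s) (complex_of_real (1 - e) \<cdot>\<^sub>m H ?s) u
        \<le> (1 - e) * qform (Phi n nw ny G Su Sw ?s) (?y @\<^sub>v u) + (1 - (1 - e)) * qform ?D u"
      using Phi_form_scale[OF Su Sw y u(1) e1] by simp
    also have "\<dots> < (1 - e) * (g\<^sup>2 * ?N) + e * (c * ?N)"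
    proof (rule add_less_le_mono)
      show "(1 - e) * qform (Phi n nw ny G Su Sw ?s) (?y @\<^sub>v u) < (1 - e) * (g\<^sup>2 * ?N)"
        using power[OF u, of x] e by simp
      show "(1 - (1 - e)) * qform ?D u \<le> e * (c * ?N)"
        using c(2) u(1) e by simp
    qed
    also have "\<dots> = ((1 - e) * g\<^sup>2 + e * c) * ?N" by (simp add: distrib_right)
    also have "\<dots> \<le> g'\<^sup>2 * ?N"
    proof (rule mult_right_mono)
      have "(1 - e) * g\<^sup>2 \<le> g\<^sup>2" using e by (simp add: mult_left_le_one_le)
      then show "(1 - e) * g\<^sup>2 + e * c \<le> g'\<^sup>2" using e(3) by linarith
    qed (use N in simp)
    finally show ?thesis .
  qed
  then show ?thesis using e by (intro exI[of _ "1 - e"]) auto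
qed

text \<open>Strictness at infinite frequency comes from the factor \<open>t\<close>: weak contractivity passes to the limit,
  strict contractivity need not.\<close>

lemma scaled_contraction:
  assumes H: "stable_entries n ny H"
    and contr: "\<And>x u. u \<in> carrier_vec n \<Longrightarrow> sqnorm ((H (im_axis x))\<^sup>\<dagger> *\<^sub>v u) \<le> sqnorm u"
    and t: "0 < t" "t < 1"
  shows "freq_value (\<lambda>s. complex_of_real t \<cdot>\<^sub>m H s) w * (freq_value (\<lambda>s. complex_of_real t \<cdot>\<^sub>m H s) w)\<^sup>\<dagger> \<prec> 1\<^sub>m n"
proof -
  obtain L where L: "mat_tendsto n ny (\<lambda>x. H (im_axis x)) L (axis_filter w)"
    by (rule stable_entries_axis_limit[OF H])
  have Lc: "L \<in> carrier_mat n ny" by (rule mat_tendsto_carrier(2)[OF L])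
  have fv: "freq_value (\<lambda>s. complex_of_real t \<cdot>\<^sub>m H s) w = complex_of_real t \<cdot>\<^sub>m L"
    by (rule freq_value_eq[OF mat_tendsto_smult[OF L]])
  show ?thesis unfolding fv contraction_iff[OF smult_carrier_mat[OF Lc]]
  proof (intro ballI impI)
    fix u :: "complex vec" assume u: "u \<in> carrier_vec n" "u \<noteq> 0\<^sub>v n"
    have "((\<lambda>x. sqnorm ((H (im_axis x))\<^sup>\<dagger> *\<^sub>v u))
        \<longlongrightarrow> sqnorm (L\<^sup>\<dagger> *\<^sub>v u)) (axis_filter w)"
      by (rule mat_tendsto_mult_vec[OF mat_tendsto_adjoint[OF L] u(1)])
    then have 1: "sqnorm (L\<^sup>\<dagger> *\<^sub>v u) \<le> sqnorm u"
      using tendsto_upperbound[OF _ always_eventually axis_filter_not_bot] contr[OF u(1)] by blast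
    have N: "sqnorm u > 0" using cscalar_self_pos[of u] u by simp
    have "(complex_of_real t \<cdot>\<^sub>m L)\<^sup>\<dagger> *\<^sub>v u = complex_of_real t \<cdot>\<^sub>v (L\<^sup>\<dagger> *\<^sub>v u)"
      using Lc u(1) by (simp add: adjoint_smult smult_mult_vec)
    then have "sqnorm ((complex_of_real t \<cdot>\<^sub>m L)\<^sup>\<dagger> *\<^sub>v u) =
        t\<^sup>2 * sqnorm (L\<^sup>\<dagger> *\<^sub>v u)"
      by (simp add: cscalar_smult_left cscalar_smult_right power2_eq_square)
    also have "\<dots> \<le> t\<^sup>2 * sqnorm u" using 1 by (intro mult_left_mono) auto
    also have "\<dots> < 1 * sqnorm u"
      using N t by (intro mult_strict_right_mono) (auto simp: power_less_one_iff)
    finally show "sqnorm ((complex_of_real t \<cdot>\<^sub>m L)\<^sup>\<dagger> *\<^sub>v u) < sqnorm u" by simp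
  qed
qed

lemma unitary_corner_contraction:
  assumes H: "H \<in> carrier_mat nf nf" "H * H\<^sup>\<dagger> = 1\<^sub>m nf" and nf: "n \<le> nf" "ny \<le> nf"
    and u: "u \<in> carrier_vec n"
  defines "K \<equiv> mat n ny (\<lambda>(i, j). H $$ (i, j))"
  shows "sqnorm (K\<^sup>\<dagger> *\<^sub>v u) \<le> sqnorm u"
proof -
  define v where "v = vec nf (\<lambda>i. if i < n then u $ i else 0)"
  have v: "v \<in> carrier_vec nf" by (simp add: v_def)
  let ?w = "H\<^sup>\<dagger> *\<^sub>v v"
  have K: "K \<in> carrier_mat n ny" by (simp add: K_def)
  have e: "(K\<^sup>\<dagger> *\<^sub>v u) $ j = ?w $ j" if j: "j < ny" for j
  proof -
    have "?w $ j = (\<Sum>i<nf. cnj (H $$ (i, j)) * v $ i)"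
      using H(1) j nf v by (subst mult_vec_sum) auto
    also have "\<dots> = (\<Sum>i<n. cnj (H $$ (i, j)) * u $ i)"
      using nf by (intro sum.mono_neutral_cong_right) (auto simp: v_def)
    also have "\<dots> = (K\<^sup>\<dagger> *\<^sub>v u) $ j"
      using K j u by (subst mult_vec_sum) (auto simp: K_def)
    finally show ?thesis ..
  qed
  have "sqnorm (K\<^sup>\<dagger> *\<^sub>v u) = (\<Sum>j<ny. (cmod (?w $ j))\<^sup>2)"
    unfolding cscalar_self using K e by simp
  also have "\<dots> \<le> (\<Sum>j<nf. (cmod (?w $ j))\<^sup>2)" using nf by (intro sum_mono2) auto
  also have "\<dots> = sqnorm ?w" unfolding cscalar_self using H(1) by simp
  also have "\<dots> = qform (H * H\<^sup>\<dagger>) v" using qform_gram[OF adjoint_carrier[OF H(1)] v] by simp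
  also have "\<dots> = sqnorm v" unfolding H(2) using v by (simp add: qform_one)
  also have "\<dots> = (\<Sum>i<nf. if i < n then (cmod (u $ i))\<^sup>2 else 0)"
  proof -
    have "(\<Sum>i<nf. (cmod (v $ i))\<^sup>2) = (\<Sum>i<nf. if i < n then (cmod (u $ i))\<^sup>2 else 0)"
      by (intro sum.cong) (auto simp: v_def)
    then show ?thesis unfolding cscalar_self using v by simp
  qed
  also have "\<dots> = (\<Sum>i<n. (cmod (u $ i))\<^sup>2)"
    using nf by (intro sum.mono_neutral_cong_right) auto
  also have "\<dots> = sqnorm u" unfolding cscalar_self using u by simp
  finally show ?thesis .
qed

text \<open>The corner of a paraunitary matrix is weakly contractive on the axis. Scaling it by \<open>t < 1\<close> makes it
  strictly contractive at the price of an arbitrarily small increase of the bound.\<close>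

lemma gamma_opt''_le_gamma_opt:
  assumes Su: "Su \<in> carrier_mat n n" "hermitian Su" "pos_def Su" and Sw: "Sw \<in> carrier_mat nw nw" "hermitian Sw" "pos_def Sw"
  shows "gamma_opt'' n nw ny G Su Sw \<le> gamma_opt n nw ny G Su Sw"
  unfolding gamma_opt_def
proof (rule Inf_greatest)
  fix \<gamma>' assume "\<gamma>' \<in> ereal ` {\<gamma>. \<gamma> > 0 \<and> (\<exists>H \<in> admissible_equalizers n ny. \<forall>\<omega>::real.
        P_e n nw ny G Su Sw (top_left n ny H) (\<i> * of_real \<omega>) \<prec> complex_of_real (\<gamma>\<^sup>2) \<cdot>\<^sub>m 1\<^sub>m n)}"
  then obtain g H where gH: "\<gamma>' = ereal g" "g > 0" "H \<in> admissible_equalizers n ny"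
    "\<And>\<omega>::real. P_e n nw ny G Su Sw (top_left n ny H) (\<i> * of_real \<omega>) \<prec> complex_of_real (g\<^sup>2) \<cdot>\<^sub>m 1\<^sub>m n"
    by auto
  obtain nz nf where nf: "nf = ny + nz" "n \<le> nf" and rat: "rational_mat nf nf H"
    and an: "\<exists>\<tau>>0. analytic_mat H {s. Re s > - \<tau>}"
    and uni: "(\<lambda>s. H s * H\<^sup>H s) \<doteq> (\<lambda>s. 1\<^sub>m nf)"
    using gH(3) unfolding admissible_equalizers_def by blast
  have Hc: "H s \<in> carrier_mat nf nf" for s using rat unfolding rational_mat_def by blast
  have Han: "(\<lambda>s. H s $$ (i, j)) analytic_on {z}" if z: "Re z \<ge> 0" and ij: "i < nf" "j < nf" for z i j
  proof -
    obtain \<tau> where "\<tau> > 0" "analytic_mat H {s. Re s > - \<tau>}" using an by blast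
    then have "(\<lambda>s. H s $$ (i, j)) analytic_on {s. Re s > - \<tau>}"
      using ij Hc[of 0] unfolding analytic_mat_def by auto
    then show ?thesis by (rule analytic_on_subset) (use z \<open>\<tau> > 0\<close> in auto)
  qed
  have unit: "H (im_axis w) * (H (im_axis w))\<^sup>\<dagger> = 1\<^sub>m nf" for w
  proof (rule mat_tendsto_unique[where F = "at w"])
    have "mat_tendsto nf nf (\<lambda>x. H (im_axis x)) (H (im_axis w)) (at w)"
    proof (rule mat_tendstoI)
      fix i j assume ij: "i < nf" "j < nf"
      have "Re (im_axis w) \<ge> 0" by simp
      from analytic_at_imp_isCont[OF Han[OF this ij]]
      show "((\<lambda>x. H (im_axis x) $$ (i, j)) \<longlongrightarrow> H (im_axis w) $$ (i, j)) (at w)"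
        by (rule isCont_tendsto_compose) (intro tendsto_intros)
    qed (simp_all add: carrier_matD[OF Hc])
    then show "mat_tendsto nf nf (\<lambda>x. H (im_axis x) * (H (im_axis x))\<^sup>\<dagger>)
        (H (im_axis w) * (H (im_axis w))\<^sup>\<dagger>) (at w)"
      by (intro mat_tendsto_mult mat_tendsto_adjoint)
    show "mat_tendsto nf nf (\<lambda>x. 1\<^sub>m nf) (1\<^sub>m nf) (at w)" by (rule mat_tendsto_const) simp
    show "eventually (\<lambda>x. H (im_axis x) * (H (im_axis x))\<^sup>\<dagger> = 1\<^sub>m nf) (at w)"
      by (rule eventually_mono[OF finite_eventually_at[OF tf_eq_axis[OF uni]]]) (simp add: para_conj_axis)
  qed simp
  let ?T = "top_left n ny H"
  have Tc: "?T s \<in> carrier_mat n ny" for s by (simp add: top_left_def)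
  have Tentry: "(\<lambda>s. ?T s $$ (i, j)) = (\<lambda>s. H s $$ (i, j))" if "i < n" "j < ny" for i j
    using that by (simp add: top_left_def)
  have contr: "sqnorm ((?T (im_axis x))\<^sup>\<dagger> *\<^sub>v u) \<le> sqnorm u"
    if "u \<in> carrier_vec n" for x u
    unfolding top_left_def by (rule unitary_corner_contraction[OF Hc unit]) (use nf that in auto)
  have "\<exists>F. stable_entries n ny F \<and> (\<forall>s. Re s \<ge> 0 \<longrightarrow> F s = ?T s)"
  proof (rule bounded_rational_stable[where M = 1])
    show "rational_mat n ny ?T"
      unfolding rational_mat_def
    proof (intro conjI allI impI)
      show "?T s \<in> carrier_mat n ny" for s by (rule Tc)
      fix i j assume ij: "i < n" "j < ny"
      then have "i < nf" "j < nf" using nf by auto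
      then show "\<exists>p q. q \<noteq> 0 \<and> (\<forall>s. poly q s \<noteq> 0 \<longrightarrow> ?T s $$ (i, j) = poly p s / poly q s)"
        using rat ij unfolding rational_mat_def top_left_def by simp
    qed
    show "(\<lambda>s. ?T s $$ (i, j)) analytic_on {z}" if "Re z \<ge> 0" "i < n" "j < ny" for z i j
      unfolding Tentry[OF that(2,3)] by (rule Han) (use that nf in auto)
    show "cmod (?T (im_axis x) $$ (i, j)) \<le> 1" if "i < n" "j < ny" for x i j
      by (rule contraction_adjoint_entry[OF Tc contr that])
  qed
  then obtain F where F: "stable_entries n ny F" "\<forall>s. Re s \<ge> 0 \<longrightarrow> F s = ?T s" by blast
  have FT: "F (im_axis x) = ?T (im_axis x)" for x using F(2) by simp
  note P = P_e_axis[of ?T, OF Tc Su(1,2) Sw(1,2)]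
  have power: "error_form (Phi n nw ny G Su Sw (im_axis x)) (F (im_axis x)) u < g\<^sup>2 * sqnorm u"
    if "u \<in> carrier_vec n" "u \<noteq> 0\<^sub>v n" for x u
    using gH(4)[of x] that unfolding FT mat_less_scalar_iff[OF P(1,2)] P(3)[OF that(1), symmetric] by blast
  show "gamma_opt'' n nw ny G Su Sw \<le> \<gamma>'"
    unfolding gH(1)
  proof (rule ereal_le_epsilon2)
    fix e :: real assume e: "0 < e"
    obtain t where t: "t > 0" "t < 1" and pw: "\<forall>x u. u \<in> carrier_vec n \<longrightarrow> u \<noteq> 0\<^sub>v n \<longrightarrow> error_form (Phi n nw ny G Su Sw (im_axis x)) (complex_of_real t \<cdot>\<^sub>m F (im_axis x)) u < (g + e)\<^sup>2 * sqnorm u"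
      using error_form_scale[OF stable_entries_carrier[OF F(1)] Su Sw power gH(2), of "g + e"] e by auto
    have "(\<lambda>s. complex_of_real t \<cdot>\<^sub>m F s) \<in> H11_minus n nw ny G Su Sw (g + e)"
    proof (rule H11_minusI[OF stable_entries_smult[OF F(1)] Su(1,2) Sw(1,2)])
      show "error_form (Phi n nw ny G Su Sw (im_axis x)) (complex_of_real t \<cdot>\<^sub>m F (im_axis x)) u < (g + e)\<^sup>2 * sqnorm u"
        if "u \<in> carrier_vec n" "u \<noteq> 0\<^sub>v n" for x u using pw that by blast
      show "freq_value (\<lambda>s. complex_of_real t \<cdot>\<^sub>m F s) w * (freq_value (\<lambda>s. complex_of_real t \<cdot>\<^sub>m F s) w)\<^sup>\<dagger> \<prec> 1\<^sub>m n" for w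
        by (rule scaled_contraction[OF F(1) _ t]) (unfold FT, rule contr)
    qed
    then have "gamma_opt'' n nw ny G Su Sw \<le> ereal (g + e)"
      unfolding gamma_opt''_def using gH(2) e by (intro Inf_lower) (auto intro!: imageI)
    then show "gamma_opt'' n nw ny G Su Sw \<le> ereal g + ereal e" by simp
  qed
qed

section \<open>Sums of squares on the circle\<close>

text \<open>Cholesky factorization: the Schur complement of the last diagonal entry is positive definite again.\<close>

lemma pos_def_factor:
  fixes R :: "nat \<Rightarrow> nat \<Rightarrow> complex"
  assumes herm: "\<And>i j. i < n \<Longrightarrow> j < n \<Longrightarrow> R j i = cnj (R i j)"
    and pos: "\<And>x. (\<exists>i<n. x i \<noteq> 0) \<Longrightarrow> Re (\<Sum>i<n. \<Sum>j<n. cnj (x i) * R i j * x j) > 0"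
  shows "\<exists>S. \<forall>i<n. \<forall>j<n. (\<Sum>r<n. cnj (S r i) * S r j) = R i j"
  using assms
proof (induction n arbitrary: R)
  case 0
  then show ?case by simp
next
  case (Suc n)
  define a where "a = Re (R n n)"
  have Rnn: "R n n = complex_of_real a"
    using Suc.prems(1)[of n n] unfolding a_def by (simp add: complex_eq_iff)
  have a: "a > 0"
  proof -
    define e where "e i = (if i = n then 1 else 0 :: complex)" for i
    have "(\<Sum>i<Suc n. \<Sum>j<Suc n. cnj (e i) * R i j * e j) = R n n"
      by (simp add: e_def)
    moreover have "\<exists>i<Suc n. e i \<noteq> 0" by (intro exI[of _ n]) (simp add: e_def)
    ultimately show ?thesis using Suc.prems(2)[of e] unfolding a_def by simp
  qed
  define R' where "R' i j = R i j - R i n * R n j / complex_of_real a" for i j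
  have herm': "R' j i = cnj (R' i j)" if "i < n" "j < n" for i j
    using Suc.prems(1)[of i j] Suc.prems(1)[of i n] Suc.prems(1)[of n j] that unfolding R'_def by simp
  have pos': "Re (\<Sum>i<n. \<Sum>j<n. cnj (x i) * R' i j * x j) > 0" if x: "\<exists>i<n. x i \<noteq> 0" for x
  proof -
    define c where "c = (\<Sum>j<n. R n j * x j)"
    have c': "cnj c = (\<Sum>i<n. cnj (x i) * R i n)"
      unfolding c_def cnj_sum
    proof (intro sum.cong refl)
      fix i assume "i \<in> {..<n}"
      then have "R i n = cnj (R n i)" using Suc.prems(1)[of n i] by simp
      then show "cnj (R n i * x i) = cnj (x i) * R i n" by (simp only: complex_cnj_mult mult.commute)
    qed
    \<comment> \<open>The last coordinate is chosen to minimize the form.\<close>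
    define y where "y i = (if i = n then - c / complex_of_real a else x i)" for i
    define T where "T = (\<Sum>i<n. \<Sum>j<n. cnj (x i) * R i j * x j)"
    have "(\<Sum>i<Suc n. \<Sum>j<Suc n. cnj (y i) * R i j * y j) =
        (\<Sum>i<n. (\<Sum>j<n. cnj (x i) * R i j * x j) + cnj (x i) * R i n * y n) +
        ((\<Sum>j<n. cnj (y n) * R n j * x j) + cnj (y n) * R n n * y n)"
      by (simp add: y_def)
    also have "\<dots> = T + cnj c * y n + (cnj (y n) * c + cnj (y n) * R n n * y n)"
      unfolding T_def c' unfolding c_def by (simp add: sum.distrib sum_distrib_left sum_distrib_right mult.assoc)
    also have "\<dots> = T - cnj c * c / complex_of_real a"
      using a unfolding y_def Rnn by (simp add: field_simps)
    also have "cnj c * c / complex_of_real a = (\<Sum>i<n. \<Sum>j<n. cnj (x i) * (R i n * R n j / complex_of_real a) * x j)"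
      unfolding c' unfolding c_def by (simp add: sum_product sum_divide_distrib mult.assoc)
    also have "T - \<dots> = (\<Sum>i<n. \<Sum>j<n. cnj (x i) * R' i j * x j)"
      unfolding T_def R'_def by (simp add: sum_subtractf[symmetric] algebra_simps)
    finally have "(\<Sum>i<Suc n. \<Sum>j<Suc n. cnj (y i) * R i j * y j) = (\<Sum>i<n. \<Sum>j<n. cnj (x i) * R' i j * x j)" .
    moreover have "\<exists>i<Suc n. y i \<noteq> 0"
    proof -
      obtain i where "i < n" "x i \<noteq> 0" using x by blast
      then show ?thesis by (intro exI[of _ i]) (simp add: y_def)
    qed
    ultimately show ?thesis using Suc.prems(2)[of y] by simp
  qed
  obtain S where S: "\<forall>i<n. \<forall>j<n. (\<Sum>r<n. cnj (S r i) * S r j) = R' i j"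
    using Suc.IH[OF herm' pos'] by blast
  define S' where "S' r i = (if r = n then R n i / complex_of_real (sqrt a) else if i = n then 0 else S r i)" for r i
  have sq: "complex_of_real (sqrt a) * complex_of_real (sqrt a) = complex_of_real a"
    using a by (simp flip: of_real_mult)
  have "(\<Sum>r<Suc n. cnj (S' r i) * S' r j) = R i j" if ij: "i < Suc n" "j < Suc n" for i j
  proof -
    have last: "cnj (S' n i) * S' n j = R i n * R n j / complex_of_real a"
      using Suc.prems(1)[of n i] ij unfolding S'_def sq[symmetric] by simp
    show ?thesis
    proof (cases "i = n \<or> j = n")
      case True
      then have "(\<Sum>r<n. cnj (S' r i) * S' r j) = 0" by (intro sum.neutral) (auto simp: S'_def)
      then show ?thesis using last True a by (auto simp: Rnn)
    next
      case False
      then have "(\<Sum>r<n. cnj (S' r i) * S' r j) = R' i j" using S ij by (simp add: S'_def)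
      then show ?thesis using last by (simp add: R'_def)
    qed
  qed
  then show ?case by blast
qed

lemma roots_of_unity_orthogonal:
  assumes "p < M" "q < M"
  defines "\<zeta> \<equiv> \<lambda>t::nat. cis (2 * pi * real t / real M)"
  shows "(\<Sum>t<M. \<zeta> t ^ p * cnj (\<zeta> t) ^ q) = (if p = q then of_nat M else 0)"
proof -
  have M: "M > 0" using assms by simp
  define w where "w = \<zeta> p * cnj (\<zeta> q)"
  have pow: "\<zeta> t ^ p * cnj (\<zeta> t) ^ q = w ^ t" for t
  proof -
    have e: "real p * (2 * pi * real t / real M) = real t * (2 * pi * real p / real M)" for p by simp
    have "\<zeta> t ^ p = \<zeta> p ^ t" "\<zeta> t ^ q = \<zeta> q ^ t" unfolding \<zeta>_def Complex.DeMoivre e[of p] e[of q] by (rule refl)+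
    then show ?thesis unfolding w_def power_mult_distrib by (metis complex_cnj_power)
  qed
  have norm: "\<zeta> q * cnj (\<zeta> q) = 1" unfolding \<zeta>_def by (simp add: complex_norm_square[symmetric])
  have wM: "w ^ M = 1"
  proof -
    have "\<zeta> t ^ M = 1" for t
    proof -
      have "real M * (2 * pi * real t / real M) = 2 * pi * real t" using M by simp
      then show ?thesis unfolding \<zeta>_def Complex.DeMoivre by (simp only: cis_multiple_2pi Ints_of_nat)
    qed
    then show ?thesis unfolding w_def power_mult_distrib by (simp flip: complex_cnj_power)
  qed
  show ?thesis
  proof (cases "p = q")
    case True
    then have "w = 1" using norm by (simp add: w_def)
    then show ?thesis using True pow by simp
  next
    case False
    have "w \<noteq> 1"
    proof
      assume "w = 1"
      then have "\<zeta> p = \<zeta> q" using norm unfolding w_def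
        by (metis (no_types) mult.assoc mult.commute mult_1_right)
      moreover have "inj_on \<zeta> {..<M}"
        using Complex.bij_betw_roots_unity[OF M] unfolding \<zeta>_def bij_betw_def by (simp add: mult.commute)
      ultimately show False using False assms(1,2) by (auto dest: inj_onD)
    qed
    then have "(\<Sum>t<M. w ^ t) = 0" using wM by (simp add: geometric_sum)
    then show ?thesis using False pow by simp
  qed
qed

text \<open>For \<open>w\<close> on the unit circle, the coefficient of \<open>w ^ (a - b)\<close> in the squared modulus of
  \<open>\<Sum>j<L. w ^ j\<close>: an unnormalized Fejer kernel. Its value is \<open>L - \<bar>a - b\<bar>\<close> when that is nonnegative.\<close>

definition shift_count :: "nat \<Rightarrow> nat \<Rightarrow> nat \<Rightarrow> nat" where
  "shift_count L a b = card {(j, k). j < L \<and> k < L \<and> b + j = a + k}"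

lemma shift_count_bounds:
  assumes "a < e" "b < e"
  shows "shift_count L a b \<le> L" "L \<le> shift_count L a b + 2 * e"
proof -
  let ?S = "{(j, k). j < L \<and> k < L \<and> b + j = a + k}"
  have fin: "finite ?S" by (rule finite_subset[of _ "{..<L} \<times> {..<L}"]) auto
  have "card ?S = card (fst ` ?S)" by (rule card_image[symmetric]) (auto simp: inj_on_def)
  also have "\<dots> \<le> card {..<L}" by (rule card_mono) auto
  finally show "shift_count L a b \<le> L" by (simp add: shift_count_def)
  have "(\<lambda>j. (j, b + j - a)) ` {a..<L - b} \<subseteq> ?S" by auto
  then have "card ((\<lambda>j. (j, b + j - a)) ` {a..<L - b}) \<le> card ?S" using fin by (rule card_mono[rotated])
  moreover have "card ((\<lambda>j. (j, b + j - a)) ` {a..<L - b}) = L - b - a"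
    by (subst card_image) (auto simp: inj_on_def)
  ultimately show "L \<le> shift_count L a b + 2 * e" using assms unfolding shift_count_def by simp
qed

lemma shift_sum:
  fixes z :: complex
  assumes "z \<noteq> 0"
  shows "(\<Sum>j<L. \<Sum>k<L. if b + j = a + k then z ^ k * inverse z ^ j else 0) =
    of_nat (shift_count L a b) * (z ^ b * inverse z ^ a)"
proof -
  let ?S = "{(j, k). j < L \<and> k < L \<and> b + j = a + k}"
  have "(\<Sum>j<L. \<Sum>k<L. if b + j = a + k then z ^ k * inverse z ^ j else 0) =
      (\<Sum>(j, k)\<in>{..<L} \<times> {..<L}. if b + j = a + k then z ^ k * inverse z ^ j else 0)"
    by (rule sum.cartesian_product)
  also have "\<dots> = (\<Sum>(j, k)\<in>?S. z ^ k * inverse z ^ j)"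
    by (rule sum.mono_neutral_cong_right) (auto split: if_splits)
  also have "\<dots> = (\<Sum>(j, k)\<in>?S. z ^ b * inverse z ^ a)"
  proof (rule sum.cong[OF refl], clarify)
    fix j k assume "b + j = a + k"
    then have "z ^ (b + j) = z ^ (a + k)" by (rule arg_cong)
    then have "z ^ b * z ^ j = z ^ a * z ^ k" unfolding power_add .
    moreover have "z ^ a \<noteq> 0" "z ^ j \<noteq> 0" using assms by auto
    ultimately show "z ^ k * inverse z ^ j = z ^ b * inverse z ^ a"
      unfolding power_inverse by (simp add: field_simps)
  qed
  also have "\<dots> = of_nat (shift_count L a b) * (z ^ b * inverse z ^ a)"
    unfolding shift_count_def by (simp add: case_prod_unfold)
  finally show ?thesis .
qed

text \<open>Dividing the coefficients by \<open>shift_count\<close> undoes the convolution with the Fejer kernel, and the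
  average over the \<open>M\<close>-th roots of unity computes this convolution exactly, since all frequencies
  that occur are smaller than \<open>M\<close>.\<close>

lemma fejer_quadrature:
  fixes \<Theta> :: "nat \<Rightarrow> nat \<Rightarrow> complex" and z :: complex
  assumes z: "z \<noteq> 0" and e: "e + L \<le> M" "2 * e < L"
  defines "\<zeta> \<equiv> (\<lambda>t::nat. cis (2 * pi * real t / real M))"
  shows "(\<Sum>t<M. (\<Sum>a<e. \<Sum>b<e. \<Theta> a b / of_nat (shift_count L a b) * \<zeta> t ^ b * cnj (\<zeta> t) ^ a) *
      ((\<Sum>j<L. (\<zeta> t * inverse z) ^ j) * (\<Sum>k<L. (cnj (\<zeta> t) * z) ^ k))) =
    of_nat M * (\<Sum>a<e. \<Sum>b<e. \<Theta> a b * z ^ b * inverse z ^ a)"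
proof -
  define J where "J t = (\<Sum>j<L. (\<zeta> t * inverse z) ^ j)" for t
  define K where "K t = (\<Sum>k<L. (cnj (\<zeta> t) * z) ^ k)" for t
  have "(\<Sum>t<M. (\<Sum>a<e. \<Sum>b<e. \<Theta> a b / of_nat (shift_count L a b) * \<zeta> t ^ b * cnj (\<zeta> t) ^ a) * (J t * K t))
    = (\<Sum>t<M. \<Sum>a<e. \<Sum>b<e. \<Theta> a b / of_nat (shift_count L a b) * \<zeta> t ^ b * cnj (\<zeta> t) ^ a * (J t * K t))"
    by (simp only: sum_distrib_right)
  also have "\<dots> = (\<Sum>t<M. \<Sum>a<e. \<Sum>b<e. \<Sum>j<L. \<Sum>k<L. \<Theta> a b / of_nat (shift_count L a b) * (z ^ k * inverse z ^ j) *
        (\<zeta> t ^ (b + j) * cnj (\<zeta> t) ^ (a + k)))"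
  proof (intro sum.cong refl)
    fix t a b
    show "\<Theta> a b / of_nat (shift_count L a b) * \<zeta> t ^ b * cnj (\<zeta> t) ^ a * (J t * K t) =
      (\<Sum>j<L. \<Sum>k<L. \<Theta> a b / of_nat (shift_count L a b) * (z ^ k * inverse z ^ j) *
        (\<zeta> t ^ (b + j) * cnj (\<zeta> t) ^ (a + k)))"
      unfolding J_def K_def sum_product unfolding sum_distrib_left
      by (intro sum.cong refl) (simp add: power_mult_distrib power_add mult_ac)
  qed
  also have "\<dots> = (\<Sum>a<e. \<Sum>b<e. \<Sum>j<L. \<Sum>k<L. \<Sum>t<M. \<Theta> a b / of_nat (shift_count L a b) * (z ^ k * inverse z ^ j) *
        (\<zeta> t ^ (b + j) * cnj (\<zeta> t) ^ (a + k)))"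
    by (simp only: sum.swap[of _ "{..<M}"])
  also have "\<dots> = (\<Sum>a<e. \<Sum>b<e. \<Sum>j<L. \<Sum>k<L. \<Theta> a b / of_nat (shift_count L a b) *
        (of_nat M * (if b + j = a + k then z ^ k * inverse z ^ j else 0)))"
  proof (intro sum.cong refl)
    fix a b j k assume "a \<in> {..<e}" "b \<in> {..<e}" "j \<in> {..<L}" "k \<in> {..<L}"
    then have "b + j < M" "a + k < M" using e by auto
    from roots_of_unity_orthogonal[OF this]
    have h: "(\<Sum>t<M. \<zeta> t ^ (b + j) * cnj (\<zeta> t) ^ (a + k)) = (if b + j = a + k then of_nat M else 0)"
      unfolding \<zeta>_def .
    show "(\<Sum>t<M. \<Theta> a b / of_nat (shift_count L a b) * (z ^ k * inverse z ^ j) * (\<zeta> t ^ (b + j) * cnj (\<zeta> t) ^ (a + k)))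
      = \<Theta> a b / of_nat (shift_count L a b) * (of_nat M * (if b + j = a + k then z ^ k * inverse z ^ j else 0))"
      unfolding sum_distrib_left[symmetric] h by simp
  qed
  also have "\<dots> = (\<Sum>a<e. \<Sum>b<e. \<Theta> a b / of_nat (shift_count L a b) *
        (of_nat M * (of_nat (shift_count L a b) * (z ^ b * inverse z ^ a))))"
    by (simp only: shift_sum[OF z, symmetric] sum_distrib_left)
  also have "\<dots> = (\<Sum>a<e. \<Sum>b<e. of_nat M * (\<Theta> a b * z ^ b * inverse z ^ a))"
  proof (intro sum.cong refl)
    fix a b assume "a \<in> {..<e}" "b \<in> {..<e}"
    then have "shift_count L a b \<noteq> 0" using shift_count_bounds(2)[of a e b L] e by auto
    then show "\<Theta> a b / of_nat (shift_count L a b) * (of_nat M * (of_nat (shift_count L a b) * (z ^ b * inverse z ^ a)))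
      = of_nat M * (\<Theta> a b * z ^ b * inverse z ^ a)" by simp
  qed
  finally show ?thesis unfolding J_def K_def by (simp only: sum_distrib_left)
qed

text \<open>On the unit circle this is the conjugate of \<open>poly p z\<close>; as a function of \<open>z\<close> it is rational.\<close>

definition refl_eval :: "complex poly \<Rightarrow> complex \<Rightarrow> complex" where
  "refl_eval p z = cnj (poly p (inverse (cnj z)))"

lemma poly_eval_sum: "degree p < e \<Longrightarrow> poly p (z::complex) = (\<Sum>b<e. coeff p b * z ^ b)"
  unfolding poly_altdef by (intro sum.mono_neutral_left) (auto simp: coeff_eq_0)

lemma refl_eval_sum: "degree p < e \<Longrightarrow> refl_eval p z = (\<Sum>a<e. cnj (coeff p a) * inverse z ^ a)"
  unfolding refl_eval_def by (simp add: poly_eval_sum)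

text \<open>As \<open>L\<close> grows, \<open>L / shift_count L a b\<close> tends to 1 for all relevant \<open>a\<close> and \<open>b\<close>, so the form
  of \<open>L\<close> times the reweighted matrix differs from the original form by less than \<open>\<delta>\<close> on unit vectors, with
  the same \<open>L\<close> for all \<open>z\<close>.\<close>

lemma fejer_weights_positive:
  fixes \<Theta> :: "nat \<Rightarrow> nat \<Rightarrow> nat \<Rightarrow> nat \<Rightarrow> complex"
  assumes d: "\<delta> > 0"
  shows "\<exists>L. 2 * e < L \<and> (\<forall>z x. cmod z = 1 \<longrightarrow>
     Re (\<Sum>i<n. \<Sum>l<n. cnj (x i) * (\<Sum>a<e. \<Sum>b<e. \<Theta> i l a b * z ^ b * cnj z ^ a) * x l) \<ge> \<delta> * (\<Sum>i<n. (cmod (x i))\<^sup>2) \<longrightarrow>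
     (\<exists>i<n. x i \<noteq> 0) \<longrightarrow>
     Re (\<Sum>i<n. \<Sum>l<n. cnj (x i) * (\<Sum>a<e. \<Sum>b<e. \<Theta> i l a b / of_nat (shift_count L a b) * z ^ b * cnj z ^ a) * x l) > 0)"
proof -
  define C where "C = (\<Sum>i<n. \<Sum>l<n. \<Sum>a<e. \<Sum>b<e. cmod (\<Theta> i l a b))"
  have C: "C \<ge> 0" unfolding C_def by (intro sum_nonneg) auto
  obtain N :: nat where N: "real N > 2 * real e * C / \<delta>" using reals_Archimedean2 by blast
  define L where "L = 2 * e + N + 1"
  have L: "2 * e < L" by (simp add: L_def)
  have small: "2 * real e / real (L - 2 * e) * C < \<delta>"
  proof -
    have "2 * real e * C < \<delta> * real N" using N d by (simp add: pos_divide_less_eq mult.commute)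
    also have "\<dots> \<le> \<delta> * real (L - 2 * e)" using d by (simp add: L_def)
    finally show ?thesis using L by (simp add: field_simps)
  qed
  have "Re (\<Sum>i<n. \<Sum>l<n. cnj (x i) * (\<Sum>a<e. \<Sum>b<e. \<Theta> i l a b / of_nat (shift_count L a b) * z ^ b * cnj z ^ a) * x l) > 0"
    if z: "cmod z = 1" and pos: "Re (\<Sum>i<n. \<Sum>l<n. cnj (x i) * (\<Sum>a<e. \<Sum>b<e. \<Theta> i l a b * z ^ b * cnj z ^ a) * x l) \<ge> \<delta> * (\<Sum>i<n. (cmod (x i))\<^sup>2)"
      and x: "\<exists>i<n. x i \<noteq> 0" for z x
  proof -
    define X where "X = (\<Sum>i<n. (cmod (x i))\<^sup>2)"
    have X: "X > 0" using x unfolding X_def by (auto intro!: sum_pos2)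
    define P where "P = (\<Sum>i<n. \<Sum>l<n. cnj (x i) * (\<Sum>a<e. \<Sum>b<e. \<Theta> i l a b * z ^ b * cnj z ^ a) * x l)"
    define W where "W = (\<Sum>i<n. \<Sum>l<n. cnj (x i) * (\<Sum>a<e. \<Sum>b<e. \<Theta> i l a b / of_nat (shift_count L a b) * z ^ b * cnj z ^ a) * x l)"
    define k where "k a b = real L / real (shift_count L a b) - 1" for a b
    have kb: "0 \<le> k a b \<and> k a b \<le> 2 * real e / real (L - 2 * e)" if "a < e" "b < e" for a b
    proof -
      let ?c = "shift_count L a b"
      note b = shift_count_bounds[OF that, of L]
      have c: "?c \<ge> L - 2 * e" "?c > 0" using b L by auto
      have "k a b = (real L - real ?c) / real ?c" using c by (simp add: k_def field_simps)
      moreover have "(real L - real ?c) / real ?c \<le> (2 * real e) / real (L - 2 * e)"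
        by (rule frac_le) (use b c L in auto)
      ultimately show ?thesis using b c by simp
    qed
    have diff: "of_nat L * W - P = (\<Sum>i<n. \<Sum>l<n. \<Sum>a<e. \<Sum>b<e. complex_of_real (k a b) * (cnj (x i) * \<Theta> i l a b * z ^ b * cnj z ^ a * x l))"
      unfolding W_def P_def
      unfolding sum_distrib_left sum_distrib_right
      unfolding sum_subtractf[symmetric]
    proof (intro sum.cong refl)
      fix i l a b
      show "of_nat L * (cnj (x i) * (\<Theta> i l a b / of_nat (shift_count L a b) * z ^ b * cnj z ^ a) * x l)
          - cnj (x i) * (\<Theta> i l a b * z ^ b * cnj z ^ a) * x l
        = complex_of_real (k a b) * (cnj (x i) * \<Theta> i l a b * z ^ b * cnj z ^ a * x l)"
        unfolding k_def by (simp add: left_diff_distrib right_diff_distrib mult_ac divide_inverse)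
    qed
    have "cmod (of_nat L * W - P) \<le> (\<Sum>i<n. \<Sum>l<n. \<Sum>a<e. \<Sum>b<e. 2 * real e / real (L - 2 * e) * X * cmod (\<Theta> i l a b))"
      unfolding diff
    proof (intro sum_norm_le)
      fix i l a b assume "i \<in> {..<n}" "l \<in> {..<n}" "a \<in> {..<e}" "b \<in> {..<e}"
      then have m: "i < n" "l < n" "a < e" "b < e" by auto
      have sqX: "(cmod (x i))\<^sup>2 \<le> X" if "i < n" for i unfolding X_def using that by (intro member_le_sum) auto
      have "cmod (x i) * cmod (x l) \<le> X"
      proof -
        have "2 * (cmod (x i) * cmod (x l)) \<le> (cmod (x i))\<^sup>2 + (cmod (x l))\<^sup>2"
          using sum_squares_bound[of "cmod (x i)" "cmod (x l)"] by simp
        then show ?thesis using sqX[OF m(1)] sqX[OF m(2)] by linarith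
      qed
      then have le: "k a b * (cmod (x i) * cmod (x l)) \<le> 2 * real e / real (L - 2 * e) * X"
        using kb[OF m(3,4)] by (intro mult_mono) auto
      have "cmod (complex_of_real (k a b) * (cnj (x i) * \<Theta> i l a b * z ^ b * cnj z ^ a * x l))
          = k a b * (cmod (x i) * cmod (x l)) * cmod (\<Theta> i l a b)"
      proof -
        have "cmod (complex_of_real (k a b)) = k a b" using kb[OF m(3,4)] by (metis norm_of_real abs_of_nonneg)
        moreover have "cmod (z ^ b) = 1" "cmod (cnj z ^ a) = 1" using z by (simp_all add: norm_power)
        ultimately show ?thesis by (simp only: norm_mult complex_mod_cnj mult_1_right) (simp only: mult_ac)
      qed
      also have "\<dots> \<le> 2 * real e / real (L - 2 * e) * X * cmod (\<Theta> i l a b)"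
        by (rule mult_right_mono[OF le norm_ge_zero])
      finally show "cmod (complex_of_real (k a b) * (cnj (x i) * \<Theta> i l a b * z ^ b * cnj z ^ a * x l))
          \<le> 2 * real e / real (L - 2 * e) * X * cmod (\<Theta> i l a b)" .
    qed
    also have "\<dots> = 2 * real e / real (L - 2 * e) * X * C"
      by (simp only: C_def sum_distrib_left)
    also have "\<dots> = (2 * real e / real (L - 2 * e) * C) * X" by (simp only: mult_ac)
    also have "\<dots> < \<delta> * X" by (rule mult_strict_right_mono[OF small X])
    finally have err: "cmod (of_nat L * W - P) < \<delta> * X" .
    have "Re (P - of_nat L * W) \<le> cmod (P - of_nat L * W)" by (rule complex_Re_le_cmod)
    then have "Re P - real L * Re W < \<delta> * X" using err by (simp add: norm_minus_commute)
    then have "real L * Re W > 0" using pos unfolding P_def[symmetric] X_def[symmetric] by linarith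
    then show ?thesis unfolding W_def[symmetric] by (simp add: zero_less_mult_iff)
  qed
  then show ?thesis by (intro exI[of _ L] conjI allI impI L)
qed

text \<open>A matrix-valued trigonometric polynomial that is uniformly positive on the circle is a sum of
  squares. By \<open>fejer_quadrature\<close> it is an average of the reweighted values at roots of unity, each
  multiplied by the squared modulus of a polynomial. These values are positive definite, hence Gram
  matrices.\<close>

lemma fejer_sos:
  fixes \<Theta> :: "nat \<Rightarrow> nat \<Rightarrow> nat \<Rightarrow> nat \<Rightarrow> complex"
  assumes herm: "\<And>i l a b. \<Theta> l i b a = cnj (\<Theta> i l a b)" and d: "\<delta> > 0"
    and pos: "\<And>z x. cmod z = 1 \<Longrightarrow> z \<noteq> -1 \<Longrightarrow>
     Re (\<Sum>i<n. \<Sum>l<n. cnj (x i) * (\<Sum>a<e. \<Sum>b<e. \<Theta> i l a b * z ^ b * cnj z ^ a) * x l) \<ge> \<delta> * (\<Sum>i<n. (cmod (x i))\<^sup>2)"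
  shows "\<exists>r (G :: nat \<Rightarrow> nat \<Rightarrow> complex poly). \<forall>z. z \<noteq> 0 \<longrightarrow> (\<forall>i<n. \<forall>l<n.
    (\<Sum>k<r. refl_eval (G k i) z * poly (G k l) z) = (\<Sum>a<e. \<Sum>b<e. \<Theta> i l a b * z ^ b * inverse z ^ a))"
proof -
  from fejer_weights_positive[OF d, of e n \<Theta>] obtain L where LW: "2 * e < L \<and> (\<forall>z x. cmod z = 1 \<longrightarrow>
     Re (\<Sum>i<n. \<Sum>l<n. cnj (x i) * (\<Sum>a<e. \<Sum>b<e. \<Theta> i l a b * z ^ b * cnj z ^ a) * x l) \<ge> \<delta> * (\<Sum>i<n. (cmod (x i))\<^sup>2) \<longrightarrow>
     (\<exists>i<n. x i \<noteq> 0) \<longrightarrow>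
     Re (\<Sum>i<n. \<Sum>l<n. cnj (x i) * (\<Sum>a<e. \<Sum>b<e. \<Theta> i l a b / of_nat (shift_count L a b) * z ^ b * cnj z ^ a) * x l) > 0)" ..
  note L = conjunct1[OF LW] and W = conjunct2[OF LW, rule_format]
  \<comment> \<open>An odd number of nodes avoids the point \<open>-1\<close>, where positivity is not assumed.\<close>
  define M where "M = 2 * (e + L) + 1"
  have M: "e + L \<le> M" "M > 0" "odd M" by (auto simp: M_def)
  define \<zeta> where "\<zeta> t = cis (2 * pi * real t / real M)" for t :: nat
  have z1: "cmod (\<zeta> t) = 1" for t by (simp add: \<zeta>_def)
  have zm: "\<zeta> t \<noteq> -1" for t
  proof
    assume "\<zeta> t = -1"
    then have "\<zeta> t ^ M = -1" using M(3) by simp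
    moreover have "\<zeta> t ^ M = 1"
    proof -
      have "real M * (2 * pi * real t / real M) = 2 * pi * real t" using M(2) by simp
      then show ?thesis unfolding \<zeta>_def Complex.DeMoivre by (simp only: cis_multiple_2pi Ints_of_nat)
    qed
    ultimately show False by simp
  qed
  define R where "R t i l = (\<Sum>a<e. \<Sum>b<e. \<Theta> i l a b / of_nat (shift_count L a b) * \<zeta> t ^ b * cnj (\<zeta> t) ^ a)" for t i l
  have sym: "shift_count L b a = shift_count L a b" for a b
  proof -
    have "{(j, k). j < L \<and> k < L \<and> a + j = b + k} = (\<lambda>(j, k). (k, j)) ` {(j, k). j < L \<and> k < L \<and> b + j = a + k}"
      by (auto simp: image_iff)
    then show ?thesis unfolding shift_count_def by (simp add: card_image inj_on_def case_prod_unfold)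
  qed
  have fac: "\<exists>S. \<forall>i<n. \<forall>l<n. (\<Sum>k<n. cnj (S k i) * S k l) = R t i l" for t
  proof (rule pos_def_factor)
    show "R t l i = cnj (R t i l)" for i l
    proof -
      have "R t l i = (\<Sum>b<e. \<Sum>a<e. \<Theta> l i b a / of_nat (shift_count L b a) * \<zeta> t ^ a * cnj (\<zeta> t) ^ b)"
        unfolding R_def ..
      also have "\<dots> = (\<Sum>a<e. \<Sum>b<e. \<Theta> l i b a / of_nat (shift_count L b a) * \<zeta> t ^ a * cnj (\<zeta> t) ^ b)"
        by (rule sum.swap)
      also have "\<dots> = cnj (R t i l)"
        unfolding R_def cnj_sum
      proof (intro sum.cong refl)
        fix a b
        show "\<Theta> l i b a / of_nat (shift_count L b a) * \<zeta> t ^ a * cnj (\<zeta> t) ^ b =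
          cnj (\<Theta> i l a b / of_nat (shift_count L a b) * \<zeta> t ^ b * cnj (\<zeta> t) ^ a)"
          unfolding herm[of l i b a] sym[of b a] by simp
      qed
      finally show ?thesis .
    qed
    show "Re (\<Sum>i<n. \<Sum>j<n. cnj (x i) * R t i j * x j) > 0" if "\<exists>i<n. x i \<noteq> 0" for x
      unfolding R_def by (rule W[OF z1 pos[OF z1 zm] that])
  qed
  define S where "S t = (SOME S. \<forall>i<n. \<forall>l<n. (\<Sum>k<n. cnj (S k i) * S k l) = R t i l)" for t
  have S: "(\<Sum>k<n. cnj (S t k i) * S t k l) = R t i l" if "i < n" "l < n" for t i l
    using someI_ex[OF fac[of t]] that unfolding S_def[symmetric] by simp
  define g where "g t = (\<Sum>j<L. monom (cnj (\<zeta> t) ^ j) j)" for t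
  have g: "poly (g t) z = (\<Sum>k<L. (cnj (\<zeta> t) * z) ^ k)" for t z
    unfolding g_def by (simp add: poly_sum poly_monom power_mult_distrib)
  have g': "refl_eval (g t) z = (\<Sum>j<L. (\<zeta> t * inverse z) ^ j)" for t z
    unfolding refl_eval_def g by (simp add: power_mult_distrib)
  define c where "c = complex_of_real (1 / sqrt (real M))"
  have c: "cnj c * c = 1 / of_nat M"
    unfolding c_def using M(2) by (simp flip: of_real_mult add: real_sqrt_mult_self)
  define G where "G k l = Polynomial.smult (c * S (k div n) (k mod n) l) (g (k div n))" for k l
  show ?thesis
  proof (rule exI[of _ "M * n"], rule exI[of _ G], intro allI impI)
    fix z :: complex and i l assume z: "z \<noteq> 0" and il: "i < n" "l < n"
    have n: "n > 0" using il by simp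
    define f where "f k = refl_eval (G k i) z * poly (G k l) z" for k
    have fk: "f k = cnj (S (k div n) (k mod n) i) * S (k div n) (k mod n) l * (1 / of_nat M * (refl_eval (g (k div n)) z * poly (g (k div n)) z))" for k
      unfolding f_def G_def c[symmetric] by (simp add: refl_eval_def mult_ac)
    have "(\<Sum>k<M * n. f k) = (\<Sum>t<M. sum f {t * n..<t * n + n})"
      by (rule sum.nat_group[symmetric])
    also have "\<dots> = (\<Sum>t<M. R t i l * (1 / of_nat M * (refl_eval (g t) z * poly (g t) z)))"
    proof (intro sum.cong refl)
      fix t
      have "sum f {t * n..<t * n + n} = (\<Sum>k<n. f (t * n + k))"
        using sum.shift_bounds_nat_ivl[of f 0 "t * n" n] by (simp add: add.commute atLeast0LessThan)
      also have "\<dots> = (\<Sum>k<n. cnj (S t k i) * S t k l * (1 / of_nat M * (refl_eval (g t) z * poly (g t) z)))"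
        by (intro sum.cong refl) (simp add: fk)
      also have "\<dots> = R t i l * (1 / of_nat M * (refl_eval (g t) z * poly (g t) z))"
        by (simp only: sum_distrib_right[symmetric] S[OF il])
      finally show "sum f {t * n..<t * n + n} = R t i l * (1 / of_nat M * (refl_eval (g t) z * poly (g t) z))" .
    qed
    also have "\<dots> = 1 / of_nat M * (\<Sum>t<M. R t i l * (refl_eval (g t) z * poly (g t) z))"
      by (simp add: sum_distrib_left mult_ac)
    also have "(\<Sum>t<M. R t i l * (refl_eval (g t) z * poly (g t) z)) = of_nat M * (\<Sum>a<e. \<Sum>b<e. \<Theta> i l a b * z ^ b * inverse z ^ a)"
      unfolding R_def g g' \<zeta>_def by (rule fejer_quadrature[OF z M(1) L])
    finally show "(\<Sum>k<M * n. refl_eval (G k i) z * poly (G k l) z) = (\<Sum>a<e. \<Sum>b<e. \<Theta> i l a b * z ^ b * inverse z ^ a)"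
      unfolding f_def using M(2) by simp
  qed
qed

section \<open>The Moebius transformation\<close>

text \<open>The numerator of \<open>p ((1 - x) / (1 + x))\<close> over the denominator \<open>(1 + x) ^ D\<close>. The map
  \<open>x \<mapsto> (1 - x) / (1 + x)\<close> is an involution that exchanges the closed right half-plane with the closed
  unit disc without \<open>-1\<close>; the point \<open>-1\<close> corresponds to infinity.\<close>

definition moebius_poly :: "nat \<Rightarrow> complex poly \<Rightarrow> complex poly" where
  "moebius_poly D p = (\<Sum>k\<le>D. Polynomial.smult (coeff p k) ([:1, -1:] ^ k * [:1, 1:] ^ (D - k)))"

lemma poly_moebius:
  assumes "degree p \<le> D" "1 + x \<noteq> 0"
  shows "poly (moebius_poly D p) x = (1 + x) ^ D * poly p ((1 - x) / (1 + x))"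
proof -
  have "poly p ((1 - x) / (1 + x)) = (\<Sum>k\<le>D. coeff p k * ((1 - x) / (1 + x)) ^ k)"
    unfolding poly_altdef by (intro sum.mono_neutral_left) (use assms(1) in \<open>auto simp: coeff_eq_0\<close>)
  then have "(1 + x) ^ D * poly p ((1 - x) / (1 + x)) = (\<Sum>k\<le>D. (1 + x) ^ D * (coeff p k * ((1 - x) / (1 + x)) ^ k))"
    by (simp add: sum_distrib_left)
  also have "\<dots> = poly (moebius_poly D p) x"
    unfolding moebius_poly_def poly_sum
  proof (intro sum.cong refl)
    fix k assume "k \<in> {..D}"
    then have "(1 + x) ^ D = (1 + x) ^ k * (1 + x) ^ (D - k)" by (simp flip: power_add)
    then show "(1 + x) ^ D * (coeff p k * ((1 - x) / (1 + x)) ^ k) =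
        poly (Polynomial.smult (coeff p k) ([:1, - 1:] ^ k * [:1, 1:] ^ (D - k))) x"
      using assms(2) by (simp add: power_divide)
  qed
  finally show ?thesis ..
qed

lemma moebius_poly_minus_one: "poly (moebius_poly D p) (-1) = coeff p D * 2 ^ D"
proof -
  have "poly (moebius_poly D p) (-1) = (\<Sum>k\<le>D. if k = D then coeff p D * 2 ^ D else 0)"
    unfolding moebius_poly_def poly_sum
  proof (intro sum.cong refl)
    fix k assume "k \<in> {..D}"
    then show "poly (Polynomial.smult (coeff p k) ([:1, - 1:] ^ k * [:1, 1:] ^ (D - k))) (- 1) =
      (if k = D then coeff p D * 2 ^ D else 0)"
      by (cases "k = D") auto
  qed
  then show ?thesis by simp
qed

lemma degree_moebius: "degree (moebius_poly D p) \<le> D"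
  unfolding moebius_poly_def
proof (rule degree_sum_le)
  fix k assume "k \<in> {..D}"
  have "degree ([:1, -1:] ^ k * [:1, 1:] ^ (D - k) :: complex poly) \<le> k + (D - k)"
    by (rule order_trans[OF degree_mult_le]) (simp add: degree_linear_power add_mono order_trans[OF degree_power_le])
  then show "degree (Polynomial.smult (coeff p k) ([:1, -1:] ^ k * [:1, 1:] ^ (D - k))) \<le> D"
    using \<open>k \<in> {..D}\<close> by (intro order_trans[OF degree_smult_le]) simp
qed simp

lemma coeff_moebius:
  assumes "degree p \<le> D"
  shows "coeff (moebius_poly D p) D = poly p (-1)"
proof -
  have "coeff ([:1, -1:] ^ k * [:1, 1:] ^ (D - k) :: complex poly) D = (-1) ^ k" if "k \<le> D" for k
  proof -
    have d: "degree ([:1, -1:] ^ k :: complex poly) = k" "degree ([:1, 1:] ^ (D - k) :: complex poly) = D - k"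
      by (simp_all add: degree_power_eq)
    have "coeff ([:1, -1:] ^ k * [:1, 1:] ^ (D - k) :: complex poly) (k + (D - k)) =
      lead_coeff ([:1, -1:] ^ k) * lead_coeff ([:1, 1:] ^ (D - k) :: complex poly)"
      using coeff_mult_degree_sum[of "[:1, -1:] ^ k :: complex poly" "[:1, 1:] ^ (D - k)"] unfolding d .
    then show ?thesis using that by (simp add: lead_coeff_power)
  qed
  then have "coeff (moebius_poly D p) D = (\<Sum>k\<le>D. coeff p k * (-1) ^ k)"
    unfolding moebius_poly_def coeff_sum by (intro sum.cong refl) simp
  also have "\<dots> = poly p (-1)"
    unfolding poly_altdef by (intro sum.mono_neutral_right) (use assms in \<open>auto simp: coeff_eq_0\<close>)
  finally show ?thesis .
qed

lemma moebius_half_plane: "Re s \<ge> 0 \<Longrightarrow> cmod ((1 - s) / (1 + s)) \<le> 1"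
proof -
  assume s: "Re s \<ge> 0"
  have "(cmod (1 - s))\<^sup>2 \<le> (cmod (1 + s))\<^sup>2"
    unfolding cmod_power2 using s by (simp add: power2_eq_square algebra_simps)
  then have "cmod (1 - s) \<le> cmod (1 + s)" by simp
  then show ?thesis by (simp add: norm_divide divide_le_eq_1)
qed

lemma moebius_disc:
  assumes "cmod z \<le> 1" "z \<noteq> -1"
  shows "Re ((1 - z) / (1 + z)) \<ge> 0" "1 + (1 - z) / (1 + z) \<noteq> 0" "(1 - (1 - z) / (1 + z)) / (1 + (1 - z) / (1 + z)) = z"
    "cmod z = 1 \<Longrightarrow> (1 - z) / (1 + z) = im_axis (Im ((1 - z) / (1 + z)))"
proof -
  have z: "1 + z \<noteq> 0" using assms(2) by (metis add_eq_0_iff)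
  have "Re ((1 - z) / (1 + z)) = (1 - (cmod z)\<^sup>2) / (cmod (1 + z))\<^sup>2"
    unfolding Re_divide cmod_power2 by (simp add: power2_eq_square algebra_simps)
  moreover have "(cmod z)\<^sup>2 \<le> 1" using assms(1) by (simp add: power_le_one)
  ultimately show "Re ((1 - z) / (1 + z)) \<ge> 0" and "cmod z = 1 \<Longrightarrow> (1 - z) / (1 + z) = im_axis (Im ((1 - z) / (1 + z)))"
    by (simp_all add: complex_eq_iff)
  have e: "1 + (1 - z) / (1 + z) = 2 / (1 + z)" "1 - (1 - z) / (1 + z) = 2 * z / (1 + z)" using z by (simp_all add: field_simps)
  show "1 + (1 - z) / (1 + z) \<noteq> 0" unfolding e using z by simp
  show "(1 - (1 - z) / (1 + z)) / (1 + (1 - z) / (1 + z)) = z" unfolding e using z by simp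
qed

lemma moebius_reflection:
  "(1 - (- cnj s)) / (1 + (- cnj s)) = inverse (cnj ((1 - s) / (1 + s)))"
  by simp

text \<open>The transformation of \<open>q\<close> at the order \<open>degree q\<close> takes a nonzero multiple of the leading coefficient
  of \<open>q\<close> as its value at \<open>-1\<close>; at the other points of the disc it vanishes only if \<open>q\<close> has a root in the
  closed right half-plane.\<close>

lemma disc_fraction:
  assumes "stable_fraction p q f"
  shows "\<exists>P Q. (\<forall>z. cmod z \<le> 1 \<longrightarrow> poly Q z \<noteq> 0) \<and>
    (\<forall>s. Re s \<ge> 0 \<longrightarrow> f s = poly P ((1 - s) / (1 + s)) / poly Q ((1 - s) / (1 + s)))"
proof (intro exI conjI allI impI)
  note pq = stable_fractionD[OF assms]
  let ?E = "degree q"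
  show "poly (moebius_poly ?E q) z \<noteq> 0" if "cmod z \<le> 1" for z
  proof (cases "z = -1")
    case True
    then show ?thesis using pq(4) by (simp add: moebius_poly_minus_one)
  next
    case False
    then have "1 + z \<noteq> 0" by (metis add_eq_0_iff)
    then show ?thesis using pq(2)[OF moebius_disc(1)[OF that False]] by (simp add: poly_moebius)
  qed
  fix s :: complex assume s: "Re s \<ge> 0"
  then have s1: "1 + s \<noteq> 0" by (auto simp: complex_eq_iff)
  let ?z = "(1 - s) / (1 + s)"
  have e: "1 + ?z = 2 / (1 + s)" "1 - ?z = 2 * s / (1 + s)" using s1 by (simp_all add: field_simps)
  have "1 + ?z \<noteq> 0" "(1 - ?z) / (1 + ?z) = s" unfolding e using s1 by simp_all
  then show "f s = poly (moebius_poly ?E p) ?z / poly (moebius_poly ?E q) ?z"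
    using pq(3)[OF pq(2)[OF s]] by (simp add: poly_moebius pq(1))
qed

text \<open>The coefficient of order \<open>D\<close> of the new denominator is \<open>poly Q (-1)\<close>. As this is nonzero, the
  denominator has full degree and the fraction is proper.\<close>

lemma half_plane_fraction:
  assumes Q: "\<And>z. cmod z \<le> 1 \<Longrightarrow> poly Q z \<noteq> 0" and D: "degree P \<le> D" "degree Q \<le> D"
  shows "stable_fraction (moebius_poly D P) (moebius_poly D Q) (\<lambda>s. poly (moebius_poly D P) s / poly (moebius_poly D Q) s)"
  unfolding stable_fraction_def
proof (intro conjI allI impI refl)
  have "coeff (moebius_poly D Q) D \<noteq> 0" unfolding coeff_moebius[OF D(2)] by (rule Q) simp
  then have "degree (moebius_poly D Q) \<ge> D" by (rule le_degree)
  then show "degree (moebius_poly D P) \<le> degree (moebius_poly D Q)" using degree_moebius[of D P] by simp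
  fix s :: complex assume s: "Re s \<ge> 0"
  then have s1: "1 + s \<noteq> 0" by (auto simp: complex_eq_iff)
  show "poly (moebius_poly D Q) s \<noteq> 0"
    using Q[OF moebius_half_plane[OF s]] s1 by (simp add: poly_moebius[OF D(2) s1])
qed

lemma stable_fraction_bounded:
  assumes "stable_fraction p q f"
  shows "\<exists>M. \<forall>s. Re s \<ge> 0 \<longrightarrow> cmod (f s) \<le> M"
proof -
  obtain P Q where PQ: "\<forall>z. cmod z \<le> 1 \<longrightarrow> poly Q z \<noteq> 0"
    "\<forall>s. Re s \<ge> 0 \<longrightarrow> f s = poly P ((1 - s) / (1 + s)) / poly Q ((1 - s) / (1 + s))"
    using disc_fraction[OF assms] by blast
  have "continuous_on (cball 0 1) (\<lambda>z. poly P z / poly Q z)"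
    using PQ(1) by (intro continuous_intros) auto
  then have "bounded ((\<lambda>z. poly P z / poly Q z) ` cball 0 1)"
    by (intro compact_imp_bounded compact_continuous_image) auto
  then obtain M where M: "\<forall>w \<in> (\<lambda>z. poly P z / poly Q z) ` cball 0 1. cmod w \<le> M" unfolding bounded_iff by blast
  show ?thesis
  proof (intro exI allI impI)
    fix s :: complex assume s: "Re s \<ge> 0"
    then have "(1 - s) / (1 + s) \<in> cball 0 1" using moebius_half_plane by simp
    then show "cmod (f s) \<le> M" using M PQ(2) s by auto
  qed
qed

lemma stable_entries_hardy:
  assumes X: "stable_entries r c X"
  shows "hardy_inf X"
proof -
  have "\<forall>i j. \<exists>M. i < r \<longrightarrow> j < c \<longrightarrow> (\<forall>s. Re s \<ge> 0 \<longrightarrow> cmod (X s $$ (i, j)) \<le> M)"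
    using stable_entriesE[OF X] stable_fraction_bounded by metis
  then obtain M where M: "\<And>i j s. i < r \<Longrightarrow> j < c \<Longrightarrow> Re s \<ge> 0 \<Longrightarrow> cmod (X s $$ (i, j)) \<le> M i j" by metis
  let ?B = "\<Sum>i<r. \<Sum>j<c. \<bar>M i j\<bar>"
  have "cmod (X s $$ (i, j)) \<le> ?B" if "i < r" "j < c" "Re s > 0" for i j s
  proof -
    have "cmod (X s $$ (i, j)) \<le> \<bar>M i j\<bar>" using M[of i j s] that by simp
    also have "\<dots> \<le> (\<Sum>j<c. \<bar>M i j\<bar>)" using that by (intro member_le_sum) auto
    also have "\<dots> \<le> ?B" using that by (intro member_le_sum[of i "{..<r}" "\<lambda>i. \<Sum>j<c. \<bar>M i j\<bar>"] sum_nonneg) auto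
    finally show ?thesis .
  qed
  moreover have "(\<lambda>s. X s $$ (i, j)) analytic_on {s. Re s > 0}" if "i < r" "j < c" for i j
    using stable_entries_analytic[OF X _ that] unfolding analytic_on_def by fastforce
  ultimately show ?thesis
    unfolding hardy_inf_def analytic_mat_def using carrier_matD[OF stable_entries_carrier[OF X]] by auto
qed

lemma common_denominator:
  assumes F: "stable_entries n ny F"
  shows "\<exists>d N. (\<forall>z. cmod z \<le> 1 \<longrightarrow> poly d z \<noteq> 0) \<and> (\<forall>s i j. Re s \<ge> 0 \<longrightarrow> i < n \<longrightarrow> j < ny \<longrightarrow>
    F s $$ (i, j) = poly (N i j) ((1 - s) / (1 + s)) / poly d ((1 - s) / (1 + s)))"
proof -
  let ?S = "{..<n} \<times> {..<ny}"
  have "\<forall>x. \<exists>h. x \<in> ?S \<longrightarrow> (\<forall>z. cmod z \<le> 1 \<longrightarrow> poly (snd h) z \<noteq> 0) \<and>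
    (\<forall>s. Re s \<ge> 0 \<longrightarrow> F s $$ x = poly (fst h) ((1 - s) / (1 + s)) / poly (snd h) ((1 - s) / (1 + s)))"
  proof
    fix x :: "nat \<times> nat"
    show "\<exists>h. x \<in> ?S \<longrightarrow> (\<forall>z. cmod z \<le> 1 \<longrightarrow> poly (snd h) z \<noteq> 0) \<and>
      (\<forall>s. Re s \<ge> 0 \<longrightarrow> F s $$ x = poly (fst h) ((1 - s) / (1 + s)) / poly (snd h) ((1 - s) / (1 + s)))"
    proof (cases "x \<in> ?S")
      case True
      then obtain i j where x: "x = (i, j)" "i < n" "j < ny" by auto
      obtain p q where "stable_fraction p q (\<lambda>s. F s $$ (i, j))" by (rule stable_entriesE[OF F x(2,3)])
      from disc_fraction[OF this] obtain P Q where "(\<forall>z. cmod z \<le> 1 \<longrightarrow> poly Q z \<noteq> 0) \<and>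
        (\<forall>s. Re s \<ge> 0 \<longrightarrow> F s $$ (i, j) = poly P ((1 - s) / (1 + s)) / poly Q ((1 - s) / (1 + s)))" by blast
      then show ?thesis unfolding x(1) by (intro exI[of _ "(P, Q)"] impI) simp
    qed simp
  qed
  from choice[OF this] obtain h where H: "\<forall>x. x \<in> ?S \<longrightarrow> (\<forall>z. cmod z \<le> 1 \<longrightarrow> poly (snd (h x)) z \<noteq> 0) \<and>
    (\<forall>s. Re s \<ge> 0 \<longrightarrow> F s $$ x = poly (fst (h x)) ((1 - s) / (1 + s)) / poly (snd (h x)) ((1 - s) / (1 + s)))" ..
  have h: "\<And>x z. x \<in> ?S \<Longrightarrow> cmod z \<le> 1 \<Longrightarrow> poly (snd (h x)) z \<noteq> 0"
    "\<And>x s. x \<in> ?S \<Longrightarrow> Re s \<ge> 0 \<Longrightarrow> F s $$ x = poly (fst (h x)) ((1 - s) / (1 + s)) / poly (snd (h x)) ((1 - s) / (1 + s))"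
    using H by blast+
  define d where "d = (\<Prod>x\<in>?S. snd (h x))"
  define N where "N i j = fst (h (i, j)) * (\<Prod>x\<in>?S - {(i, j)}. snd (h x))" for i j
  have "poly d z \<noteq> 0" if "cmod z \<le> 1" for z
    unfolding d_def poly_prod using h(1)[OF _ that] by (simp add: prod_zero_iff)
  moreover have "F s $$ (i, j) = poly (N i j) ((1 - s) / (1 + s)) / poly d ((1 - s) / (1 + s))"
    if s: "Re s \<ge> 0" and ij: "i < n" "j < ny" for s i j
  proof -
    let ?z = "(1 - s) / (1 + s)"
    have z: "cmod ?z \<le> 1" by (rule moebius_half_plane[OF s])
    have x: "(i, j) \<in> ?S" using ij by simp
    have "poly d ?z = poly (snd (h (i, j))) ?z * poly (\<Prod>x\<in>?S - {(i, j)}. snd (h x)) ?z"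
      unfolding d_def by (subst prod.remove[OF _ x]) auto
    moreover have "poly (\<Prod>x\<in>?S - {(i, j)}. snd (h x)) ?z \<noteq> 0"
      unfolding poly_prod using h(1)[OF _ z] by (simp add: prod_zero_iff)
    ultimately show ?thesis unfolding h(2)[OF x s] N_def by simp
  qed
  ultimately show ?thesis by blast
qed

section \<open>Paraunitary completion\<close>

text \<open>Expand \<open>0 \<le> |t\<^sup>2 x - A\<^sup>\<dagger> A x|\<^sup>2\<close> and bound \<open>|A\<^sup>\<dagger> (A x)|\<^sup>2\<close> by \<open>t\<^sup>2 |A x|\<^sup>2\<close>.\<close>

lemma contraction_transpose:
  assumes A: "A \<in> carrier_mat n k" and t: "t > 0"
    and contr: "\<And>u. u \<in> carrier_vec n \<Longrightarrow> sqnorm (A\<^sup>\<dagger> *\<^sub>v u) \<le> t\<^sup>2 * sqnorm u"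
    and x: "x \<in> carrier_vec k"
  shows "sqnorm (A *\<^sub>v x) \<le> t\<^sup>2 * sqnorm x"
proof -
  let ?y = "A *\<^sub>v x" and ?w = "A\<^sup>\<dagger> *\<^sub>v (A *\<^sub>v x)" and ?c = "complex_of_real (t\<^sup>2)"
  note d = carrier_matD[OF A] carrier_vecD[OF x]
  have e: "x \<bullet>c ?w = ?y \<bullet>c ?y" using cscalar_adjoint[of A x ?y] by (simp add: d)
  have e': "?w \<bullet>c x = ?y \<bullet>c ?y" using cscalar_cnj[of x ?w] e by (simp add: d cscalar_cnj)
  have "0 \<le> sqnorm (?c \<cdot>\<^sub>v x - ?w)" by (rule cscalar_self_nonneg)
  also have "\<dots> = t\<^sup>2 * (t\<^sup>2 * sqnorm x) - 2 * (t\<^sup>2 * sqnorm ?y) + sqnorm ?w"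
    by (simp add: d cscalar_minus_left cscalar_minus_right cscalar_smult_left cscalar_smult_right e e' right_diff_distrib)
  finally have "0 \<le> t\<^sup>2 * (t\<^sup>2 * sqnorm x) - 2 * (t\<^sup>2 * sqnorm ?y) + sqnorm ?w" .
  moreover have "sqnorm ?w \<le> t\<^sup>2 * sqnorm ?y" by (rule contr) (simp add: d)
  ultimately have "t\<^sup>2 * sqnorm ?y \<le> t\<^sup>2 * (t\<^sup>2 * sqnorm x)" by simp
  then show ?thesis by (rule mult_left_le_imp_le) (use t in simp)
qed

text \<open>Halmos dilation: \<open>V W\<close> is idempotent, and \<open>1 - V W\<close> fills the complement of the range of \<open>V\<close>.\<close>

lemma halmos_unitary:
  fixes V W :: "complex mat"
  assumes V: "V \<in> carrier_mat q k" and W: "W \<in> carrier_mat k q" and WV: "W * V = 1\<^sub>m k" and b: "b * c = 1"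
  shows "four_block_mat V (b \<cdot>\<^sub>m (1\<^sub>m q - V * W)) (0\<^sub>m k k) (b \<cdot>\<^sub>m W) *
    four_block_mat W (0\<^sub>m k k) (c \<cdot>\<^sub>m (1\<^sub>m q - V * W)) (c \<cdot>\<^sub>m V) = 1\<^sub>m (q + k)"
proof -
  let ?P = "1\<^sub>m q - V * W"
  have P: "?P \<in> carrier_mat q q" using V W by auto
  have VW: "V * W \<in> carrier_mat q q" using V W by auto
  have idem: "(V * W) * (V * W) = V * W"
  proof -
    have "(V * W) * (V * W) = V * (W * (V * W))" by (rule assoc_mult_mat[OF V W VW])
    also have "W * (V * W) = W" by (subst assoc_mult_mat[OF W V W, symmetric]) (use W WV in simp)
    finally show ?thesis .
  qed
  have PP: "?P * ?P = ?P"
    using VW by (simp add: minus_mult_distrib_mat[OF one_carrier_mat VW P] mult_minus_distrib_mat[OF VW one_carrier_mat VW] idem left_mult_one_mat[OF P])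
       (rule eq_matI, auto)
  have PV: "?P * V = 0\<^sub>m q k"
    using V by (simp add: minus_mult_distrib_mat[OF one_carrier_mat VW V] assoc_mult_mat[OF V W V] WV)
  have WP: "W * ?P = 0\<^sub>m k q"
    using W by (simp add: mult_minus_distrib_mat[OF W one_carrier_mat VW] assoc_mult_mat[OF W V W, symmetric] WV)
  have bc: "(b \<cdot>\<^sub>m X) * (c \<cdot>\<^sub>m Y) = X * Y" if X: "X \<in> carrier_mat n1 n2" and Y: "Y \<in> carrier_mat n2 n3"
    for X Y :: "complex mat" and n1 n2 n3
  proof -
    have "(b \<cdot>\<^sub>m X) * (c \<cdot>\<^sub>m Y) = b \<cdot>\<^sub>m (c \<cdot>\<^sub>m (X * Y))"
      using mult_smult_assoc_mat[OF X smult_carrier_mat[OF Y], of b c] mult_smult_distrib[OF X Y, of c] by simp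
    also have "\<dots> = (b * c) \<cdot>\<^sub>m (X * Y)" by (rule eq_matI) (simp_all add: mult.assoc)
    finally show ?thesis unfolding b by (simp add: mat_eq_iff)
  qed
  have "four_block_mat V (b \<cdot>\<^sub>m ?P) (0\<^sub>m k k) (b \<cdot>\<^sub>m W) * four_block_mat W (0\<^sub>m k k) (c \<cdot>\<^sub>m ?P) (c \<cdot>\<^sub>m V)
    = four_block_mat (V * W + ?P * ?P) (V * 0\<^sub>m k k + ?P * V) (0\<^sub>m k k * W + W * ?P) (0\<^sub>m k k * 0\<^sub>m k k + W * V)"
    by (subst mult_four_block_mat[of _ q k _ q _ k]) (use V W P in \<open>auto simp: bc[OF P P] bc[OF P V] bc[OF W P] bc[OF W V]\<close>)
  also have "V * W + ?P * ?P = 1\<^sub>m q" unfolding PP using carrier_matD[OF VW] by (intro eq_matI) (auto simp del: index_mult_mat(1))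
  also have "V * 0\<^sub>m k k + ?P * V = 0\<^sub>m q k" unfolding PV using V by simp
  also have "0\<^sub>m k k * W + W * ?P = 0\<^sub>m k q" unfolding WP using W by simp
  also have "0\<^sub>m k k * 0\<^sub>m k k + W * V = 1\<^sub>m k" unfolding WV by simp
  finally show ?thesis by (simp add: four_block_one_mat)
qed

text \<open>\<open>refl_eval\<close> has a pole at zero; multiplication by \<open>z ^ e\<close> turns it into a polynomial.\<close>

definition conj_reverse :: "nat \<Rightarrow> complex poly \<Rightarrow> complex poly" where
  "conj_reverse e p = (\<Sum>a\<le>e. monom (cnj (coeff p a)) (e - a))"

lemma poly_conj_reverse:
  assumes "degree p \<le> e" "z \<noteq> 0"
  shows "poly (conj_reverse e p) z = z ^ e * refl_eval p z"
proof -
  have "refl_eval p z = (\<Sum>a\<le>e. cnj (coeff p a) * inverse z ^ a)"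
    using refl_eval_sum[of p "Suc e" z] assms(1) by (simp add: lessThan_Suc_atMost)
  then have "z ^ e * refl_eval p z = (\<Sum>a\<le>e. z ^ e * (cnj (coeff p a) * inverse z ^ a))"
    by (simp add: sum_distrib_left)
  also have "\<dots> = poly (conj_reverse e p) z"
    unfolding conj_reverse_def poly_sum
  proof (intro sum.cong refl)
    fix a assume "a \<in> {..e}"
    then have "z ^ e * inverse z ^ a = z ^ (e - a)" using assms(2) by (simp add: power_inverse power_diff field_simps)
    then show "z ^ e * (cnj (coeff p a) * inverse z ^ a) = poly (monom (cnj (coeff p a)) (e - a)) z"
      by (simp add: poly_monom mult.left_commute)
  qed
  finally show ?thesis ..
qed

text \<open>On the circle without \<open>-1\<close> the matrix \<open>|d|\<^sup>2 - N\<^sup>\<dagger> N\<close> is at least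
  \<open>(1 - t\<^sup>2) |d|\<^sup>2\<close>, and \<open>|d|\<close> is bounded away from zero by compactness. The rows of \<open>U\<close> below those of \<open>N\<close> are the squares provided by \<open>fejer_sos\<close>; the identity between
  trigonometric polynomials then holds off the circle too.\<close>

lemma isometric_completion:
  fixes N :: "nat \<Rightarrow> nat \<Rightarrow> complex poly"
  assumes d: "\<And>z. cmod z = 1 \<Longrightarrow> poly d z \<noteq> 0" and t: "t < 1" "0 < t"
    and contr: "\<And>z x. cmod z = 1 \<Longrightarrow> z \<noteq> -1 \<Longrightarrow>
      (\<Sum>r<n. (cmod (\<Sum>l<k. poly (N r l) z * x l))\<^sup>2) \<le> t\<^sup>2 * ((cmod (poly d z))\<^sup>2 * (\<Sum>i<k. (cmod (x i))\<^sup>2))"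
  shows "\<exists>q (U :: nat \<Rightarrow> nat \<Rightarrow> complex poly). n \<le> q \<and> (\<forall>i<n. \<forall>l. U i l = N i l) \<and>
    (\<forall>z. z \<noteq> 0 \<longrightarrow> (\<forall>i<k. \<forall>l<k. (\<Sum>r<q. refl_eval (U r i) z * poly (U r l) z) =
      (if i = l then refl_eval d z * poly d z else 0)))"
proof -
  define e where "e = Suc (degree d + (\<Sum>r<n. \<Sum>l<k. degree (N r l)))"
  have de: "degree d < e" by (simp add: e_def)
  have Ne: "degree (N r l) < e" if "r < n" "l < k" for r l
  proof -
    have "degree (N r l) \<le> (\<Sum>l<k. degree (N r l))" using that by (intro member_le_sum) auto
    also have "\<dots> \<le> (\<Sum>r<n. \<Sum>l<k. degree (N r l))" using that by (intro member_le_sum[of r "{..<n}" "\<lambda>r. \<Sum>l<k. degree (N r l)"]) auto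
    finally show ?thesis by (simp add: e_def)
  qed
  define \<Theta> where "\<Theta> i l a b = (if i = l then cnj (coeff d a) * coeff d b else 0) - (\<Sum>r<n. cnj (coeff (N r i) a) * coeff (N r l) b)"
    for i l a b
  have expand: "(\<Sum>a<e. \<Sum>b<e. \<Theta> i l a b * z ^ b * w ^ a) =
      (if i = l then (\<Sum>a<e. cnj (coeff d a) * w ^ a) * (\<Sum>b<e. coeff d b * z ^ b) else 0)
      - (\<Sum>r<n. (\<Sum>a<e. cnj (coeff (N r i) a) * w ^ a) * (\<Sum>b<e. coeff (N r l) b * z ^ b))" for i l z w
  proof -
    have prod: "(\<Sum>a<e. f a * w ^ a) * (\<Sum>b<e. g b * z ^ b) = (\<Sum>a<e. \<Sum>b<e. f a * g b * z ^ b * w ^ a)" for f g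
      unfolding sum_product by (intro sum.cong refl) (simp add: mult_ac)
    have "(\<Sum>a<e. \<Sum>b<e. \<Theta> i l a b * z ^ b * w ^ a) =
      (\<Sum>a<e. \<Sum>b<e. (if i = l then cnj (coeff d a) * coeff d b * z ^ b * w ^ a else 0)
        - (\<Sum>r<n. cnj (coeff (N r i) a) * coeff (N r l) b * z ^ b * w ^ a))"
      unfolding \<Theta>_def by (intro sum.cong refl) (simp add: left_diff_distrib sum_distrib_right)
    also have "\<dots> = (\<Sum>a<e. \<Sum>b<e. if i = l then cnj (coeff d a) * coeff d b * z ^ b * w ^ a else 0)
        - (\<Sum>a<e. \<Sum>b<e. \<Sum>r<n. cnj (coeff (N r i) a) * coeff (N r l) b * z ^ b * w ^ a)"
      by (simp only: sum_subtractf)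
    also have "(\<Sum>a<e. \<Sum>b<e. \<Sum>r<n. cnj (coeff (N r i) a) * coeff (N r l) b * z ^ b * w ^ a)
      = (\<Sum>r<n. \<Sum>a<e. \<Sum>b<e. cnj (coeff (N r i) a) * coeff (N r l) b * z ^ b * w ^ a)"
      by (simp only: sum.swap[of _ "{..<n}"])
    finally show ?thesis unfolding prod by simp
  qed
  have coefficient_sum: "(\<Sum>a<e. \<Sum>b<e. \<Theta> i l a b * z ^ b * inverse z ^ a) =
      (if i = l then refl_eval d z * poly d z else 0) - (\<Sum>r<n. refl_eval (N r i) z * poly (N r l) z)"
    if "i < k" "l < k" for i l z
  proof -
    have "(\<Sum>r<n. refl_eval (N r i) z * poly (N r l) z) =
        (\<Sum>r<n. (\<Sum>a<e. cnj (coeff (N r i) a) * inverse z ^ a) * (\<Sum>b<e. coeff (N r l) b * z ^ b))"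
      by (intro sum.cong refl arg_cong2[of _ _ _ _ "(*)"] refl_eval_sum poly_eval_sum Ne that) simp_all
    then show ?thesis unfolding expand by (simp only: refl_eval_sum[OF de] poly_eval_sum[OF de])
  qed
  have circle: "refl_eval p z = cnj (poly p z)" "inverse z = cnj z" if "cmod z = 1" for p z
  proof -
    show iz: "inverse z = cnj z" using that by (simp add: inverse_complex_def complex_eq_iff cmod_power2[symmetric])
    then show "refl_eval p z = cnj (poly p z)" unfolding refl_eval_def by (metis complex_cnj_cnj complex_cnj_inverse)
  qed
  obtain c where c: "c > 0" "\<And>z. cmod z = 1 \<Longrightarrow> c \<le> cmod (poly d z)"
  proof -
    have "continuous_on (sphere 0 1) (\<lambda>z. cmod (poly d z))" by (intro continuous_intros)
    moreover have "compact (sphere (0::complex) 1)" "sphere (0::complex) 1 \<noteq> {}" by auto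
    ultimately obtain w where w: "w \<in> sphere 0 1" "\<forall>z\<in>sphere 0 1. cmod (poly d w) \<le> cmod (poly d z)"
      using continuous_attains_inf by blast
    show ?thesis by (rule that[of "cmod (poly d w)"]) (use w d in auto)
  qed
  have "\<exists>r (G :: nat \<Rightarrow> nat \<Rightarrow> complex poly). \<forall>z. z \<noteq> 0 \<longrightarrow> (\<forall>i<k. \<forall>l<k.
    (\<Sum>j<r. refl_eval (G j i) z * poly (G j l) z) = (\<Sum>a<e. \<Sum>b<e. \<Theta> i l a b * z ^ b * inverse z ^ a))"
  proof (rule fejer_sos)
    show "\<Theta> l i b a = cnj (\<Theta> i l a b)" for i l a b unfolding \<Theta>_def by (simp add: mult.commute)
    show "c\<^sup>2 * (1 - t\<^sup>2) > 0" using c(1) t by (simp add: power_less_one_iff)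
    fix z :: complex and x :: "nat \<Rightarrow> complex" assume z: "cmod z = 1" "z \<noteq> -1"
    let ?X = "\<Sum>i<k. (cmod (x i))\<^sup>2"
    have X: "?X \<ge> 0" by (intro sum_nonneg) auto
    have sq: "cnj w * w = complex_of_real ((cmod w)\<^sup>2)" for w using complex_norm_square[of w] by (simp add: mult.commute)
    have "(\<Sum>i<k. \<Sum>l<k. cnj (x i) * (\<Sum>a<e. \<Sum>b<e. \<Theta> i l a b * z ^ b * cnj z ^ a) * x l)
      = (\<Sum>i<k. \<Sum>l<k. (if i = l then cnj (x i) * (cnj (poly d z) * poly d z) * x l else 0)
          - (\<Sum>r<n. (cnj (x i) * cnj (poly (N r i) z)) * (poly (N r l) z * x l)))"
    proof (intro sum.cong refl)
      fix i l assume "i \<in> {..<k}" "l \<in> {..<k}"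
      then have e: "(\<Sum>a<e. \<Sum>b<e. \<Theta> i l a b * z ^ b * cnj z ^ a) =
        (if i = l then cnj (poly d z) * poly d z else 0) - (\<Sum>r<n. cnj (poly (N r i) z) * poly (N r l) z)"
        using coefficient_sum[of i l z] unfolding circle(2)[OF z(1)] circle(1)[OF z(1)] by simp
      show "cnj (x i) * (\<Sum>a<e. \<Sum>b<e. \<Theta> i l a b * z ^ b * cnj z ^ a) * x l =
        (if i = l then cnj (x i) * (cnj (poly d z) * poly d z) * x l else 0)
          - (\<Sum>r<n. (cnj (x i) * cnj (poly (N r i) z)) * (poly (N r l) z * x l))"
        unfolding e left_diff_distrib right_diff_distrib sum_distrib_left sum_distrib_right by (simp add: mult_ac)
    qed
    also have "\<dots> = (\<Sum>i<k. \<Sum>l<k. if i = l then cnj (x i) * (cnj (poly d z) * poly d z) * x l else 0)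
        - (\<Sum>i<k. \<Sum>l<k. \<Sum>r<n. (cnj (x i) * cnj (poly (N r i) z)) * (poly (N r l) z * x l))"
      by (simp only: sum_subtractf)
    also have "(\<Sum>i<k. \<Sum>l<k. \<Sum>r<n. (cnj (x i) * cnj (poly (N r i) z)) * (poly (N r l) z * x l))
      = (\<Sum>r<n. \<Sum>i<k. \<Sum>l<k. (cnj (x i) * cnj (poly (N r i) z)) * (poly (N r l) z * x l))"
      by (simp only: sum.swap[of _ "{..<n}"])
    also have "\<dots> = (\<Sum>r<n. cnj (\<Sum>l<k. poly (N r l) z * x l) * (\<Sum>l<k. poly (N r l) z * x l))"
      unfolding cnj_sum sum_product by (intro sum.cong refl) (simp add: mult_ac)
    also have "\<dots> = complex_of_real (\<Sum>r<n. (cmod (\<Sum>l<k. poly (N r l) z * x l))\<^sup>2)"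
      unfolding sq by simp
    also have "(\<Sum>i<k. \<Sum>l<k. if i = l then cnj (x i) * (cnj (poly d z) * poly d z) * x l else 0)
      = (\<Sum>i<k. (cnj (poly d z) * poly d z) * (cnj (x i) * x i))"
      by (intro sum.cong refl) (simp add: mult_ac)
    also have "\<dots> = complex_of_real ((cmod (poly d z))\<^sup>2 * ?X)"
      unfolding sq by (simp add: sum_distrib_left)
    finally have "Re (\<Sum>i<k. \<Sum>l<k. cnj (x i) * (\<Sum>a<e. \<Sum>b<e. \<Theta> i l a b * z ^ b * cnj z ^ a) * x l)
      = (cmod (poly d z))\<^sup>2 * ?X - (\<Sum>r<n. (cmod (\<Sum>l<k. poly (N r l) z * x l))\<^sup>2)"
      by (simp only: minus_complex.sel Re_complex_of_real)
    also have "\<dots> \<ge> (cmod (poly d z))\<^sup>2 * ?X - t\<^sup>2 * ((cmod (poly d z))\<^sup>2 * ?X)"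
      using contr[OF z, of x] by simp
    moreover have "c\<^sup>2 * ((1 - t\<^sup>2) * ?X) \<le> (cmod (poly d z))\<^sup>2 * ((1 - t\<^sup>2) * ?X)"
      using c(1) c(2)[OF z(1)] t X by (intro mult_right_mono power_mono mult_nonneg_nonneg) (simp_all add: power_le_one)
    ultimately show "c\<^sup>2 * (1 - t\<^sup>2) * ?X \<le> Re (\<Sum>i<k. \<Sum>l<k. cnj (x i) * (\<Sum>a<e. \<Sum>b<e. \<Theta> i l a b * z ^ b * cnj z ^ a) * x l)"
      by (simp add: algebra_simps)
  qed
  then obtain r and G :: "nat \<Rightarrow> nat \<Rightarrow> complex poly" where G: "\<forall>z. z \<noteq> 0 \<longrightarrow> (\<forall>i<k. \<forall>l<k.
    (\<Sum>j<r. refl_eval (G j i) z * poly (G j l) z) = (\<Sum>a<e. \<Sum>b<e. \<Theta> i l a b * z ^ b * inverse z ^ a))" by (elim exE)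
  define U where "U j l = (if j < n then N j l else G (j - n) l)" for j l
  have split: "(\<Sum>j<n + r. refl_eval (U j i) z * poly (U j l) z) =
      (\<Sum>j<n. refl_eval (N j i) z * poly (N j l) z) + (\<Sum>j<r. refl_eval (G j i) z * poly (G j l) z)" for i l z
    by (induction r) (simp_all add: U_def)
  show ?thesis
  proof (intro exI[of _ "n + r"] exI[of _ U] conjI allI impI)
    fix z :: complex and i l assume "z \<noteq> 0" "i < k" "l < k"
    then show "(\<Sum>j<n + r. refl_eval (U j i) z * poly (U j l) z) = (if i = l then refl_eval d z * poly d z else 0)"
      unfolding split using G coefficient_sum[of i l z] by simp
  qed (simp_all add: U_def)
qed

text \<open>The rows of \<open>V = U / d\<close> extend \<open>F\<close> to an isometric column, and its reflection \<open>W\<close> is a left inverse.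
  The Halmos dilation of \<open>V\<close> contains \<open>W\<close>, whose poles lie in the disc, at zero or at roots of \<open>d\<close>
  reflected at the circle. The numerator of the inner function \<open>b = z ^ e * refl_eval d z / poly d z\<close> is
  \<open>conj_reverse e d\<close>, so multiplying the second block column by \<open>b\<close> cancels these poles; it also keeps the
  matrix paraunitary and does not touch the corner \<open>F\<close>.\<close>

lemma paraunitary_completion:
  assumes F: "stable_entries n ny F" and t: "0 < t" "t < 1"
    and contr: "\<And>x u. u \<in> carrier_vec n \<Longrightarrow> sqnorm ((F (im_axis x))\<^sup>\<dagger> *\<^sub>v u)
      \<le> t\<^sup>2 * sqnorm u"
  shows "\<exists>H \<in> admissible_equalizers n ny. \<forall>x. top_left n ny H (im_axis x) = F (im_axis x)"
proof -
  obtain d N where d: "\<And>z. cmod z \<le> 1 \<Longrightarrow> poly d z \<noteq> 0" and N: "\<And>s i j. Re s \<ge> 0 \<Longrightarrow> i < n \<Longrightarrow> j < ny \<Longrightarrow>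
    F s $$ (i, j) = poly (N i j) ((1 - s) / (1 + s)) / poly d ((1 - s) / (1 + s))"
    using common_denominator[OF F] by blast
  have Fc: "F s \<in> carrier_mat n ny" for s by (rule stable_entries_carrier[OF F])
  have "\<exists>q (U :: nat \<Rightarrow> nat \<Rightarrow> complex poly). n \<le> q \<and> (\<forall>i<n. \<forall>l. U i l = N i l) \<and>
    (\<forall>z. z \<noteq> 0 \<longrightarrow> (\<forall>i<ny. \<forall>l<ny. (\<Sum>r<q. refl_eval (U r i) z * poly (U r l) z) =
      (if i = l then refl_eval d z * poly d z else 0)))"
  proof (rule isometric_completion[OF d t(2,1)])
    fix z :: complex and x :: "nat \<Rightarrow> complex" assume z: "cmod z = 1" "z \<noteq> -1"
    then have z': "cmod z \<le> 1" by simp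
    define w where "w = Im ((1 - z) / (1 + z))"
    have s: "(1 - z) / (1 + z) = im_axis w" unfolding w_def by (rule moebius_disc(4)[OF z' z(2,1)])
    have zs: "(1 - im_axis w) / (1 + im_axis w) = z"
      unfolding s[symmetric] by (rule moebius_disc(3)[OF z' z(2)])
    let ?F = "F (im_axis w)"
    have "(\<Sum>r<n. (cmod (\<Sum>l<ny. poly (N r l) z * x l))\<^sup>2) =
        (cmod (poly d z))\<^sup>2 * (\<Sum>r<n. (cmod ((?F *\<^sub>v vec ny x) $ r))\<^sup>2)"
      unfolding sum_distrib_left
    proof (intro sum.cong refl)
      fix r assume r: "r \<in> {..<n}"
      have "(\<Sum>l<ny. poly (N r l) z * x l) = poly d z * (\<Sum>l<ny. ?F $$ (r, l) * x l)"
        unfolding sum_distrib_left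
      proof (intro sum.cong refl)
        fix l assume "l \<in> {..<ny}"
        then have "?F $$ (r, l) = poly (N r l) z / poly d z" using N[of "im_axis w" r l] r unfolding zs by simp
        then show "poly (N r l) z * x l = poly d z * (?F $$ (r, l) * x l)" using d[OF z'] by simp
      qed
      moreover have "(?F *\<^sub>v vec ny x) $ r = (\<Sum>l<ny. ?F $$ (r, l) * x l)"
        using r carrier_matD[OF Fc] by (subst mult_vec_sum) auto
      ultimately show "(cmod (\<Sum>l<ny. poly (N r l) z * x l))\<^sup>2 = (cmod (poly d z))\<^sup>2 * (cmod ((?F *\<^sub>v vec ny x) $ r))\<^sup>2"
        by (simp add: norm_mult power_mult_distrib)
    qed
    also have "(\<Sum>r<n. (cmod ((?F *\<^sub>v vec ny x) $ r))\<^sup>2) = sqnorm (?F *\<^sub>v vec ny x)"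
      unfolding cscalar_self using carrier_matD[OF Fc] by simp
    also have "(cmod (poly d z))\<^sup>2 * sqnorm (?F *\<^sub>v vec ny x)
        \<le> (cmod (poly d z))\<^sup>2 * (t\<^sup>2 * sqnorm (vec ny x))"
      by (intro mult_left_mono contraction_transpose[OF Fc t(1) contr]) auto
    also have "sqnorm (vec ny x) = (\<Sum>i<ny. (cmod (x i))\<^sup>2)" unfolding cscalar_self by simp
    finally show "(\<Sum>r<n. (cmod (\<Sum>l<ny. poly (N r l) z * x l))\<^sup>2) \<le> t\<^sup>2 * ((cmod (poly d z))\<^sup>2 * (\<Sum>i<ny. (cmod (x i))\<^sup>2))"
      by (simp add: mult_ac)
  qed simp
  then obtain q and U :: "nat \<Rightarrow> nat \<Rightarrow> complex poly" where q: "n \<le> q" and UN: "\<forall>i<n. \<forall>l. U i l = N i l"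
    and gram: "\<forall>z. z \<noteq> 0 \<longrightarrow> (\<forall>i<ny. \<forall>l<ny. (\<Sum>r<q. refl_eval (U r i) z * poly (U r l) z) =
      (if i = l then refl_eval d z * poly d z else 0))" by (elim exE conjE)
  define e where "e = degree d + (\<Sum>r<q. \<Sum>l<ny. degree (U r l))"
  have de: "degree d \<le> e" by (simp add: e_def)
  have Ue: "degree (U r l) \<le> e" if "r < q" "l < ny" for r l
  proof -
    have "degree (U r l) \<le> (\<Sum>l<ny. degree (U r l))" using that by (intro member_le_sum) auto
    also have "\<dots> \<le> (\<Sum>r<q. \<Sum>l<ny. degree (U r l))" using that by (intro member_le_sum[of r "{..<q}" "\<lambda>r. \<Sum>l<ny. degree (U r l)"]) auto
    finally show ?thesis by (simp add: e_def)
  qed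
  define V where "V z = mat q ny (\<lambda>(k, j). poly (U k j) z / poly d z)" for z
  define W where "W z = mat ny q (\<lambda>(j, k). refl_eval (U k j) z / refl_eval d z)" for z
  define b where "b z = z ^ e * refl_eval d z / poly d z" for z
  define c where "c z = inverse z ^ e * poly d z / refl_eval d z" for z
  define \<H> where "\<H> z = four_block_mat (V z) (b z \<cdot>\<^sub>m (1\<^sub>m q - V z * W z)) (0\<^sub>m ny ny) (b z \<cdot>\<^sub>m W z)" for z
  have V: "V z \<in> carrier_mat q ny" and W: "W z \<in> carrier_mat ny q" for z by (auto simp: V_def W_def)
  have WV: "W z * V z = 1\<^sub>m ny" if z: "z \<noteq> 0" "poly d z \<noteq> 0" "refl_eval d z \<noteq> 0" for z
  proof (rule eq_matI)
    fix i l assume "i < dim_row (1\<^sub>m ny :: complex mat)" "l < dim_col (1\<^sub>m ny :: complex mat)"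
    then have il: "i < ny" "l < ny" by auto
    have "(W z * V z) $$ (i, l) = (\<Sum>k<q. refl_eval (U k i) z / refl_eval d z * (poly (U k l) z / poly d z))"
      using il carrier_matD[OF V] carrier_matD[OF W] by (subst mult_mat_sum) (auto simp: V_def W_def)
    also have "\<dots> = (\<Sum>k<q. refl_eval (U k i) z * poly (U k l) z) / (refl_eval d z * poly d z)"
      by (simp add: sum_divide_distrib)
    finally show "(W z * V z) $$ (i, l) = 1\<^sub>m ny $$ (i, l)" using gram il z by simp
  qed (use carrier_matD[OF V] carrier_matD[OF W] in auto)
  have bc: "b z * c z = 1" if "z \<noteq> 0" "poly d z \<noteq> 0" "refl_eval d z \<noteq> 0" for z
    using that by (simp add: b_def c_def power_inverse)
  have Vr: "(V (inverse (cnj z)))\<^sup>\<dagger> = W z" and Wr: "(W (inverse (cnj z)))\<^sup>\<dagger> = V z" and br: "cnj (b (inverse (cnj z))) = c z" for z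
    unfolding V_def W_def b_def c_def by (intro eq_matI; simp add: refl_eval_def)+ (simp add: refl_eval_def)
  have Hr: "(\<H> (inverse (cnj z)))\<^sup>\<dagger> = four_block_mat (W z) (0\<^sub>m ny ny) (c z \<cdot>\<^sub>m (1\<^sub>m q - V z * W z)) (c z \<cdot>\<^sub>m V z)" for z
  proof -
    let ?z = "inverse (cnj z)"
    have P: "1\<^sub>m q - V ?z * W ?z \<in> carrier_mat q q" by (intro carrier_matI) (simp_all add: carrier_matD[OF V] carrier_matD[OF W])
    have "(1\<^sub>m q - V ?z * W ?z)\<^sup>\<dagger> = 1\<^sub>m q - V z * W z"
      using carrier_matD[OF V] carrier_matD[OF W] by (simp add: adjoint_minus adjoint_mult Vr Wr)
    then show ?thesis unfolding \<H>_def
      by (subst adjoint_four_block[OF V smult_carrier_mat[OF P] zero_carrier_mat smult_carrier_mat[OF W]])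
         (simp add: adjoint_smult Vr Wr br)
  qed
  have unit: "\<H> z * (\<H> (inverse (cnj z)))\<^sup>\<dagger> = 1\<^sub>m (q + ny)" if "z \<noteq> 0" "poly d z \<noteq> 0" "refl_eval d z \<noteq> 0" for z
    unfolding Hr unfolding \<H>_def by (rule halmos_unitary[OF V W WV[OF that] bc[OF that]])
  \<comment> \<open>Numerators of the entries of \<open>\<H>\<close> over the denominator \<open>d\<^sup>2\<close>.\<close>
  define R where "R i j = (if i < q then if j < ny then U i j * d
      else (if i = j - ny then conj_reverse e d * d else 0) - (\<Sum>l<ny. U i l * conj_reverse e (U (j - ny) l))
    else if j < ny then 0 else conj_reverse e (U (j - ny) (i - q)) * d)" for i j
  define nf where "nf = q + ny"
  define D where "D = degree (d * d) + (\<Sum>i<nf. \<Sum>j<nf. degree (R i j))"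
  have RD: "degree (R i j) \<le> D" if "i < nf" "j < nf" for i j
  proof -
    have "degree (R i j) \<le> (\<Sum>j<nf. degree (R i j))" using that by (intro member_le_sum) auto
    also have "\<dots> \<le> (\<Sum>i<nf. \<Sum>j<nf. degree (R i j))" using that by (intro member_le_sum[of i "{..<nf}" "\<lambda>i. \<Sum>j<nf. degree (R i j)"]) auto
    finally show ?thesis by (simp add: D_def)
  qed
  have dD: "degree (d * d) \<le> D" by (simp add: D_def)
  have Hc: "\<H> z \<in> carrier_mat nf nf" for z
    unfolding \<H>_def nf_def by (intro carrier_matI) (simp_all add: carrier_matD[OF V] carrier_matD[OF W])
  have He: "\<H> z $$ (i, j) = poly (R i j) z / poly (d * d) z"
    if z: "z \<noteq> 0" "poly d z \<noteq> 0" "refl_eval d z \<noteq> 0" and ij: "i < nf" "j < nf" for z i j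
  proof -
    note dims = carrier_matD[OF V] carrier_matD[OF W]
    have rev: "poly (conj_reverse e (U r l)) z = z ^ e * refl_eval (U r l) z" if "r < q" "l < ny" for r l
      by (rule poly_conj_reverse[OF Ue[OF that] z(1)])
    have revd: "poly (conj_reverse e d) z = z ^ e * refl_eval d z" by (rule poly_conj_reverse[OF de z(1)])
    consider "i < q" "j < ny" | "i < q" "j \<ge> ny" "j - ny < q" | "i \<ge> q" "j < ny" | "i \<ge> q" "j \<ge> ny" "i - q < ny" "j - ny < q"
      using ij unfolding nf_def by linarith
    then show ?thesis
    proof cases
      case 1
      then show ?thesis using z by (simp add: \<H>_def dims R_def V_def)
    next
      case 2
      have "(V z * W z) $$ (i, j - ny) = (\<Sum>l<ny. poly (U i l) z / poly d z * (refl_eval (U (j - ny) l) z / refl_eval d z))"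
        using 2 by (subst mult_mat_sum) (auto simp: dims V_def W_def)
      then have "\<H> z $$ (i, j) = b z * ((if i = j - ny then 1 else 0) - (\<Sum>l<ny. poly (U i l) z * refl_eval (U (j - ny) l) z) / (poly d z * refl_eval d z))"
        using 2 ij by (simp add: \<H>_def dims nf_def sum_divide_distrib del: index_mult_mat(1))
      also have "\<dots> = ((if i = j - ny then z ^ e * refl_eval d z * poly d z else 0) - (\<Sum>l<ny. poly (U i l) z * refl_eval (U (j - ny) l) z) * z ^ e) / (poly d z * poly d z)"
        using z by (simp add: b_def field_simps)
      also have "(\<Sum>l<ny. poly (U i l) z * refl_eval (U (j - ny) l) z) * z ^ e = (\<Sum>l<ny. poly (U i l) z * poly (conj_reverse e (U (j - ny) l)) z)"
        unfolding sum_distrib_right by (intro sum.cong refl) (simp add: rev[OF 2(3)] mult_ac)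
      finally show ?thesis using 2 by (simp add: R_def poly_sum revd)
    next
      case 3
      then show ?thesis using ij by (simp add: \<H>_def dims R_def nf_def)
    next
      case 4
      then show ?thesis using ij z by (simp add: \<H>_def dims R_def nf_def W_def b_def rev)
    qed
  qed
  define H where "H s = mat nf nf (\<lambda>(i, j). poly (moebius_poly D (R i j)) s / poly (moebius_poly D (d * d)) s)" for s
  have stab: "stable_entries nf nf H"
    unfolding stable_entries_def
  proof (intro conjI allI impI)
    fix i j assume ij: "i < nf" "j < nf"
    have "stable_fraction (moebius_poly D (R i j)) (moebius_poly D (d * d)) (\<lambda>s. H s $$ (i, j))"
      using half_plane_fraction[OF _ RD[OF ij] dD] d ij unfolding H_def by simp
    then show "\<exists>p q. stable_fraction p q (\<lambda>s. H s $$ (i, j))" by blast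
  qed (simp add: H_def)
  have Hs: "H s $$ (i, j) = poly (R i j) ((1 - s) / (1 + s)) / poly (d * d) ((1 - s) / (1 + s))"
    if s: "1 + s \<noteq> 0" and ij: "i < nf" "j < nf" for s i j
    using ij s unfolding H_def by (simp add: poly_moebius[OF RD[OF ij] s] poly_moebius[OF dD s])
  define E where "E = {s. poly (moebius_poly e d) s = 0}"
  have "poly (moebius_poly e d) 0 \<noteq> 0" using d[of 1] de by (simp add: poly_moebius)
  then have E: "finite E" unfolding E_def by (intro poly_roots_finite) auto
  \<comment> \<open>Off this finite set \<open>H\<close> and its reflection are given by \<open>\<H>\<close>.\<close>
  define S where "S = {1, -1} \<union> E \<union> (\<lambda>s. - cnj s) ` E"
  have good: "H s = \<H> ((1 - s) / (1 + s)) \<and> H (- cnj s) = \<H> (inverse (cnj ((1 - s) / (1 + s)))) \<and>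
      H s * (H (- cnj s))\<^sup>\<dagger> = 1\<^sub>m nf \<and> (H (- cnj s))\<^sup>\<dagger> * H s = 1\<^sub>m nf" if s: "s \<notin> S" for s
  proof -
    let ?z = "(1 - s) / (1 + s)"
    let ?w = "(1 - (- cnj s)) / (1 + (- cnj s))"
    have s1: "1 + s \<noteq> 0" "1 - s \<noteq> 0" using s unfolding S_def by (auto simp: add_eq_0_iff)
    have s2: "1 + (- cnj s) \<noteq> 0" using s1(2) by (metis complex_cnj_one complex_cnj_diff complex_cnj_zero_iff diff_conv_add_uminus)
    have w: "?w = inverse (cnj ?z)" by (rule moebius_reflection)
    have z0: "?z \<noteq> 0" using s1 by simp
    have sE: "s \<notin> E" "- cnj s \<notin> E" using s unfolding S_def by (force simp: image_iff)+
    have dz: "poly d ?z \<noteq> 0" using sE(1) unfolding E_def by (simp add: poly_moebius[OF de s1(1)])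
    have dw: "poly d ?w \<noteq> 0" using sE(2) unfolding E_def by (simp add: poly_moebius[OF de s2])
    have rz: "refl_eval d ?z \<noteq> 0" using dw unfolding w refl_eval_def by simp
    have rw: "refl_eval d ?w \<noteq> 0" using dz unfolding w refl_eval_def by simp
    have w0: "?w \<noteq> 0" unfolding w using z0 by (simp only: inverse_nonzero_iff_nonzero complex_cnj_zero_iff not_False_eq_True)
    have e1: "H s = \<H> ?z"
      by (rule eq_matI) (use carrier_matD[OF Hc] He[OF z0 dz rz] Hs[OF s1(1)] in \<open>auto simp: H_def\<close>)
    have e2: "H (- cnj s) = \<H> ?w"
      by (rule eq_matI) (use carrier_matD[OF Hc] He[OF w0 dw rw] Hs[OF s2] in \<open>auto simp: H_def\<close>)
    have u: "H s * (H (- cnj s))\<^sup>\<dagger> = 1\<^sub>m nf" unfolding e1 e2 w nf_def by (rule unit[OF z0 dz rz])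
    have "H s \<in> carrier_mat nf nf" "(H (- cnj s))\<^sup>\<dagger> \<in> carrier_mat nf nf" by (simp_all add: H_def)
    from mat_mult_left_right_inverse[OF this u] show ?thesis using e1 e2 u unfolding w by blast
  qed
  have fin: "finite S" using E by (simp add: S_def)
  have "H \<in> admissible_equalizers n ny"
    unfolding admissible_equalizers_def
  proof (rule CollectI, rule exI[of _ q], rule exI[of _ nf], intro conjI)
    show "nf = ny + q" by (simp add: nf_def)
    show "n \<le> nf" using q by (simp add: nf_def)
    show "rational_mat nf nf H"
      using stable_entries_proper[OF stab] unfolding proper_rational_mat_def rational_mat_def by blast
    show "\<forall>s. pole H s \<longrightarrow> Re s < 0" using stable_entries_no_pole[OF stab] by blast
    show "hardy_inf H" by (rule stable_entries_hardy[OF stab])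
    show "\<exists>\<tau>>0. analytic_mat H {s. Re s > - \<tau>}" by (rule stable_entries_analytic_mat[OF stab])
    show "(\<lambda>s. H\<^sup>H s * H s) \<doteq> (\<lambda>s. 1\<^sub>m nf)" "(\<lambda>s. H s * H\<^sup>H s) \<doteq> (\<lambda>s. 1\<^sub>m nf)"
      unfolding tf_eq_def eventually_cofinite para_conj_def using good
      by (auto intro!: finite_subset[OF _ fin])
  qed
  moreover have "top_left n ny H (im_axis x) = F (im_axis x)" for x
  proof (rule eq_matI)
    let ?s = "im_axis x"
    have s: "Re ?s \<ge> 0" "1 + ?s \<noteq> 0" by (simp_all add: complex_eq_iff)
    fix i j assume "i < dim_row (F ?s)" "j < dim_col (F ?s)"
    then have ij: "i < n" "j < ny" using carrier_matD[OF Fc] by auto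
    then have "i < nf" "j < nf" "i < q" using q by (auto simp: nf_def)
    then show "top_left n ny H ?s $$ (i, j) = F ?s $$ (i, j)"
      using ij Hs[OF s(2), of i j] N[OF s(1) ij] d[OF moebius_half_plane[OF s(1)]] UN by (simp add: top_left_def R_def)
  qed (use carrier_matD[OF Fc] in \<open>auto simp: top_left_def\<close>)
  ultimately show ?thesis by blast
qed

text \<open>A feasible filter scaled by \<open>t < 1\<close> is a corner of an equalizer by \<open>paraunitary_completion\<close>, and
  \<open>P_e\<close> on the axis depends only on that corner.\<close>

lemma gamma_opt_le_gamma_opt'':
  assumes Su: "Su \<in> carrier_mat n n" "hermitian Su" "pos_def Su" and Sw: "Sw \<in> carrier_mat nw nw" "hermitian Sw" "pos_def Sw"
  shows "gamma_opt n nw ny G Su Sw \<le> gamma_opt'' n nw ny G Su Sw"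
  unfolding gamma_opt''_def
proof (rule Inf_greatest)
  fix \<gamma>' assume "\<gamma>' \<in> ereal ` {\<gamma>. \<gamma> > 0 \<and> H11_minus n nw ny G Su Sw \<gamma> \<noteq> {}}"
  then obtain g X where gX: "\<gamma>' = ereal g" "g > 0" "X \<in> H11_minus n nw ny G Su Sw g" by auto
  have rat: "proper_rational_mat n ny X" and an: "\<exists>\<tau>>0. analytic_mat X {s. Re s > - \<tau>}"
    and less: "\<And>\<omega>::real. P_e n nw ny G Su Sw X (\<i> * of_real \<omega>) \<prec> complex_of_real (g\<^sup>2) \<cdot>\<^sub>m 1\<^sub>m n"
    and con: "\<And>\<omega>::ereal. freq_value X \<omega> * (freq_value X \<omega>)\<^sup>\<dagger> \<prec> 1\<^sub>m n"
    using gX(3) unfolding H11_minus_def by auto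
  have Xc: "X s \<in> carrier_mat n ny" for s using rat unfolding proper_rational_mat_def by blast
  have contr: "sqnorm ((X (im_axis x))\<^sup>\<dagger> *\<^sub>v u) \<le> sqnorm u"
    if u: "u \<in> carrier_vec n" for x u
  proof (cases "u = 0\<^sub>v n")
    case True
    then have "(X (im_axis x))\<^sup>\<dagger> *\<^sub>v u = 0\<^sub>v ny"
      using mult_vec_zero[of "(X (im_axis x))\<^sup>\<dagger>"] carrier_matD[OF Xc] by simp
    then show ?thesis using cscalar_self_nonneg[of u] by simp
  next
    case False
    then show ?thesis using con[of "ereal x"] u unfolding freq_value_simps contraction_iff[OF Xc] by (simp add: less_imp_le)
  qed
  have "\<exists>F. stable_entries n ny F \<and> (\<forall>s. Re s \<ge> 0 \<longrightarrow> F s = X s)"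
  proof (rule bounded_rational_stable[where M = 1])
    show "rational_mat n ny X" using rat unfolding rational_mat_def proper_rational_mat_def by blast
    show "(\<lambda>s. X s $$ (i, j)) analytic_on {z}" if z: "Re z \<ge> 0" "i < n" "j < ny" for z i j
    proof -
      obtain \<tau> where "\<tau> > 0" "analytic_mat X {s. Re s > - \<tau>}" using an by blast
      then have "(\<lambda>s. X s $$ (i, j)) analytic_on {s. Re s > - \<tau>}"
        using z Xc[of 0] unfolding analytic_mat_def by auto
      then show ?thesis by (rule analytic_on_subset) (use z \<open>\<tau> > 0\<close> in auto)
    qed
    show "cmod (X (im_axis x) $$ (i, j)) \<le> 1" if "i < n" "j < ny" for x i j
      by (rule contraction_adjoint_entry[OF Xc contr that])
  qed
  then obtain F where F: "stable_entries n ny F" "\<forall>s. Re s \<ge> 0 \<longrightarrow> F s = X s" by blast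
  have FX: "F (im_axis x) = X (im_axis x)" for x using F(2) by simp
  note P = P_e_axis[of X, OF Xc Su(1,2) Sw(1,2)]
  have power: "error_form (Phi n nw ny G Su Sw (im_axis x)) (F (im_axis x)) u < g\<^sup>2 * sqnorm u"
    if "u \<in> carrier_vec n" "u \<noteq> 0\<^sub>v n" for x u
    using less[of x] that unfolding FX mat_less_scalar_iff[OF P(1,2)] P(3)[OF that(1), symmetric] by blast
  show "gamma_opt n nw ny G Su Sw \<le> \<gamma>'"
    unfolding gX(1)
  proof (rule ereal_le_epsilon2)
    fix e :: real assume e: "0 < e"
    obtain t where t: "t > 0" "t < 1" and pw: "\<forall>x u. u \<in> carrier_vec n \<longrightarrow> u \<noteq> 0\<^sub>v n \<longrightarrow> error_form (Phi n nw ny G Su Sw (im_axis x)) (complex_of_real t \<cdot>\<^sub>m F (im_axis x)) u < (g + e)\<^sup>2 * sqnorm u"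
      using error_form_scale[OF stable_entries_carrier[OF F(1)] Su Sw power gX(2), of "g + e"] e by auto
    let ?T = "\<lambda>s. complex_of_real t \<cdot>\<^sub>m F s"
    have T: "stable_entries n ny ?T" by (rule stable_entries_smult[OF F(1)])
    have "sqnorm ((?T (im_axis x))\<^sup>\<dagger> *\<^sub>v u) \<le> t\<^sup>2 * sqnorm u"
      if u: "u \<in> carrier_vec n" for x u
    proof -
      let ?w = "(X (im_axis x))\<^sup>\<dagger> *\<^sub>v u"
      have w: "(?T (im_axis x))\<^sup>\<dagger> *\<^sub>v u = complex_of_real t \<cdot>\<^sub>v ?w"
        unfolding FX adjoint_smult using u carrier_matD[OF Xc] by (simp add: smult_mult_vec)
      show ?thesis
        unfolding w using mult_left_mono[OF contr[OF u, of x], of "t\<^sup>2"]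
        by (simp add: cscalar_smult_left cscalar_smult_right power2_eq_square mult.assoc)
    qed
    from paraunitary_completion[OF T t this] obtain H where H: "H \<in> admissible_equalizers n ny"
      and top: "\<forall>x. top_left n ny H (im_axis x) = ?T (im_axis x)" by blast
    have "P_e n nw ny G Su Sw (top_left n ny H) (im_axis x) \<prec> complex_of_real ((g + e)\<^sup>2) \<cdot>\<^sub>m 1\<^sub>m n" for x
    proof -
      note P = P_e_axis[of "top_left n ny H" x n ny, OF _ Su(1,2) Sw(1,2)]
      have c: "top_left n ny H (im_axis x) \<in> carrier_mat n ny" by (simp add: top_left_def)
      show ?thesis unfolding mat_less_scalar_iff[OF P(1)[OF c] P(2)[OF c]]
        using P(3)[OF c] pw top by simp
    qed
    then have "gamma_opt n nw ny G Su Sw \<le> ereal (g + e)"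
      unfolding gamma_opt_def using gX(2) e H by (intro Inf_lower imageI CollectI conjI bexI[of _ H] allI) auto
    then show "gamma_opt n nw ny G Su Sw \<le> ereal g + ereal e" by simp
  qed
qed

theorem corollary1:
  fixes n nw ny nd k p m m11 :: nat
    and A B C D Su Sw :: "complex mat"
    and G Ups :: "complex \<Rightarrow> complex mat"
    and l gbar g \<theta> :: real
    and Al Bl C1 C2 D1 D2 Nc :: "complex mat"
  assumes channel: "quantum_channel n nw ny nd k A B C D"
    and G: "G = state_space A B C D"
    and Su: "Su \<in> carrier_mat n n" "hermitian Su" "pos_def Su"
    and Sw: "Sw \<in> carrier_mat nw nw" "hermitian Sw" "pos_def Sw"
    and l: "l \<ge> 0"
    and Ups_rational: "rational_mat (ny + n) p Ups"
    and Ups_stable: "\<exists>\<tau>>0. (\<forall>s. pole Ups s \<longrightarrow> Re s < - \<tau>) \<and> analytic_mat Ups {s. Re s > - \<tau>}"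
    and factorization: "Phi_lambda n nw ny G Su Sw l \<doteq> (\<lambda>s. Ups s * Ups\<^sup>H s)"
    and dims: "C1 \<in> carrier_mat ny m" "C2 \<in> carrier_mat n m"
      "D1 \<in> carrier_mat ny p" "D2 \<in> carrier_mat n p"
    and realization: "minimal_realization (ny + n) p m Al Bl (C1 @\<^sub>r C2) (D1 @\<^sub>r D2) Ups"
    and Al: "hurwitz Al"
    and Nc: "full_rank Nc" "dim_row Nc = m + p" "mat_image Nc = mat_kernel (C1 @\<^sub>c D1)"
    and m11: "m11 = m"
    and gbar: "gbar > 0"
    and feasible: "\<exists>X1 Y1. lmi_feasible m n p l Al Bl C2 D2 Nc gbar X1 Y1"
    and g: "g = sqrt (gbar\<^sup>2 - l\<^sup>2)"
    and \<theta>: "\<theta> > 0"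
      "\<forall>\<omega>::ereal. pos_def (freq_value (\<lambda>s.
         complex_of_real \<theta> \<cdot>\<^sub>m (Phi n nw ny G Su Sw s - complex_of_real (g\<^sup>2) \<cdot>\<^sub>m E22 n ny)
         - four_block_mat (1\<^sub>m ny) (0\<^sub>m ny n) (0\<^sub>m n ny) (- 1\<^sub>m n)) \<omega>)"
  shows "g > 0 \<and>
    H11_minus n nw ny G Su Sw g \<noteq> {} \<and>
    ereal g \<ge> gamma_opt'' n nw ny G Su Sw \<and>
    gamma_opt'' n nw ny G Su Sw = gamma_opt n nw ny G Su Sw \<and>
    (\<exists>A11 B11 C11 J11.
       design_inequality m m11 n ny p Al Bl C1 C2 D1 D2 gbar A11 B11 C11 J11) \<and>
    (\<forall>A11 B11 C11 J11.
       design_inequality m m11 n ny p Al Bl C1 C2 D1 D2 gbar A11 B11 C11 J11 \<longrightarrow>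
       state_space A11 B11 C11 J11 \<in> H11_minus n nw ny G Su Sw g)"
proof (intro conjI)
  obtain X1 Y1 where lmi: "lmi_feasible m n p l Al Bl C2 D2 Nc gbar X1 Y1" using feasible by blast
  then have less: "l\<^sup>2 < gbar\<^sup>2" unfolding lmi_feasible_def by blast
  show g0: "g > 0" unfolding g using less by simp
  have g2: "g\<^sup>2 = gbar\<^sup>2 - l\<^sup>2" unfolding g using less by simp
  have real: "Al \<in> carrier_mat m m" "Bl \<in> carrier_mat m p"
    using realization unfolding minimal_realization_def is_realization_def by auto
  show ex: "\<exists>A11 B11 C11 J11. design_inequality m m11 n ny p Al Bl C1 C2 D1 D2 gbar A11 B11 C11 J11"
    unfolding m11 by (rule design_exists[OF real dims Nc(2,3) lmi])
  show member: "\<forall>A11 B11 C11 J11. design_inequality m m11 n ny p Al Bl C1 C2 D1 D2 gbar A11 B11 C11 J11 \<longrightarrow>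
      state_space A11 B11 C11 J11 \<in> H11_minus n nw ny G Su Sw g"
    using design_member[OF channel G Su(1,2) Sw(1,2) factorization dims realization Al g2 \<theta>] by blast
  show nonempty: "H11_minus n nw ny G Su Sw g \<noteq> {}" using ex member by blast
  show "gamma_opt'' n nw ny G Su Sw \<le> ereal g"
    unfolding gamma_opt''_def using g0 nonempty by (intro Inf_lower) auto
  show "gamma_opt'' n nw ny G Su Sw = gamma_opt n nw ny G Su Sw"
    by (rule antisym[OF gamma_opt''_le_gamma_opt[OF Su Sw] gamma_opt_le_gamma_opt''[OF Su Sw]])
qed

end
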